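(* Let $\alpha\in(0,1)$, $\beta\in(0,2]$ and $d\in\mathbb{Z}_+$. There exists a sequence $(u_n)_{n=1}^\infty$ of smooth, positive solutions to the equation $$\partial_t^\alpha\big(u_n-u_n|_{t=0}\big)+(-\Delta)^{\beta/2}u_n=0\quad\text{in }(0,\infty)\times\mathbb{R}^d$$ such that for all $t_1,t_2>0$ there holds $$\frac{u_n(t_1,0)}{\|u_n(t_2,\cdot)\|_{L^p(\mathbb{R}^d)}}\to\infty\quad\text{as }n\to\infty,$$ if (i) $d>\beta$ and $1\le p<\frac{d}{\beta}$, or (ii) $d=\beta$ and $p=1$.
   Context: For $0<\alpha<1$, $\partial_t^\alpha$ is the Riemann-Liouville fractional derivative in time, $$\partial_t^\alpha f(t)=\frac{d}{dt}\,\frac{1}{\Gamma(1-\alpha)}\int_0^t(t-\tau)^{-\alpha}f(\tau)\,d\tau .$$ $(-\Delta)^{\beta/2}$ acts in the space variable as the Fourier multiplier with symbol $|\xi|^\beta$ (so it is $-\Delta$ for $\beta=2$). Under suitable conditions on $u_0$, the classical solution of the Cauchy problem $\partial_t^\alpha(u-u_0)+(-\Delta)^{\beta/2}u=0$, $u(0,x)=u_0(x)$, is given by $u(t,x)=\int_{\mathbb{R}^d}Z(t,x-y)u_0(y)\,dy$. Here $Z$ is the fundamental solution, i.e. for each $t>0$ the probability density $Z(t,\cdot)$ on $\mathbb{R}^d$ (continuous on $\mathbb{R}^d\setminus\{0\}$) with Fourier transform $\widehat Z(t,\xi)=(2\pi)^{-d/2}E_\alpha(-|\xi|^\beta t^\alpha)$,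 where $\widehat f(\xi)=(2\pi)^{-d/2}\int_{\mathbb{R}^d}e^{-ix\cdot\xi}f(x)\,dx$ and $E_\alpha(z)=\sum_{k=0}^\infty z^k/\Gamma(1+\alpha k)$ is the Mittag-Leffler function. *)

theory Defs
  imports "HOL-Analysis.Analysis"
begin

text \<open>\<open>C_k k S f\<close>: \<open>f\<close> has continuous partial derivatives up to order \<open>k\<close> on the open set \<open>S\<close>.\<close>

primrec C_k :: "nat \<Rightarrow> 'a::euclidean_space set \<Rightarrow> ('a \<Rightarrow> real) \<Rightarrow> bool" where
  "C_k 0 S f \<longleftrightarrow> continuous_on S f"
| "C_k (Suc k) S f \<longleftrightarrow>
     (\<forall>x\<in>S. f differentiable (at x)) \<and>
     (\<forall>b\<in>Basis. C_k k S (\<lambda>x. frechet_derivative f (at x) b))"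

definition smooth_on :: "'a::euclidean_space set \<Rightarrow> ('a \<Rightarrow> real) \<Rightarrow> bool" where
  "smooth_on S f \<longleftrightarrow> (\<forall>k. C_k k S f)"

definition frac_integral :: "real \<Rightarrow> (real \<Rightarrow> real) \<Rightarrow> real \<Rightarrow> real" where
  "frac_integral \<alpha> f t =
     1 / Gamma (1 - \<alpha>) * (LINT \<tau>:{0..t}|lborel. (t - \<tau>) powr (- \<alpha>) * f \<tau>)"

definition has_RL_derivative :: "real \<Rightarrow> (real \<Rightarrow> real) \<Rightarrow> real \<Rightarrow> real \<Rightarrow> bool" where
  "has_RL_derivative \<alpha> f D t \<longleftrightarrow>
     (\<forall>s>0. set_integrable lborel {0..s} (\<lambda>\<tau>. (s - \<tau>) powr (- \<alpha>) * f \<tau>)) \<and>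
     (frac_integral \<alpha> f has_real_derivative D) (at t)"

definition fourier :: "(real ^ 'd \<Rightarrow> complex) \<Rightarrow> real ^ 'd \<Rightarrow> complex" where
  "fourier f \<xi> = of_real ((2 * pi) powr (- real CARD('d) / 2)) *
     (LINT x|lborel. exp (- (\<i> * of_real (x \<bullet> \<xi>))) * f x)"

definition inv_fourier :: "(real ^ 'd \<Rightarrow> complex) \<Rightarrow> real ^ 'd \<Rightarrow> complex" where
  "inv_fourier g x = of_real ((2 * pi) powr (- real CARD('d) / 2)) *
     (LINT \<xi>|lborel. exp (\<i> * of_real (x \<bullet> \<xi>)) * g \<xi>)"

definition frac_laplacian_symbol ::
    "real \<Rightarrow> (real ^ 'd \<Rightarrow> real) \<Rightarrow> real ^ 'd \<Rightarrow> complex" where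
  "frac_laplacian_symbol \<beta> f \<xi> =
     of_real (norm \<xi> powr \<beta>) * fourier (\<lambda>x. of_real (f x)) \<xi>"

text \<open>\<open>has_frac_laplacian \<beta> f g\<close>: the Fourier multiplier with symbol \<open>|\<xi>|\<^sup>\<beta>\<close> maps \<open>f\<close> to \<open>g\<close>.
  Both integrals (for \<open>f\<close> and for the inverse transform) are required to converge
  absolutely, so \<open>g\<close> is determined pointwise.\<close>

definition has_frac_laplacian ::
    "real \<Rightarrow> (real ^ 'd \<Rightarrow> real) \<Rightarrow> (real ^ 'd \<Rightarrow> real) \<Rightarrow> bool" where
  "has_frac_laplacian \<beta> f g \<longleftrightarrow>
     integrable lborel f \<and>
     integrable lborel (frac_laplacian_symbol \<beta> f) \<and>
     (\<forall>x. complex_of_real (g x) = inv_fourier (frac_laplacian_symbol \<beta> f) x)"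

text \<open>Classical solutions, with the equation holding at every point of \<open>(0,\<infinity>) \<times> \<real>\<^sup>d\<close>. Continuity up to
  \<open>t = 0\<close> makes \<open>u 0\<close> the initial trace \<open>u|\<^sub>t\<^sub>=\<^sub>0\<close>.\<close>

definition time_frac_solution ::
    "real \<Rightarrow> real \<Rightarrow> (real \<Rightarrow> real ^ 'd \<Rightarrow> real) \<Rightarrow> bool" where
  "time_frac_solution \<alpha> \<beta> u \<longleftrightarrow>
     continuous_on ({0..} \<times> UNIV) (\<lambda>(t, x). u t x) \<and>
     (\<forall>t>0. \<exists>D L. (\<forall>x. has_RL_derivative \<alpha> (\<lambda>s. u s x - u 0 x) (D x) t) \<and>
                 has_frac_laplacian \<beta> (u t) L \<and>
                 (\<forall>x. D x + L x = 0))"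

text \<open>If \<open>|f|\<^sup>p\<close> is not integrable, the value is 0 instead of \<open>\<infinity>\<close>; a quotient \<open>a / Lp_norm p f\<close> is then 0,
  as it would be with the value \<open>\<infinity>\<close>.\<close>

definition Lp_norm :: "real \<Rightarrow> (real ^ 'd \<Rightarrow> real) \<Rightarrow> real" where
  "Lp_norm p f = (LINT x|lborel. \<bar>f x\<bar> powr p) powr (1 / p)"

end

theory Submission
  imports Defs "HOL-Probability.Probability" "HOL-Complex_Analysis.Complex_Analysis"
begin

text \<open>
Write \<open>E\<close> for the Mittag-Leffler function \<open>E\<^sub>\<alpha>\<close> and \<open>d\<close> for the dimension. The solutions are
\<open>u\<^sub>n(t, x) = \<integral> cos (x \<bullet> \<xi>) E(- |\<xi>|\<^sup>\<beta> t\<^sup>\<alpha>) exp (- |\<xi>|\<^sup>2 / n) d\<xi>\<close>, whose initial data are Gaussians of fixed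
mass, height of order \<open>n\<^sup>d\<^sup>/\<^sup>2\<close> and width of order \<open>n\<^sup>-\<^sup>1\<^sup>/\<^sup>2\<close>.

The norms are controlled by conservation of mass and the bound \<open>|u\<^sub>n| \<le> (\<pi> n)\<^sup>d\<^sup>/\<^sup>2\<close>: interpolation gives an
\<open>L\<^sup>p\<close> norm of order at most \<open>n\<close> to the power \<open>(d / 2) (1 - 1 / p)\<close>, at every time. The value at the origin
is \<open>\<integral> E(- |\<xi>|\<^sup>\<beta> t\<^sup>\<alpha>) exp (- |\<xi>|\<^sup>2 / n) d\<xi>\<close>, and \<open>E(- x)\<close> decays only like \<open>1 / x\<close>
(\<open>mittag_leffler_lower_bound\<close>). Frequencies up to \<open>sqrt n\<close> therefore contribute at least a multiple of
\<open>n\<close> to the power \<open>(d - \<beta>) / 2\<close>, which beats the norm if \<open>p < d / \<beta>\<close> (\<open>ratio_blowup_subcritical\<close>). For \<open>d = \<beta>\<close> the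
integral of \<open>|\<xi>|\<^sup>-\<^sup>d\<close> diverges logarithmically at infinity while the mass stays fixed
(\<open>ratio_blowup_critical\<close>).

Positivity, smoothness and the equation rest on one fact: for \<open>0 < \<gamma> \<le> 1\<close> and \<open>c \<ge> 0\<close> the function
\<open>z \<mapsto> E(- c z\<^sup>\<gamma>)\<close> is the Laplace transform of a measure of mass at most one
(\<open>laplace_cone_mittag_leffler\<close>). It is obtained by approximating \<open>E(- x)\<close> by generating functions of the
number of tables in the Chinese restaurant process, polynomials with nonnegative coefficients in
\<open>1 / (1 + x / n\<^sup>\<alpha>)\<close>, and by expanding \<open>1 / (1 + c z\<^sup>\<gamma>)\<close> into exponentials with nonnegative weights.

In the variable \<open>z = |\<xi>|\<^sup>2\<close> with \<open>\<gamma> = \<beta> / 2\<close> it makes \<open>u\<^sub>n(t, \<cdot>)\<close> a mixture of Gaussians, hence positive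
(\<open>gaussian_wave_pos\<close>). Positivity in turn gives integrability and the Fourier transform of \<open>u\<^sub>n(t, \<cdot>)\<close>
(\<open>fourier_inversion_nonneg\<close>), so that the fractional Laplacian can be computed. In the variable \<open>z = t\<close>
with \<open>\<gamma> = \<alpha>\<close> it bounds all time derivatives uniformly in \<open>\<xi>\<close>, and smoothness follows by differentiating
under the integral (\<open>relaxation_wave_smooth\<close>). The equation itself holds for each frequency: the power
series of \<open>E\<close> is integrated termwise against the kernel \<open>(t - \<tau>)\<^sup>-\<^sup>\<alpha>\<close> with Beta integrals
(\<open>mittag_leffler_fractional_integral\<close>), and Fubini's theorem assembles the frequencies.
\<close>

section \<open>Laplace transforms of measures of mass at most one\<close>

text \<open>On the right half-plane the members are the Laplace transforms \<open>z \<mapsto> \<integral> exp (- r z) d\<mu>(r)\<close> of measures \<open>\<mu>\<close>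
on \<open>[0, \<infinity>)\<close> with total mass at most one. Describing them by closure properties makes limits
immediate, where measures would need a compactness theorem, and turns every linear
consequence of positivity into a rule induction. Only points with \<open>Re z > 0\<close> matter, so the limit
rule asks for nothing elsewhere. Complex arguments are kept because the bound by one on a half-plane
yields derivative estimates through Cauchy's inequality.\<close>

inductive_set laplace_cone :: "(complex \<Rightarrow> complex) set" where
  exp: "0 \<le> r \<Longrightarrow> (\<lambda>z. exp (- (of_real r * z))) \<in> laplace_cone"
| mix: "(\<And>i. i < N \<Longrightarrow> f i \<in> laplace_cone) \<Longrightarrow> (\<And>i. i < N \<Longrightarrow> 0 \<le> w i) \<Longrightarrow> (\<Sum>i<N. w i) \<le> (1::real)
    \<Longrightarrow> (\<lambda>z. \<Sum>i<(N::nat). of_real (w i) * f i z) \<in> laplace_cone"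
| lim: "(\<And>n::nat. f n \<in> laplace_cone) \<Longrightarrow> (\<And>z. Re z > 0 \<Longrightarrow> (\<lambda>n. f n z) \<longlonglongrightarrow> g z)
    \<Longrightarrow> g \<in> laplace_cone"

lemma laplace_cone_norm_le:
  assumes "f \<in> laplace_cone" "Re z > 0"
  shows "norm (f z) \<le> 1"
  using assms
proof (induction arbitrary: z)
  case (exp r)
  then show ?case by simp
next
  case (mix N f w)
  have "norm (\<Sum>i<N. of_real (w i) * f i z) \<le> (\<Sum>i<N. norm (of_real (w i) * f i z))"
    by (rule norm_sum)
  also have "\<dots> \<le> (\<Sum>i<N. w i * 1)"
    using mix by (intro sum_mono) (auto simp: norm_mult intro!: mult_left_le)
  also have "\<dots> \<le> 1" using mix by simp
  finally show ?case .
next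
  case (lim f g)
  from lim.hyps(2)[OF lim.prems] have "(\<lambda>n. norm (f n z)) \<longlonglongrightarrow> norm (g z)"
    by (rule tendsto_norm)
  then show ?case by (rule LIMSEQ_le_const2) (use lim in auto)
qed

text \<open>Convolution of measures: the exponents of two exponentials add, and products distribute over
mixtures and limits, first in the second factor and then in the first.\<close>

lemma laplace_cone_mult:
  assumes "f \<in> laplace_cone" "g \<in> laplace_cone"
  shows "(\<lambda>z. f z * g z) \<in> laplace_cone"
proof -
  have E: "(\<lambda>z. exp (- (of_real r * z)) * g z) \<in> laplace_cone" if "0 \<le> r" "g \<in> laplace_cone" for r g
    using that(2)
  proof induction
    case (exp s)
    then show ?case
      using laplace_cone.exp[of "r + s"] that(1) by (simp add: exp_add [symmetric] algebra_simps)
  next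
    case (mix N f w)
    have "(\<lambda>z. \<Sum>i<N. of_real (w i) * (exp (- (of_real r * z)) * f i z)) \<in> laplace_cone"
      by (rule laplace_cone.mix) (use mix in auto)
    then show ?case by (simp add: sum_distrib_left mult.left_commute)
  next
    case (lim f g)
    show ?case
      by (rule laplace_cone.lim[where f = "\<lambda>n z. exp (- (of_real r * z)) * f n z"])
        (use lim in \<open>auto intro!: tendsto_intros\<close>)
  qed
  show ?thesis using assms(1)
  proof induction
    case (exp r)
    then show ?case using E assms(2) by blast
  next
    case (mix N f w)
    have "(\<lambda>z. \<Sum>i<N. of_real (w i) * (f i z * g z)) \<in> laplace_cone"
      by (rule laplace_cone.mix) (use mix in auto)
    then show ?case by (simp add: sum_distrib_right mult.assoc)
  next
    case (lim f h)
    show ?case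
      by (rule laplace_cone.lim[where f = "\<lambda>n z. f n z * g z"])
        (use lim in \<open>auto intro!: tendsto_intros\<close>)
  qed
qed

lemma laplace_cone_one: "(\<lambda>z. 1) \<in> laplace_cone"
  using laplace_cone.exp[of 0] by simp

lemma laplace_cone_power: "f \<in> laplace_cone \<Longrightarrow> (\<lambda>z. f z ^ k) \<in> laplace_cone"
  by (induction k) (auto intro: laplace_cone_one laplace_cone_mult)

lemma laplace_cone_sums:
  assumes "\<And>i. f i \<in> laplace_cone" "\<And>i. 0 \<le> w i" "\<And>N. (\<Sum>i<N. w i) \<le> (1::real)"
    and "\<And>z. Re z > 0 \<Longrightarrow> (\<lambda>i. of_real (w i) * f i z) sums g z"
  shows "g \<in> laplace_cone"
proof (rule laplace_cone.lim)
  fix N :: nat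
  show "(\<lambda>z. \<Sum>i<N. of_real (w i) * f i z) \<in> laplace_cone"
    by (rule laplace_cone.mix) (use assms in auto)
qed (use assms(4) in \<open>simp add: sums_def\<close>)

text \<open>The coefficients in \<open>1 - (1 - z) powr \<gamma> = (\<Sum>k. binom_weight \<gamma> k * z ^ k)\<close>. For \<open>0 < \<gamma> \<le> 1\<close> they
form a probability distribution, the Sibuya law, and this function is its generating function.\<close>

definition binom_weight :: "real \<Rightarrow> nat \<Rightarrow> real" where
  "binom_weight \<gamma> k = (if k = 0 then 0 else - ((-1) ^ k * (\<gamma> gchoose k)))"

text \<open>Consecutive coefficients have the ratio \<open>(k - \<gamma>) / (k + 1)\<close>, which is nonnegative from \<open>k = 1\<close>
on because \<open>\<gamma> \<le> 1\<close>.\<close>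

lemma binom_weight_nonneg:
  assumes "0 < \<gamma>" "\<gamma> \<le> 1"
  shows "0 \<le> binom_weight \<gamma> k"
proof (induction k)
  case 0
  then show ?case by (simp add: binom_weight_def)
next
  case (Suc k)
  show ?case
  proof (cases "k = 0")
    case True
    then show ?thesis using assms by (simp add: binom_weight_def)
  next
    case False
    have "real (Suc k) * (\<gamma> gchoose Suc k) = (\<gamma> - real k) * (\<gamma> gchoose k)"
      using gbinomial_mult_1[of \<gamma> k] by (simp add: algebra_simps)
    then have eq: "\<gamma> gchoose Suc k = (\<gamma> - real k) * (\<gamma> gchoose k) / real (Suc k)"
      by (simp add: field_simps)
    then have "binom_weight \<gamma> (Suc k) = binom_weight \<gamma> k * ((real k - \<gamma>) / real (Suc k))"
    proof -
      have "binom_weight \<gamma> (Suc k) = (-1) ^ k * ((\<gamma> - real k) * (\<gamma> gchoose k) / real (Suc k))"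
        unfolding binom_weight_def eq by simp
      also have "\<dots> = - ((-1) ^ k * (\<gamma> gchoose k)) * ((real k - \<gamma>) / real (Suc k))"
        by (simp add: divide_inverse algebra_simps)
      finally show ?thesis using False by (simp add: binom_weight_def)
    qed
    moreover have "real k \<ge> \<gamma>" using assms False by (cases k) auto
    ultimately show ?thesis using Suc by (simp add: zero_le_mult_iff)
  qed
qed

lemma binom_weight_sums:
  assumes "norm (z :: complex) < 1"
  shows "(\<lambda>k. of_real (binom_weight \<gamma> k) * z ^ k) sums (1 - (1 - z) powr of_real \<gamma>)"
proof -
  have "(\<lambda>k. (of_real \<gamma> gchoose k) * (- z) ^ k) sums (1 + (- z)) powr of_real \<gamma>"
    by (rule gen_binomial_complex) (use assms in simp)
  then have "(\<lambda>k. (if k = 0 then 1 else 0) - (of_real \<gamma> gchoose k) * (- z) ^ k) sums (1 - (1 - z) powr of_real \<gamma>)"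
    using sums_single[of 0 "\<lambda>_. 1::complex"] by (intro sums_diff) auto
  moreover have "(if k = 0 then 1 else 0) - (complex_of_real \<gamma> gchoose k) * (- z) ^ k
     = of_real (binom_weight \<gamma> k) * z ^ k" for k
  proof -
    have "(of_real \<gamma> gchoose k) = complex_of_real (\<gamma> gchoose k)"
      by (simp add: gbinomial_prod_rev)
    then show ?thesis by (simp add: binom_weight_def power_minus[of z])
  qed
  ultimately show ?thesis by simp
qed

text \<open>Every partial sum at \<open>0 < x < 1\<close> is at most \<open>1 - (1 - x) powr \<gamma> \<le> 1\<close>; then \<open>x\<close> tends to \<open>1\<close>.\<close>

lemma binom_weight_sum_le:
  assumes "0 < \<gamma>" "\<gamma> \<le> 1"
  shows "(\<Sum>k<N. binom_weight \<gamma> k) \<le> 1"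
proof -
  have le: "(\<Sum>k<N. binom_weight \<gamma> k * x ^ k) \<le> 1" if x: "0 < x" "x < 1" for x :: real
  proof -
    have "(\<lambda>k. (\<gamma> gchoose k) * (- x) ^ k) sums (1 + (- x)) powr \<gamma>"
      by (rule gen_binomial_real) (use x in simp)
    then have "(\<lambda>k. (if k = 0 then 1 else 0) - (\<gamma> gchoose k) * (- x) ^ k) sums (1 - (1 - x) powr \<gamma>)"
      using sums_single[of 0 "\<lambda>_. 1::real"] by (intro sums_diff) auto
    moreover have "(if k = 0 then 1 else 0) - (\<gamma> gchoose k) * (- x) ^ k = binom_weight \<gamma> k * x ^ k" for k
      by (simp add: binom_weight_def power_minus[of x])
    ultimately have s: "(\<lambda>k. binom_weight \<gamma> k * x ^ k) sums (1 - (1 - x) powr \<gamma>)" by simp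
    have "(\<Sum>k<N. binom_weight \<gamma> k * x ^ k) \<le> 1 - (1 - x) powr \<gamma>"
      using s x assms binom_weight_nonneg by (intro sum_le_suminf[where I = "{..<N}" and f = "\<lambda>k. binom_weight \<gamma> k * x ^ k", folded sums_unique[OF s]])
        (auto simp: sums_iff)
    then show ?thesis using powr_ge_zero[of "1 - x" \<gamma>] by linarith
  qed
  have "((\<lambda>x. \<Sum>k<N. binom_weight \<gamma> k * x ^ k) \<longlongrightarrow> (\<Sum>k<N. binom_weight \<gamma> k * 1 ^ k)) (at_left 1)"
    by (intro tendsto_intros)
  moreover have "eventually (\<lambda>x. (\<Sum>k<N. binom_weight \<gamma> k * x ^ k) \<le> 1) (at_left 1)"
    using eventually_at_left_real[of 0 1] by (auto elim!: eventually_mono intro: le)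
  ultimately have "(\<Sum>k<N. binom_weight \<gamma> k * 1 ^ k) \<le> 1"
    by (rule tendsto_upperbound) simp
  then show ?thesis by simp
qed

lemma Re_powr_pos:
  assumes "Re z > 0" "0 \<le> \<gamma>" "\<gamma> \<le> 1"
  shows "Re (z powr of_real \<gamma>) > 0"
proof -
  have z: "z \<noteq> 0" using assms by auto
  have "\<bar>Im (Ln z)\<bar> < pi/2" using Re_Ln_pos_lt[OF z] assms by auto
  then have "\<bar>\<gamma> * Im (Ln z)\<bar> < pi/2"
    using assms mult_left_le_one_le[of "\<bar>Im (Ln z)\<bar>" \<gamma>] by (simp add: abs_mult)
  then have "cos (\<gamma> * Im (Ln z)) > 0" by (intro cos_gt_zero_pi) auto
  then show ?thesis using z by (simp add: powr_def Re_exp)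
qed

lemma one_plus_powr_nonzero:
  assumes "Re z > 0" "0 \<le> \<gamma>" "\<gamma> \<le> 1" "0 \<le> c"
  shows "1 + of_real c * z powr of_real \<gamma> \<noteq> 0"
proof -
  have "Re (1 + of_real c * z powr of_real \<gamma>) \<ge> 1"
    using Re_powr_pos[OF assms(1-3)] assms by simp
  then show ?thesis by (auto simp del: plus_complex.simps)
qed

text \<open>With \<open>z = exp (- h w)\<close> the function \<open>\<phi> = 1 - (1 - exp (- h w)) powr \<gamma>\<close> is the transform of a measure
on the lattice \<open>h \<nat>\<close>, and \<open>1 / (1 + S (1 - \<phi>))\<close> is a geometric series in \<open>\<phi>\<close> whose weights
\<open>(1 - q) q ^ k\<close>, \<open>q = S / (1 + S)\<close>, sum to one.\<close>

lemma laplace_cone_resolvent_diff: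
  assumes \<gamma>: "0 < \<gamma>" "\<gamma> \<le> 1" and h: "0 < h" and S: "0 \<le> S"
  shows "(\<lambda>z. 1 / (1 + of_real S * (1 - exp (- (of_real h * z))) powr of_real \<gamma>)) \<in> laplace_cone"
proof -
  define \<phi> where "\<phi> z = 1 - (1 - exp (- (of_real h * z))) powr of_real \<gamma>" for z :: complex
  have lt: "norm (exp (- (of_real h * z))) < 1" if "Re z > 0" for z
    using h that by simp
  have \<phi>: "\<phi> \<in> laplace_cone"
  proof (rule laplace_cone_sums)
    show "(\<lambda>z. exp (- (of_real h * z)) ^ k) \<in> laplace_cone" for k
      by (intro laplace_cone_power laplace_cone.exp) (use h in simp)
    show "(\<lambda>k. of_real (binom_weight \<gamma> k) * exp (- (of_real h * z)) ^ k) sums \<phi> z" if "Re z > 0" for z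
      unfolding \<phi>_def by (rule binom_weight_sums[OF lt[OF that]])
  qed (use binom_weight_nonneg binom_weight_sum_le \<gamma> in auto)
  define q where "q = S / (1 + S)"
  have q: "0 \<le> q" "q < 1" and q1: "1 - q = 1 / (1 + S)" using S by (auto simp: q_def field_simps)
  show ?thesis
  proof (rule laplace_cone_sums)
    show "(\<lambda>z. \<phi> z ^ k) \<in> laplace_cone" for k by (rule laplace_cone_power[OF \<phi>])
    show "0 \<le> (1 - q) * q ^ k" for k using q by simp
    show "(\<Sum>k<N. (1 - q) * q ^ k) \<le> 1" for N
      using q by (simp add: sum_distrib_left[symmetric] one_diff_power_eq[symmetric])
    fix z :: complex assume z: "Re z > 0"
    have "norm (of_real q * \<phi> z) \<le> q * 1" unfolding norm_mult
      using q laplace_cone_norm_le[OF \<phi> z] by (intro mult_mono) auto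
    then have n: "norm (of_real q * \<phi> z) < 1" using q by simp
    then have "(\<lambda>k. of_real (1 - q) * (of_real q * \<phi> z) ^ k) sums (of_real (1 - q) * (1 / (1 - of_real q * \<phi> z)))"
      by (intro sums_mult geometric_sums)
    moreover have "of_real (1 - q) * (1 / (1 - of_real q * \<phi> z)) = 
       1 / (1 + of_real S * (1 - exp (- (of_real h * z))) powr of_real \<gamma>)"
    proof -
      define P where "P = (1 - exp (- (of_real h * z))) powr complex_of_real \<gamma>"
      have q1': "complex_of_real (1 - q) = 1 / of_real (1 + S)" by (simp only: q1 of_real_divide of_real_1)
      have "q * (1 + S) = S" using S by (simp add: q_def)
      then have qS: "complex_of_real q * of_real (1 + S) = of_real S" by (metis of_real_mult)
      have "of_real (1 + S) * (1 - of_real q * \<phi> z) = of_real (1 + S) - (of_real q * of_real (1 + S)) * \<phi> z"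
        by (simp only: right_diff_distrib mult_1_right mult_1_left mult_ac)
      also have "\<dots> = 1 + of_real S * P"
        unfolding qS \<phi>_def P_def[symmetric] by (simp add: algebra_simps)
      finally have eq: "of_real (1 + S) * (1 - of_real q * \<phi> z) = 1 + of_real S * P" .
      show ?thesis unfolding P_def[symmetric] eq[symmetric] q1' by simp
    qed
    ultimately show "(\<lambda>k. of_real ((1 - q) * q ^ k) * \<phi> z ^ k) sums
        (1 / (1 + of_real S * (1 - exp (- (of_real h * z))) powr of_real \<gamma>))"
      by (simp add: power_mult_distrib mult_ac)
  qed
qed

text \<open>The lattice version with \<open>S = c / h powr \<gamma>\<close> replaces \<open>z\<close> by the difference quotient
\<open>(1 - exp (- h z)) / h\<close>, which tends to \<open>z\<close> as \<open>h\<close> tends to \<open>0\<close>.\<close>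

lemma laplace_cone_resolvent:
  assumes \<gamma>: "0 < \<gamma>" "\<gamma> \<le> 1" and c: "0 \<le> c"
  shows "(\<lambda>z. 1 / (1 + of_real c * z powr of_real \<gamma>)) \<in> laplace_cone"
proof (rule laplace_cone.lim)
  define h where "h n = inverse (real (Suc n))" for n
  have h: "h n > 0" for n by (simp add: h_def)
  show "(\<lambda>z. 1 / (1 + of_real (c * h n powr (- \<gamma>)) * (1 - exp (- (of_real (h n) * z))) powr of_real \<gamma>)) \<in> laplace_cone" for n
    by (rule laplace_cone_resolvent_diff) (use assms h in auto)
  fix z :: complex assume z: "Re z > 0"
  have h0: "h \<longlonglongrightarrow> 0" unfolding h_def by (rule LIMSEQ_inverse_real_of_nat)
  have "((\<lambda>x. 1 - exp (- (x * z))) has_field_derivative z) (at 0)"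
    by (auto intro!: derivative_eq_intros)
  then have "((\<lambda>x. (1 - exp (- (x * z))) / x) \<longlongrightarrow> z) (at 0)"
    by (simp add: has_field_derivative_iff)
  moreover have "filterlim (\<lambda>n. complex_of_real (h n)) (at 0) sequentially"
    using h0 h by (auto simp: filterlim_at tendsto_of_real_iff[where c=0, simplified] less_imp_neq[symmetric] intro!: always_eventually)
  ultimately have l: "(\<lambda>n. (1 - exp (- (of_real (h n) * z))) / of_real (h n)) \<longlonglongrightarrow> z"
    by (rule filterlim_compose)
  have "z \<notin> \<real>\<^sub>\<le>\<^sub>0" using z by (auto simp: complex_nonpos_Reals_iff)
  with l have "(\<lambda>n. ((1 - exp (- (of_real (h n) * z))) / of_real (h n)) powr of_real \<gamma>) \<longlonglongrightarrow> z powr of_real \<gamma>"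
    by (intro tendsto_powr_complex tendsto_const) auto
  moreover have "((1 - exp (- (of_real (h n) * z))) / of_real (h n)) powr of_real \<gamma> 
     = of_real (h n powr (- \<gamma>)) * (1 - exp (- (of_real (h n) * z))) powr of_real \<gamma>" for n
  proof -
    have "(of_real (inverse (h n)) * (1 - exp (- (of_real (h n) * z)))) powr of_real \<gamma>
      = of_real (inverse (h n)) powr of_real \<gamma> * (1 - exp (- (of_real (h n) * z))) powr of_real \<gamma>"
      by (rule powr_times_real_left) (use h[of n] in auto)
    moreover have "of_real (inverse (h n)) powr of_real \<gamma> = complex_of_real (h n powr (- \<gamma>))"
      using h[of n] by (subst powr_of_real) (auto simp: powr_minus inverse_powr)
    ultimately show ?thesis by (simp add: field_simps)
  qed
  ultimately have "(\<lambda>n. of_real (h n powr (- \<gamma>)) * (1 - exp (- (of_real (h n) * z))) powr of_real \<gamma>)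
     \<longlonglongrightarrow> z powr of_real \<gamma>" by simp
  then have "(\<lambda>n. 1 / (1 + of_real c * (of_real (h n powr (- \<gamma>)) * (1 - exp (- (of_real (h n) * z))) powr of_real \<gamma>)))
     \<longlonglongrightarrow> 1 / (1 + of_real c * z powr of_real \<gamma>)"
    by (intro tendsto_intros one_plus_powr_nonzero) (use z \<gamma> c in auto)
  then show "(\<lambda>n. 1 / (1 + of_real (c * h n powr (- \<gamma>)) * (1 - exp (- (of_real (h n) * z))) powr of_real \<gamma>))
     \<longlonglongrightarrow> 1 / (1 + of_real c * z powr of_real \<gamma>)"
    by (simp add: mult_ac)
qed

section \<open>The Mittag-Leffler function as a limit of rational Laplace transforms\<close>

definition mittag_leffler :: "real \<Rightarrow> 'a \<Rightarrow> 'a::{banach,real_normed_field}" where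
  "mittag_leffler \<alpha> z = (\<Sum>k. of_real (rGamma (1 + \<alpha> * real k)) * z ^ k)"

text \<open>The Chinese restaurant process with discount \<open>\<alpha>\<close>: \<open>crp_weight \<alpha> n k\<close> is the probability that
\<open>n + 1\<close> customers occupy \<open>k\<close> tables, where a further customer opens a new table with probability
\<open>\<alpha> k / (n + 1)\<close>. The number of tables divided by \<open>n powr \<alpha>\<close> has a limit law with Laplace transform
\<open>x \<mapsto> mittag_leffler \<alpha> (- x)\<close>. This gives an elementary proof that the Mittag-Leffler function of a
negative argument is a Laplace transform, without stable densities or contour integrals.\<close>

primrec crp_weight :: "real \<Rightarrow> nat \<Rightarrow> nat \<Rightarrow> real" where
  "crp_weight \<alpha> 0 k = (if k = 1 then 1 else 0)"
| "crp_weight \<alpha> (Suc n) k = crp_weight \<alpha> n k * (1 - \<alpha> * real k / real (Suc n))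
     + (case k of 0 \<Rightarrow> 0 | Suc j \<Rightarrow> crp_weight \<alpha> n j * (\<alpha> * real j / real (Suc n)))"

lemma crp_weight_eq_0: "k > Suc n \<Longrightarrow> crp_weight \<alpha> n k = 0"
  by (induction n arbitrary: k) (auto split: nat.splits)

lemma crp_weight_nonneg:
  assumes "0 < \<alpha>" "\<alpha> < 1"
  shows "0 \<le> crp_weight \<alpha> n k"
proof (induction n arbitrary: k)
  case (Suc n)
  have "0 \<le> crp_weight \<alpha> n k * (1 - \<alpha> * real k / real (Suc n))"
  proof (cases "k > Suc n")
    case False
    then have "\<alpha> * real k \<le> 1 * real (Suc n)" using assms by (intro mult_mono) auto
    then show ?thesis using Suc[of k] by (intro mult_nonneg_nonneg) (auto simp: field_simps)
  qed (simp add: crp_weight_eq_0)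
  then show ?case using Suc assms by (auto split: nat.splits intro!: add_nonneg_nonneg)
qed auto

text \<open>One step of the process: from \<open>k\<close> tables it moves to \<open>k + 1\<close> with probability \<open>\<alpha> k / (n + 1)\<close>.\<close>

lemma crp_weight_Suc_sum:
  fixes f :: "nat \<Rightarrow> real"
  shows "(\<Sum>k<n+3. crp_weight \<alpha> (Suc n) k * f k) =
   (\<Sum>k<n+2. crp_weight \<alpha> n k * ((1 - \<alpha> * real k / real (Suc n)) * f k + \<alpha> * real k / real (Suc n) * f (Suc k)))"
proof -
  have n3: "n + 3 = Suc (n + 2)" by simp
  have 1: "(\<Sum>k<n+3. crp_weight \<alpha> n k * (1 - \<alpha> * real k / real (Suc n)) * f k)
     = (\<Sum>k<n+2. crp_weight \<alpha> n k * (1 - \<alpha> * real k / real (Suc n)) * f k)"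
    unfolding n3 by (simp add: crp_weight_eq_0)
  have 2: "(\<Sum>k<n+3. (case k of 0 \<Rightarrow> 0 | Suc j \<Rightarrow> crp_weight \<alpha> n j * (\<alpha> * real j / real (Suc n))) * f k)
     = (\<Sum>k<n+2. crp_weight \<alpha> n k * (\<alpha> * real k / real (Suc n)) * f (Suc k))"
    unfolding n3 sum.lessThan_Suc_shift[of _ "n + 2"] by simp
  show ?thesis
    unfolding crp_weight.simps distrib_right sum.distrib 1 2
    by (simp add: sum.distrib [symmetric] algebra_simps)
qed

lemma crp_weight_sum: "(\<Sum>k<n+2. crp_weight \<alpha> n k) = 1"
proof (induction n)
  case 0
  then show ?case by (simp add: eval_nat_numeral)
next
  case (Suc n)
  then show ?case using crp_weight_Suc_sum[of \<alpha> n "\<lambda>_. 1"] by (simp add: numeral_eq_Suc)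
qed

text \<open>Rising factorials are eigenfunctions of the transition step, since
\<open>k * pochhammer (k + 1) m = (k + m) * pochhammer k m\<close>; each step multiplies the moment by
\<open>1 + \<alpha> m / (n + 1)\<close>.\<close>

lemma crp_weight_rising_moment:
  "(\<Sum>k<n+2. crp_weight \<alpha> n k * pochhammer (real k) m) = fact m * (\<Prod>j=1..n. 1 + \<alpha> * real m / real j)"
proof (induction n)
  case 0
  then show ?case by (simp add: eval_nat_numeral pochhammer_fact)
next
  case (Suc n)
  have "(1 - \<alpha> * real k / real (Suc n)) * pochhammer (real k) m + \<alpha> * real k / real (Suc n) * pochhammer (real (Suc k)) m
     = (1 + \<alpha> * real m / real (Suc n)) * pochhammer (real k) m" for k
  proof -
    have "real k * pochhammer (real (Suc k)) m = (real k + real m) * pochhammer (real k) m"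
      using pochhammer_rec[of "real k" m] pochhammer_rec'[of "real k" m] by (simp add: add.commute)
    then have "\<alpha> / real (Suc n) * (real k * pochhammer (real (Suc k)) m)
       = \<alpha> / real (Suc n) * ((real k + real m) * pochhammer (real k) m)" by simp
    then show ?thesis by (simp add: divide_inverse algebra_simps)
  qed
  then have "(\<Sum>k<n+3. crp_weight \<alpha> (Suc n) k * pochhammer (real k) m)
     = (\<Sum>k<n+2. (1 + \<alpha> * real m / real (Suc n)) * (crp_weight \<alpha> n k * pochhammer (real k) m))"
    unfolding crp_weight_Suc_sum by (simp add: mult_ac)
  also have "\<dots> = (1 + \<alpha> * real m / real (Suc n)) * (fact m * (\<Prod>j=1..n. 1 + \<alpha> * real m / real j))"
    unfolding sum_distrib_left[symmetric] Suc ..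
  finally show ?case by (simp add: numeral_eq_Suc mult_ac)
qed

text \<open>The binomial series of \<open>(1 + z) powr (- k)\<close>, whose coefficients are the rising factorials of \<open>k\<close>.\<close>

lemma inverse_power_sums:
  assumes "norm (z::complex) < 1"
  shows "(\<lambda>m. of_real (pochhammer (real k) m / fact m) * (- z) ^ m) sums (1 / (1 + z)) ^ k"
proof -
  have nz: "1 + z \<noteq> 0" using assms by (metis add.inverse_unique norm_minus_cancel norm_one less_irrefl)
  have "(\<lambda>m. ((- of_nat k) gchoose m) * z ^ m) sums (1 + z) powr (- of_nat k)"
    by (rule gen_binomial_complex[OF assms])
  moreover have "(1 + z) powr (- of_nat k) = (1 / (1 + z)) ^ k"
    using nz by (simp add: powr_minus powr_nat' power_divide inverse_eq_divide)
  moreover have "((- of_nat k) gchoose m) * z ^ m = of_real (pochhammer (real k) m / fact m) * (- z) ^ m" for m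
  proof -
    have "complex_of_real (pochhammer (real k) m) = pochhammer (of_nat k) m"
      by (simp add: pochhammer_of_real[symmetric])
    then show ?thesis by (simp add: gbinomial_pochhammer power_minus[of z])
  qed
  ultimately show ?thesis by simp
qed

text \<open>For \<open>a = \<alpha> m\<close> this is \<open>1 / m!\<close> times the \<open>m\<close>-th rising factorial moment, normalised by
\<open>n powr (\<alpha> m)\<close>. It equals \<open>\<Gamma>(n + 1 + a) / (\<Gamma>(1 + a) \<Gamma>(n + 1) n powr a)\<close>.\<close>

definition crp_moment :: "real \<Rightarrow> nat \<Rightarrow> real" where
  "crp_moment a n = (\<Prod>j=1..n. 1 + a / real j) * real n powr (- a)"

lemma crp_generating_sums:
  assumes "norm (z::complex) < 1"
  shows "(\<lambda>m. of_real (\<Prod>j=1..n. 1 + \<alpha> * real m / real j) * (- z) ^ m) sums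
     (\<Sum>k<n+2. of_real (crp_weight \<alpha> n k) * (1 / (1 + z)) ^ k)"
proof -
  have "(\<lambda>m. \<Sum>k<n+2. of_real (crp_weight \<alpha> n k) * (of_real (pochhammer (real k) m / fact m) * (- z) ^ m)) sums
     (\<Sum>k<n+2. of_real (crp_weight \<alpha> n k) * (1 / (1 + z)) ^ k)"
    by (intro sums_sum sums_mult inverse_power_sums assms)
  moreover have "(\<Sum>k<n+2. of_real (crp_weight \<alpha> n k) * (of_real (pochhammer (real k) m / fact m) * (- z) ^ m))
     = of_real (\<Prod>j=1..n. 1 + \<alpha> * real m / real j) * (- z) ^ m" for m
  proof -
    have "(\<Sum>k<n+2. of_real (crp_weight \<alpha> n k) * (of_real (pochhammer (real k) m / fact m) * (- z) ^ m))
      = of_real ((\<Sum>k<n+2. crp_weight \<alpha> n k * pochhammer (real k) m) / fact m) * (- z) ^ m"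
      by (simp only: sum_divide_distrib of_real_sum sum_distrib_right sum_distrib_left of_real_mult of_real_divide mult_ac times_divide_eq_right times_divide_eq_left)
    then show ?thesis unfolding crp_weight_rising_moment by simp
  qed
  ultimately show ?thesis by simp
qed

text \<open>The factor \<open>1 + a / (n + 1)\<close> is at most \<open>((n + 1) / n) powr a\<close>, because
\<open>1 / (n + 1) \<le> ln ((n + 1) / n)\<close>. Monotonicity in \<open>n\<close> makes the moments at one fixed index \<open>M\<close> a
dominating sequence for all later ones.\<close>

lemma crp_moment_decreasing:
  assumes "0 \<le> a" "0 < n"
  shows "crp_moment a (Suc n) \<le> crp_moment a n"
proof -
  define N where "N = real n"
  have N: "N > 0" using assms by (simp add: N_def)
  have "- ln (N / (N + 1)) \<ge> 1 / (N + 1)"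
    using ln_le_minus_one[of "N / (N + 1)"] N by (simp add: field_simps)
  then have "ln ((N + 1) / N) \<ge> 1 / (N + 1)" using N by (simp add: ln_div)
  then have "1 + a / (N + 1) \<le> 1 + a * ln ((N + 1) / N)"
    using assms mult_left_mono[of "1 / (N + 1)" "ln ((N + 1) / N)" a] by simp
  also have "\<dots> \<le> exp (a * ln ((N + 1) / N))" by (rule exp_ge_add_one_self)
  also have "\<dots> = ((N + 1) / N) powr a" using N by (simp add: powr_def)
  also have "\<dots> = N powr (- a) / (N + 1) powr (- a)"
    using N by (simp add: powr_divide powr_minus field_simps)
  finally have "(1 + a / (N + 1)) * (N + 1) powr (- a) \<le> N powr (- a)"
    using N by (simp add: field_simps)
  then have "(\<Prod>j=1..n. 1 + a / real j) * ((1 + a / (N + 1)) * (N + 1) powr (- a)) \<le> (\<Prod>j=1..n. 1 + a / real j) * N powr (- a)"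
    using assms by (intro mult_left_mono prod_nonneg) auto
  then show ?thesis by (simp add: crp_moment_def N_def add.commute mult.assoc)
qed

lemma crp_moment_antimono:
  assumes "0 \<le> a" "0 < M" "M \<le> n"
  shows "crp_moment a n \<le> crp_moment a M"
  using assms(3)
proof (induction n rule: dec_induct)
  case (step n)
  then show ?case using crp_moment_decreasing[of a n] assms by linarith
qed simp

lemma crp_moment_nonneg: "0 \<le> a \<Longrightarrow> 0 \<le> crp_moment a n"
  by (auto simp: crp_moment_def intro!: mult_nonneg_nonneg prod_nonneg)

lemma crp_moment_bound:
  assumes "0 \<le> a"
  shows "crp_moment a M \<le> (1 + a) ^ M * real M powr (- a)"
proof -
  have "(\<Prod>j=1..M. 1 + a / real j) \<le> (\<Prod>j=1..M. 1 + a)"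
    using assms by (intro prod_mono) (auto simp: divide_le_eq mult_le_cancel_left1)
  then show ?thesis by (auto simp: crp_moment_def intro!: mult_right_mono)
qed

text \<open>Gauss's product for \<open>1 / \<Gamma>(1 + a)\<close>, up to the factor \<open>n / (1 + a + n)\<close>, which tends to one.\<close>

lemma crp_moment_tendsto:
  assumes "0 \<le> a"
  shows "crp_moment a \<longlonglongrightarrow> rGamma (1 + a)"
proof -
  have "(\<lambda>n. rGamma_series (1 + a) n * (real n / (1 + a + real n))) \<longlonglongrightarrow> rGamma (1 + a) * 1"
    by (intro tendsto_intros) real_asymp
  moreover have "eventually (\<lambda>n. rGamma_series (1 + a) n * (real n / (1 + a + real n)) = crp_moment a n) sequentially"
    using eventually_gt_at_top[of 0]
  proof eventually_elim
    case (elim n)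
    have p: "(\<Prod>j=1..n. 1 + a / real j) = pochhammer (1 + a) n / fact n" for n
    proof (induction n)
      case (Suc n)
      have "(\<Prod>j=1..Suc n. 1 + a / real j) = pochhammer (1 + a) n / fact n * (1 + a / real (Suc n))"
        using Suc.IH by simp
      also have "\<dots> = pochhammer (1 + a) (Suc n) / fact (Suc n)"
        by (simp add: pochhammer_Suc field_simps)
      finally show ?case .
    qed simp
    have "rGamma_series (1 + a) n = pochhammer (1 + a) n * (1 + a + real n) / (fact n * (real n * real n powr a))"
      using elim by (simp add: rGamma_series_def pochhammer_Suc powr_def exp_add [symmetric] algebra_simps)
        (simp add: exp_add)
    then show ?case
      unfolding crp_moment_def p using elim assms by (simp add: powr_minus field_simps)
  qed
  ultimately show ?thesis by (simp add: tendsto_cong)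
qed

text \<open>Choosing \<open>M\<close> with \<open>M powr \<alpha> \<ge> 2 x + 2\<close> bounds the terms by \<open>(1 + \<alpha> m) ^ M / 2 ^ m\<close>.\<close>

lemma crp_moment_summable:
  assumes \<alpha>: "0 < \<alpha>" and x: "0 \<le> (x::real)"
  shows "\<exists>M>0. summable (\<lambda>m. x ^ m * crp_moment (\<alpha> * real m) M)"
proof -
  obtain M :: nat where M: "real M > (2 * x + 2) powr (1 / \<alpha>)" using reals_Archimedean2 by blast
  have M0: "0 < M" using M powr_ge_zero[of "2 * x + 2" "1 / \<alpha>"] by (metis of_nat_0_less_iff order_le_less_trans)
  have "((2 * x + 2) powr (1 / \<alpha>)) powr \<alpha> \<le> real M powr \<alpha>"
    using M \<alpha> by (intro powr_mono2) auto
  then have M\<alpha>: "2 * x + 2 \<le> real M powr \<alpha>" using \<alpha> x by (simp add: powr_powr)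
  define r where "r = x * real M powr (- \<alpha>)"
  have r: "0 \<le> r" "r \<le> 1/2" using x M\<alpha> M0 by (auto simp: r_def powr_minus field_simps)
  have pw: "x ^ m * real M powr (- (\<alpha> * real m)) = r ^ m" for m
  proof -
    have "real M powr (- (\<alpha> * real m)) = (real M powr (- \<alpha>)) powr real m"
      by (simp add: powr_powr)
    also have "\<dots> = (real M powr (- \<alpha>)) ^ m"
      using M0 by (simp add: powr_realpow)
    finally show ?thesis by (simp add: r_def power_mult_distrib)
  qed
  have "summable (\<lambda>m. (1 + \<alpha> * real m) ^ M * (1 / 2) ^ m)"
  proof (rule summable_comparison_test_bigo)
    show "summable (\<lambda>m. norm ((2/3 :: real) ^ m))" by (simp add: summable_geometric)
    show "(\<lambda>m. (1 + \<alpha> * real m) ^ M * (1 / 2) ^ m) \<in> O(\<lambda>m. (2/3) ^ m)" using \<alpha> by real_asymp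
  qed
  moreover have "norm (x ^ m * crp_moment (\<alpha> * real m) M) \<le> (1 + \<alpha> * real m) ^ M * (1 / 2) ^ m" for m
  proof -
    have "norm (x ^ m * crp_moment (\<alpha> * real m) M) = x ^ m * crp_moment (\<alpha> * real m) M"
      using x \<alpha> crp_moment_nonneg[of "\<alpha> * real m" M] by simp
    also have "\<dots> \<le> x ^ m * ((1 + \<alpha> * real m) ^ M * real M powr (- (\<alpha> * real m)))"
      using x \<alpha> by (intro mult_left_mono crp_moment_bound) auto
    also have "\<dots> = (1 + \<alpha> * real m) ^ M * r ^ m" by (simp add: pw[symmetric])
    also have "\<dots> \<le> (1 + \<alpha> * real m) ^ M * (1 / 2) ^ m"
      using r \<alpha> by (intro mult_left_mono power_mono) auto
    finally show ?thesis .
  qed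
  ultimately have "summable (\<lambda>m. x ^ m * crp_moment (\<alpha> * real m) M)"
    by (rule summable_comparison_test'[where N = 0]) 
  then show ?thesis using M0 by blast
qed

text \<open>The generating function of the process at \<open>1 / (1 + x / n powr \<alpha>)\<close> is the power series in \<open>- x\<close> with
the normalised moments as coefficients. They converge to \<open>1 / \<Gamma>(1 + \<alpha> m)\<close> and are dominated, so
Tannery's theorem applies; the dominating series also gives the convergence of the
Mittag-Leffler series on the whole plane.\<close>

lemma mittag_leffler_limit:
  fixes x :: complex
  assumes \<alpha>: "0 < \<alpha>"
  shows "(\<lambda>n. \<Sum>k<n+2. of_real (crp_weight \<alpha> n k) * (1 / (1 + x * of_real (real n powr (- \<alpha>)))) ^ k)
           \<longlonglongrightarrow> mittag_leffler \<alpha> (- x)" (is ?L)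
    and "summable (\<lambda>k. norm (of_real (rGamma (1 + \<alpha> * real k)) * x ^ k))" (is ?S)
proof -
  from crp_moment_summable[OF \<alpha> norm_ge_zero[of x]] obtain M where M: "M > 0"
    and sM: "summable (\<lambda>m. norm x ^ m * crp_moment (\<alpha> * real m) M)" by auto
  define a where "a m n = of_real (crp_moment (\<alpha> * real m) n) * (- x) ^ m" for m n
  have T: "eventually (\<lambda>n. summable (\<lambda>k. norm (a k n))) sequentially \<and>
           summable (\<lambda>n. norm (of_real (rGamma (1 + \<alpha> * real n)) * (- x) ^ n)) \<and>
           ((\<lambda>n. suminf (\<lambda>k. a k n)) \<longlongrightarrow> suminf (\<lambda>k. of_real (rGamma (1 + \<alpha> * real k)) * (- x) ^ k)) sequentially"
  proof (rule tannerys_theorem)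
    show "(\<lambda>n. a k n) \<longlonglongrightarrow> of_real (rGamma (1 + \<alpha> * real k)) * (- x) ^ k" for k
      unfolding a_def using \<alpha> by (intro tendsto_intros crp_moment_tendsto) simp
    have "norm (a k n) \<le> norm x ^ k * crp_moment (\<alpha> * real k) M" if "n \<ge> M" for k n
    proof -
      have "crp_moment (\<alpha> * real k) n \<le> crp_moment (\<alpha> * real k) M"
        using \<alpha> M that by (intro crp_moment_antimono) auto
      then show ?thesis using crp_moment_nonneg[of "\<alpha> * real k" n] \<alpha>
        by (simp add: a_def norm_mult norm_power mult.commute mult_left_mono)
    qed
    then show "eventually (\<lambda>(k, n). norm (a k n) \<le> norm x ^ k * crp_moment (\<alpha> * real k) M) (at_top \<times>\<^sub>F sequentially)"
      unfolding eventually_prod_filter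
      by (intro exI[of _ "\<lambda>_. True"] exI[of _ "\<lambda>n. n \<ge> M"]) (auto simp: eventually_ge_at_top)
  qed (use sM in auto)
  from T show ?S by (simp add: norm_mult norm_power)
  have "eventually (\<lambda>n. suminf (\<lambda>k. a k n) =
     (\<Sum>k<n+2. of_real (crp_weight \<alpha> n k) * (1 / (1 + x * of_real (real n powr (- \<alpha>)))) ^ k)) sequentially"
  proof -
    have "(\<lambda>n. norm x * real n powr (- \<alpha>)) \<longlonglongrightarrow> 0" using \<alpha> by real_asymp
    then have "eventually (\<lambda>n. norm x * real n powr (- \<alpha>) < 1) sequentially"
      by (rule order_tendstoD) simp
    then show ?thesis using eventually_gt_at_top[of 0]
    proof eventually_elim
      case (elim n)
      have "a m n = of_real (\<Prod>j=1..n. 1 + \<alpha> * real m / real j) * (- (x * of_real (real n powr (- \<alpha>)))) ^ m" for m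
      proof -
        have "real n powr (- (\<alpha> * real m)) = (real n powr (- \<alpha>)) powr real m"
          by (simp add: powr_powr)
        also have "\<dots> = (real n powr (- \<alpha>)) ^ m"
          using elim by (simp add: powr_realpow)
        finally have "crp_moment (\<alpha> * real m) n = (\<Prod>j=1..n. 1 + \<alpha> * real m / real j) * (real n powr (- \<alpha>)) ^ m"
          by (simp add: crp_moment_def)
        then show ?thesis unfolding a_def minus_mult_left power_mult_distrib
          by (simp del: of_real_prod)
      qed
      then show ?case
        using crp_generating_sums[of "x * of_real (real n powr (- \<alpha>))" \<alpha> n] elim
        by (simp add: sums_iff norm_mult)
    qed
  qed
  with T show ?L unfolding mittag_leffler_def by (simp add: tendsto_cong)
qed

text \<open>The source of all positivity below. With \<open>\<gamma> = 1\<close> it gives bounds and monotonicity of \<open>E\<^sub>\<alpha>\<close> on the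
negative axis; with \<open>\<gamma> = \<alpha>\<close> in the time variable it controls time derivatives; with \<open>\<gamma> = \<beta> / 2\<close> and
\<open>z = |\<xi>|\<^sup>2\<close> it exhibits the solution as a mixture of Gaussians.\<close>

lemma laplace_cone_mittag_leffler:
  assumes "0 < \<alpha>" "\<alpha> < 1" "0 < \<gamma>" "\<gamma> \<le> 1" "0 \<le> c"
  shows "(\<lambda>z. mittag_leffler \<alpha> (- (of_real c * z powr of_real \<gamma>))) \<in> laplace_cone"
proof (rule laplace_cone.lim)
  fix n
  have "(\<lambda>z. \<Sum>k<n+2. of_real (crp_weight \<alpha> n k) * (1 / (1 + of_real (c * real n powr (- \<alpha>)) * z powr of_real \<gamma>)) ^ k) \<in> laplace_cone"
    by (rule laplace_cone.mix)
      (use assms in \<open>auto simp: crp_weight_sum[simplified] simp del: of_real_mult intro!: laplace_cone_power laplace_cone_resolvent crp_weight_nonneg\<close>)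
  then show "(\<lambda>z. \<Sum>k<n+2. of_real (crp_weight \<alpha> n k) * (1 / (1 + (of_real c * z powr of_real \<gamma>) * of_real (real n powr (- \<alpha>)))) ^ k) \<in> laplace_cone"
    by (simp add: mult_ac)
qed (rule mittag_leffler_limit, use assms in simp)

section \<open>The Mittag-Leffler function on the negative axis\<close>

lemma laplace_cone_Re:
  assumes "f \<in> laplace_cone"
  shows "0 < x \<Longrightarrow> 0 \<le> Re (f (of_real x))"
    and "0 < x \<Longrightarrow> x \<le> y \<Longrightarrow> Re (f (of_real y)) \<le> Re (f (of_real x))"
proof -
  have "(\<forall>x>0. 0 \<le> Re (f (of_real x))) \<and> (\<forall>x y. 0 < x \<longrightarrow> x \<le> y \<longrightarrow> Re (f (of_real y)) \<le> Re (f (of_real x)))"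
    using assms
  proof induction
    case (exp r)
    then show ?case by (auto simp: Re_exp mult_left_mono)
  next
    case (mix N f w)
    then show ?case by (auto intro!: sum_nonneg sum_mono mult_left_mono)
  next
    case (lim f g)
    have l: "(\<lambda>n. Re (f n (of_real x))) \<longlonglongrightarrow> Re (g (of_real x))" if "x > 0" for x
      using that by (intro tendsto_Re lim.hyps(2)) simp
    show ?case
    proof (intro conjI allI impI)
      fix x :: real assume "x > 0"
      show "0 \<le> Re (g (of_real x))" by (rule LIMSEQ_le_const[OF l]) (use lim \<open>x > 0\<close> in auto)
    next
      fix x y :: real assume *: "0 < x" "x \<le> y"
      then show "Re (g (of_real y)) \<le> Re (g (of_real x))"
        by (intro LIMSEQ_le[OF l l]) (use lim * in auto)
    qed
  qed
  then show "0 < x \<Longrightarrow> 0 \<le> Re (f (of_real x))"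
    and "0 < x \<Longrightarrow> x \<le> y \<Longrightarrow> Re (f (of_real y)) \<le> Re (f (of_real x))" by auto
qed

lemma mittag_leffler_summable_complex:
  assumes "0 < \<alpha>"
  shows "summable (\<lambda>k. of_real (rGamma (1 + \<alpha> * real k)) * (z::complex) ^ k)"
  using mittag_leffler_limit(2)[OF assms] by (rule summable_norm_cancel)

lemma mittag_leffler_summable_abs:
  assumes "0 < \<alpha>"
  shows "summable (\<lambda>k. \<bar>rGamma (1 + \<alpha> * real k) * (x::real) ^ k\<bar>)"
  using mittag_leffler_limit(2)[OF assms, of "of_real x"] by (simp add: norm_mult norm_power abs_mult power_abs)

lemma mittag_leffler_summable_real:
  assumes "0 < \<alpha>"
  shows "summable (\<lambda>k. rGamma (1 + \<alpha> * real k) * (x::real) ^ k)"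
  using mittag_leffler_summable_abs[OF assms] by (rule summable_rabs_cancel)

lemma mittag_leffler_of_real:
  assumes "0 < \<alpha>"
  shows "mittag_leffler \<alpha> (complex_of_real x) = of_real (mittag_leffler \<alpha> x)"
proof -
  have "(\<lambda>k. of_real (rGamma (1 + \<alpha> * real k) * x ^ k)) sums complex_of_real (\<Sum>k. rGamma (1 + \<alpha> * real k) * x ^ k)"
    by (intro sums_of_real summable_sums mittag_leffler_summable_real assms)
  then show ?thesis by (simp add: mittag_leffler_def sums_iff)
qed

lemma mittag_leffler_holomorphic:
  assumes "0 < \<alpha>"
  shows "(mittag_leffler \<alpha> :: complex \<Rightarrow> complex) holomorphic_on A"
proof -
  have "(mittag_leffler \<alpha> has_field_derivative (\<Sum>n. diffs (\<lambda>k. of_real (rGamma (1 + \<alpha> * real k))) n * z ^ n)) (at z)" for z :: complex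
    unfolding mittag_leffler_def[abs_def]
    by (rule termdiffs_strong_converges_everywhere) (rule mittag_leffler_summable_complex[OF assms])
  then show ?thesis unfolding holomorphic_on_def field_differentiable_def
    using has_field_derivative_at_within by blast
qed

lemma mittag_leffler_continuous:
  assumes "0 < \<alpha>"
  shows "continuous_on A (mittag_leffler \<alpha> :: real \<Rightarrow> real)"
proof -
  have "(mittag_leffler \<alpha> has_field_derivative (\<Sum>n. diffs (\<lambda>k. of_real (rGamma (1 + \<alpha> * real k))) n * x ^ n)) (at x)" for x :: real
    unfolding mittag_leffler_def[abs_def]
    by (rule termdiffs_strong_converges_everywhere) (use mittag_leffler_summable_real[OF assms] in simp)
  then have "isCont (mittag_leffler \<alpha>) x" for x :: real by (rule DERIV_isCont)
  then show ?thesis by (simp add: continuous_at_imp_continuous_on)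
qed

lemma mittag_leffler_0: "mittag_leffler \<alpha> (0::real) = 1"
proof -
  have "(\<lambda>k. rGamma (1 + \<alpha> * real k) * (0::real) ^ k) = (\<lambda>k. if k = 0 then 1 else 0)"
    by (auto simp: fun_eq_iff rGamma_inverse_Gamma)
  then show ?thesis unfolding mittag_leffler_def
    using sums_unique[OF sums_single[of 0 "\<lambda>_. 1::real"]] by simp
qed

lemma mittag_leffler_neg:
  fixes x :: real
  assumes \<alpha>: "0 < \<alpha>" "\<alpha> < 1"
  shows mittag_leffler_neg_nonneg: "0 \<le> x \<Longrightarrow> 0 \<le> mittag_leffler \<alpha> (- x)"
    and mittag_leffler_neg_le_1: "0 \<le> x \<Longrightarrow> mittag_leffler \<alpha> (- x) \<le> 1"
    and mittag_leffler_neg_antimono: "0 \<le> x \<Longrightarrow> x \<le> y \<Longrightarrow> mittag_leffler \<alpha> (- y) \<le> mittag_leffler \<alpha> (- x)"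
proof -
  let ?f = "\<lambda>z. mittag_leffler \<alpha> (- (of_real 1 * z powr of_real 1)) :: complex"
  have f: "?f \<in> laplace_cone" by (rule laplace_cone_mittag_leffler) (use \<alpha> in auto)
  have eq: "?f (of_real x) = of_real (mittag_leffler \<alpha> (- x))" if "0 < x" for x
    using that mittag_leffler_of_real[OF \<alpha>(1), of "- x"] by simp
  have pos: "0 \<le> mittag_leffler \<alpha> (- x)" if "0 < x" for x :: real
    using laplace_cone_Re(1)[OF f that] unfolding eq[OF that] by simp
  then show "0 \<le> mittag_leffler \<alpha> (- x)" if "0 \<le> x" using that
    by (cases "x = 0") (auto simp: mittag_leffler_0)
  have le1: "mittag_leffler \<alpha> (- x) \<le> 1" if "0 \<le> x" for x :: real
  proof (cases "x = 0")
    case False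
    then have x: "0 < x" using that by simp
    show ?thesis using laplace_cone_norm_le[OF f, of "of_real x"] x unfolding eq[OF x] by simp
  qed (simp add: mittag_leffler_0)
  then show "mittag_leffler \<alpha> (- x) \<le> 1" if "0 \<le> x" using that .
  show "mittag_leffler \<alpha> (- y) \<le> mittag_leffler \<alpha> (- x)" if *: "0 \<le> x" "x \<le> y"
  proof (cases "x = 0")
    case True
    then show ?thesis using le1[of y] * by (simp add: mittag_leffler_0)
  next
    case False
    then have x: "0 < x" "0 < y" using * by auto
    show ?thesis using laplace_cone_Re(2)[OF f x(1) *(2)] unfolding eq[OF x(1)] eq[OF x(2)] by simp
  qed
qed

section \<open>The fractional relaxation equation\<close>

text \<open>The two-parameter Mittag-Leffler function \<open>E\<^sub>\<alpha>\<^sub>,\<^sub>2\<close>; it enters through the antiderivative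
\<open>t E\<^sub>\<alpha>\<^sub>,\<^sub>2(- c t\<^sup>\<alpha>)\<close> of \<open>E\<^sub>\<alpha>(- c t\<^sup>\<alpha>)\<close>.\<close>

definition mittag_leffler2 :: "real \<Rightarrow> real \<Rightarrow> real" where
  "mittag_leffler2 \<alpha> y = (\<Sum>k. rGamma (2 + \<alpha> * real k) * y ^ k)"

lemma rGamma_2_plus:
  fixes x :: real
  assumes "0 \<le> x"
  shows "(1 + x) * rGamma (2 + x) = rGamma (1 + x)" "0 \<le> rGamma (2 + x)" "rGamma (2 + x) \<le> rGamma (1 + x)" "0 < rGamma (1 + x)"
proof -
  show 1: "(1 + x) * rGamma (2 + x) = rGamma (1 + x)"
    using rGamma_plus1[of "1 + x"] by (simp add: add.assoc[symmetric])
  show "0 < rGamma (1 + x)" using assms by (simp add: rGamma_inverse_Gamma Gamma_real_pos)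
  show 2: "0 \<le> rGamma (2 + x)" using assms by (simp add: rGamma_inverse_Gamma Gamma_real_pos less_imp_le)
  show "rGamma (2 + x) \<le> rGamma (1 + x)"
    unfolding 1[symmetric] using assms 2 by (simp add: mult_le_cancel_right1)
qed

lemma mittag_leffler2_summable_abs:
  assumes "0 < \<alpha>"
  shows "summable (\<lambda>k. \<bar>rGamma (2 + \<alpha> * real k) * y ^ k\<bar>)"
proof (rule summable_comparison_test'[OF mittag_leffler_summable_abs[OF assms, of y], of 0])
  fix k :: nat
  have "0 \<le> \<alpha> * real k" using assms by simp
  from rGamma_2_plus[OF this] show "norm \<bar>rGamma (2 + \<alpha> * real k) * y ^ k\<bar> \<le> \<bar>rGamma (1 + \<alpha> * real k) * y ^ k\<bar>"
    by (simp add: abs_mult mult_right_mono)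
qed

text \<open>Differentiating termwise turns \<open>1 / \<Gamma>(2 + \<alpha> k)\<close> into \<open>(1 + \<alpha> k) / \<Gamma>(2 + \<alpha> k) = 1 / \<Gamma>(1 + \<alpha> k)\<close>.\<close>

lemma mittag_leffler2_has_derivative:
  assumes \<alpha>: "0 < \<alpha>" and t: "0 < t"
  shows "((\<lambda>t. t * mittag_leffler2 \<alpha> (- (c * t powr \<alpha>))) has_real_derivative mittag_leffler \<alpha> (- (c * t powr \<alpha>))) (at t)"
proof -
  let ?c = "\<lambda>k. rGamma (2 + \<alpha> * real k)"
  define y where "y = - (c * t powr \<alpha>)"
  have s: "summable (\<lambda>k. ?c k * x ^ k)" for x
    using mittag_leffler2_summable_abs[OF \<alpha>] by (rule summable_rabs_cancel)
  define D where "D = (\<Sum>n. diffs ?c n * y ^ n)"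
  have d: "(mittag_leffler2 \<alpha> has_field_derivative D) (at y)"
    unfolding mittag_leffler2_def[abs_def] D_def by (rule termdiffs_strong_converges_everywhere) (rule s)
  have "(\<lambda>n. diffs ?c n * y ^ n * y) sums (D * y)"
    unfolding D_def by (intro sums_mult2 summable_sums termdiff_converges_all s)
  then have "(\<lambda>n. real (Suc n) * ?c (Suc n) * y ^ Suc n) sums (D * y)"
    by (simp add: diffs_def mult_ac)
  then have yD: "(\<lambda>n. real n * ?c n * y ^ n) sums (D * y)"
    using sums_Suc_iff[of "\<lambda>n. real n * ?c n * y ^ n" "D * y"] by simp
  have "(\<lambda>n. ?c n * y ^ n + \<alpha> * (real n * ?c n * y ^ n)) sums (mittag_leffler2 \<alpha> y + \<alpha> * (D * y))"
    unfolding mittag_leffler2_def by (intro sums_add sums_mult summable_sums s yD)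
  moreover have "?c n * y ^ n + \<alpha> * (real n * ?c n * y ^ n) = rGamma (1 + \<alpha> * real n) * y ^ n" for n
    using rGamma_2_plus(1)[of "\<alpha> * real n", symmetric] \<alpha> by (simp add: algebra_simps)
  ultimately have e: "mittag_leffler \<alpha> y = mittag_leffler2 \<alpha> y + \<alpha> * (D * y)"
    by (simp add: mittag_leffler_def sums_iff)
  have "((\<lambda>t. - (c * t powr \<alpha>)) has_real_derivative (- (c * (\<alpha> * t powr (\<alpha> - 1))))) (at t)"
    using t by (auto intro!: derivative_eq_intros)
  from DERIV_chain2[OF d[unfolded y_def] this]
  have "((\<lambda>t. mittag_leffler2 \<alpha> (- (c * t powr \<alpha>))) has_real_derivative D * (- (c * (\<alpha> * t powr (\<alpha> - 1))))) (at t)"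
    by simp
  from DERIV_mult[OF DERIV_ident this]
  have "((\<lambda>t. t * mittag_leffler2 \<alpha> (- (c * t powr \<alpha>))) has_real_derivative
     mittag_leffler2 \<alpha> y + t * (D * (- (c * (\<alpha> * t powr (\<alpha> - 1)))))) (at t)"
    by (simp add: y_def mult_ac add_ac)
  moreover have "t * (D * (- (c * (\<alpha> * t powr (\<alpha> - 1))))) = \<alpha> * (D * y)"
    using t by (simp add: y_def powr_diff)
  ultimately show ?thesis unfolding y_def[symmetric] e by metis
qed

text \<open>Euler's Beta integral, scaled from \<open>[0, 1]\<close> to \<open>[0, t]\<close>.\<close>

lemma frac_kernel_power:
  fixes a t \<alpha> :: real
  assumes \<alpha>: "\<alpha> < 1" and a: "0 \<le> a" and t: "0 < t"
  shows "has_bochner_integral lborel (\<lambda>\<tau>. indicator {0..t} \<tau> * ((t - \<tau>) powr (- \<alpha>) * \<tau> powr a))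
     (t powr (a + 1 - \<alpha>) * (Gamma (1 + a) * Gamma (1 - \<alpha>) * rGamma (2 + a - \<alpha>)))"
proof -
  define f where "f \<tau> = indicator {0..t} \<tau> * ((t - \<tau>) powr (- \<alpha>) * \<tau> powr a)" for \<tau>
  have i: "set_integrable lborel {0..1} (\<lambda>s. s powr ((1 + a) - 1) * (1 - s) powr ((1 - \<alpha>) - 1))"
    by (rule integrable_Beta) (use \<alpha> a in auto)
  then have "has_bochner_integral lborel (\<lambda>s. indicator {0..1} s * (s powr a * (1 - s) powr (- \<alpha>))) (Beta (1 + a) (1 - \<alpha>))"
    using has_integral_Beta_real[of "1 + a" "1 - \<alpha>"] \<alpha> a set_borel_integral_eq_integral(2)[OF i]
    by (auto simp: has_bochner_integral_iff set_integrable_def set_lebesgue_integral_def integral_unique)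
  then have "has_bochner_integral lborel (\<lambda>s. t powr (a - \<alpha>) * (indicator {0..1} s * (s powr a * (1 - s) powr (- \<alpha>)))) (t powr (a - \<alpha>) * Beta (1 + a) (1 - \<alpha>))"
    by (rule has_bochner_integral_mult_right)
  moreover have "t powr (a - \<alpha>) * (indicator {0..1} s * (s powr a * (1 - s) powr (- \<alpha>))) = f (0 + t * s)" for s
  proof (cases "s \<in> {0..1}")
    case True
    have "t - t * s = t * (1 - s)" by (simp add: algebra_simps)
    then have "(t - t * s) powr (- \<alpha>) = t powr (- \<alpha>) * (1 - s) powr (- \<alpha>)"
      using t True by (simp add: powr_mult)
    moreover have "t * s \<le> t" using t True by (simp add: mult_left_le)
    ultimately show ?thesis using True t by (simp add: f_def powr_mult powr_diff powr_minus field_simps)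
  next
    case False
    then have "\<not> (0 \<le> t * s \<and> t * s \<le> t)" using t by (auto simp: zero_le_mult_iff mult_le_cancel_left1)
    then show ?thesis using False by (auto simp: f_def)
  qed
  ultimately have "has_bochner_integral lborel (\<lambda>s. f (0 + t * s)) (t powr (a - \<alpha>) * Beta (1 + a) (1 - \<alpha>))"
    by simp
  moreover have "t powr (a - \<alpha>) * Beta (1 + a) (1 - \<alpha>) = (t powr (a + 1 - \<alpha>) * Beta (1 + a) (1 - \<alpha>)) /\<^sub>R \<bar>t\<bar>"
    using t by (simp add: powr_diff powr_add field_simps)
  ultimately have "has_bochner_integral lborel f (t powr (a + 1 - \<alpha>) * Beta (1 + a) (1 - \<alpha>))"
    using lborel_has_bochner_integral_real_affine_iff[of t f _ 0] t by simp
  then show ?thesis unfolding f_def[abs_def] by (simp add: Beta_altdef add_ac diff_add_eq)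
qed

lemma frac_kernel_integrable:
  fixes t \<alpha> :: real
  assumes "\<alpha> < 1" "0 < t"
  shows "integrable lborel (\<lambda>\<tau>. indicat_real {0..t} \<tau> * (t - \<tau>) powr (- \<alpha>))"
proof -
  have 1: "integrable lborel (\<lambda>\<tau>. indicator {0..t} \<tau> * ((t - \<tau>) powr (- \<alpha>) * \<tau> powr 0))"
    using frac_kernel_power[OF assms(1) _ assms(2), of 0] by (simp add: has_bochner_integral_iff)
  \<comment> \<open>The point \<open>\<tau> = 0\<close> is exceptional because \<open>0 powr 0 = 0\<close>.\<close>
  have "AE \<tau> in lborel. \<tau> \<noteq> (0::real)" by (rule AE_lborel_singleton)
  then have "AE \<tau> in lborel. indicator {0..t} \<tau> * ((t - \<tau>) powr (- \<alpha>) * \<tau> powr 0) = indicator {0..t} \<tau> * (t - \<tau>) powr (- \<alpha>)"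
    by eventually_elim simp
  with 1 show ?thesis by (subst (asm) integrable_cong_AE) auto
qed

lemma frac_kernel_set_integrable:
  fixes f :: "real \<Rightarrow> real" and t \<alpha> :: real
  assumes "\<alpha> < 1" "0 < t" "f \<in> borel_measurable lborel" "\<And>\<tau>. \<tau> \<in> {0..t} \<Longrightarrow> \<bar>f \<tau>\<bar> \<le> C"
  shows "set_integrable lborel {0..t} (\<lambda>\<tau>. (t - \<tau>) powr (- \<alpha>) * f \<tau>)"
  unfolding set_integrable_def
proof (rule Bochner_Integration.integrable_bound)
  show "integrable lborel (\<lambda>\<tau>. C * (indicator {0..t} \<tau> * (t - \<tau>) powr (- \<alpha>)))"
    by (intro integrable_mult_right frac_kernel_integrable assms)
  show "AE \<tau> in lborel. norm (indicator {0..t} \<tau> *\<^sub>R ((t - \<tau>) powr (- \<alpha>) * f \<tau>)) \<le> norm (C * (indicator {0..t} \<tau> * (t - \<tau>) powr (- \<alpha>)))"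
  proof (rule AE_I2)
    fix \<tau> show "norm (indicator {0..t} \<tau> *\<^sub>R ((t - \<tau>) powr (- \<alpha>) * f \<tau>)) \<le> norm (C * (indicator {0..t} \<tau> * (t - \<tau>) powr (- \<alpha>)))"
      using order_trans[OF assms(4)[of \<tau>] abs_ge_self[of C]]
      by (auto simp: indicator_def abs_mult mult.commute[of "_ powr _"] intro!: mult_right_mono)
  qed
qed (use assms(3) in measurable)

text \<open>The integrated form of the relaxation equation \<open>\<partial>\<^sub>t\<^sup>\<alpha>(e - 1) = - c e\<close> for \<open>e t = E\<^sub>\<alpha>(- c t\<^sup>\<alpha>)\<close>: the
right-hand side is \<open>- c \<Gamma>(1 - \<alpha>)\<close> times the antiderivative of \<open>e\<close>. The power series is integrated
against the kernel term by term, each term being a Beta integral.\<close>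

lemma mittag_leffler_fractional_integral:
  assumes \<alpha>: "0 < \<alpha>" "\<alpha> < 1" and t: "0 < t"
  shows "(LINT \<tau>:{0..t}|lborel. (t - \<tau>) powr (- \<alpha>) * (mittag_leffler \<alpha> (- (c * \<tau> powr \<alpha>)) - 1))
     = - (Gamma (1 - \<alpha>) * c * (t * mittag_leffler2 \<alpha> (- (c * t powr \<alpha>))))"
proof -
  let ?e = "\<lambda>\<tau>. mittag_leffler \<alpha> (- (c * \<tau> powr \<alpha>))"
    and ?k = "\<lambda>k \<tau>. indicator {0..t} \<tau> * ((t - \<tau>) powr (- \<alpha>) * \<tau> powr (\<alpha> * real (Suc k)))"
    and ?r = "\<lambda>k. rGamma (1 + \<alpha> * real (Suc k))"
  define f where "f k \<tau> = ?k k \<tau> * ((- c) ^ Suc k * ?r k)" for k \<tau>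
  have fa: "norm (f k \<tau>) = ?k k \<tau> * \<bar>(- c) ^ Suc k * ?r k\<bar>" for k \<tau>
    by (simp add: f_def abs_mult)
  define q where "q k = t powr (1 + \<alpha> * real k) * (Gamma (1 - \<alpha>) * rGamma (2 + \<alpha> * real k))" for k
  have G: "t powr (\<alpha> * real (Suc k) + 1 - \<alpha>) * (Gamma (1 + \<alpha> * real (Suc k)) * Gamma (1 - \<alpha>) * rGamma (2 + \<alpha> * real (Suc k) - \<alpha>)) * (x * ?r k) = x * q k" for k x
  proof -
    have "Gamma (1 + \<alpha> * real (Suc k)) \<noteq> 0"
      using \<alpha> by (intro less_imp_neq[symmetric] Gamma_real_pos add_pos_nonneg) auto
    moreover have "\<alpha> * real (Suc k) + 1 - \<alpha> = 1 + \<alpha> * real k" "2 + \<alpha> * real (Suc k) - \<alpha> = 2 + \<alpha> * real k"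
      by (auto simp: algebra_simps)
    ultimately show ?thesis by (simp only: q_def rGamma_inverse_Gamma mult_ac) simp
  qed
  have q0: "0 \<le> q k" for k
    using \<alpha> rGamma_2_plus(2)[of "\<alpha> * real k"] by (simp add: q_def Gamma_real_pos less_imp_le)
  have FK: "has_bochner_integral lborel (\<lambda>\<tau>. ?k k \<tau>)
     (t powr (\<alpha> * real (Suc k) + 1 - \<alpha>) * (Gamma (1 + \<alpha> * real (Suc k)) * Gamma (1 - \<alpha>) * rGamma (2 + \<alpha> * real (Suc k) - \<alpha>)))" for k
    by (rule frac_kernel_power[OF \<alpha>(2) _ t]) (use \<alpha> in simp)
  have hb: "has_bochner_integral lborel (f k) ((- c) ^ Suc k * q k)" for k
    using has_bochner_integral_mult_left[OF FK[of k], of "(- c) ^ Suc k * ?r k"] \<alpha>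
    unfolding G f_def[abs_def] by simp
  have nb: "(LINT \<tau>|lborel. norm (f k \<tau>)) = \<bar>c\<bar> ^ Suc k * q k" for k
  proof -
    have r0: "0 \<le> ?r k" using rGamma_2_plus(4)[of "\<alpha> * real (Suc k)"] \<alpha> by simp
    have "norm (f k \<tau>) = ?k k \<tau> * (\<bar>c\<bar> ^ Suc k * ?r k)" for \<tau>
      unfolding fa using r0 by (simp add: abs_mult power_abs)
    then have "has_bochner_integral lborel (\<lambda>\<tau>. norm (f k \<tau>)) (\<bar>c\<bar> ^ Suc k * q k)"
      using has_bochner_integral_mult_left[OF FK[of k], of "\<bar>c\<bar> ^ Suc k * ?r k"] \<alpha>
      unfolding G by simp
    then show ?thesis by (rule has_bochner_integral_integral_eq)
  qed
  have tp: "t powr (\<alpha> * real k) = (t powr \<alpha>) ^ k" if "t > 0" for t k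
    using that by (simp add: powr_powr[symmetric] powr_realpow)
  have qe: "x ^ Suc k * q k = x * t * Gamma (1 - \<alpha>) * (rGamma (2 + \<alpha> * real k) * (x * t powr \<alpha>) ^ k)" for x k
    using t by (simp add: q_def powr_add tp power_mult_distrib)
  have sq: "summable (\<lambda>k. \<bar>c\<bar> ^ Suc k * q k)"
    unfolding qe using mittag_leffler2_summable_abs[OF \<alpha>(1), of "\<bar>c\<bar> * t powr \<alpha>"]
    by (intro summable_mult) (rule summable_rabs_cancel)
  have ml: "(\<lambda>k. f k \<tau>) sums (indicator {0..t} \<tau> *\<^sub>R ((t - \<tau>) powr (- \<alpha>) * (?e \<tau> - 1)))" for \<tau>
  proof (cases "\<tau> \<in> {0..t}")
    case True
    have "(\<lambda>k. rGamma (1 + \<alpha> * real k) * (- (c * \<tau> powr \<alpha>)) ^ k) sums ?e \<tau>"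
      using summable_sums[OF mittag_leffler_summable_real[OF \<alpha>(1)]] by (simp add: mittag_leffler_def)
    then have "(\<lambda>k. ?r k * (- (c * \<tau> powr \<alpha>)) ^ Suc k) sums (?e \<tau> - 1)"
      by (subst sums_Suc_iff) (simp add: rGamma_inverse_Gamma)
    then have "(\<lambda>k. (t - \<tau>) powr (- \<alpha>) * (?r k * (- (c * \<tau> powr \<alpha>)) ^ Suc k)) sums ((t - \<tau>) powr (- \<alpha>) * (?e \<tau> - 1))"
      by (rule sums_mult)
    moreover have "(t - \<tau>) powr (- \<alpha>) * (?r k * (- (c * \<tau> powr \<alpha>)) ^ Suc k) = f k \<tau>" for k
    proof -
      have "\<tau> powr (\<alpha> * real (Suc k)) = (\<tau> powr \<alpha>) ^ Suc k"
        using True tp[of \<tau> "Suc k"] by (cases "\<tau> = 0") auto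
      moreover have "(- (c * \<tau> powr \<alpha>)) ^ Suc k = (- c) ^ Suc k * (\<tau> powr \<alpha>) ^ Suc k"
        unfolding minus_mult_left by (rule power_mult_distrib)
      ultimately show ?thesis using True unfolding f_def by (simp only: indicator_simps mult_1_left mult_ac)
    qed
    ultimately show ?thesis using True by simp
  qed (simp add: f_def)
  have "(LINT \<tau>|lborel. (\<Sum>k. f k \<tau>)) = (\<Sum>k. LINT \<tau>|lborel. f k \<tau>)"
  proof (rule integral_suminf)
    show "integrable lborel (f k)" for k using hb[of k] by (simp add: has_bochner_integral_iff)
    show "AE \<tau> in lborel. summable (\<lambda>k. norm (f k \<tau>))"
    proof (rule AE_I2)
      fix \<tau> :: real
      show "summable (\<lambda>k. norm (f k \<tau>))"
      proof (cases "\<tau> \<in> {0<..t}")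
        case True
        have "summable (\<lambda>k. \<bar>?r k * (c * \<tau> powr \<alpha>) ^ Suc k\<bar>)"
          using mittag_leffler_summable_abs[OF \<alpha>(1), of "c * \<tau> powr \<alpha>"] by (subst summable_Suc_iff)
        then have "summable (\<lambda>k. (t - \<tau>) powr (- \<alpha>) * \<bar>?r k * (c * \<tau> powr \<alpha>) ^ Suc k\<bar>)"
          by (rule summable_mult)
        moreover have "(t - \<tau>) powr (- \<alpha>) * \<bar>?r k * (c * \<tau> powr \<alpha>) ^ Suc k\<bar> = norm (f k \<tau>)" for k
          unfolding fa using True tp[of \<tau> "Suc k"] by (simp add: abs_mult power_mult_distrib power_abs)
        ultimately show ?thesis by (simp only:)
      next
        case False
        then have "f k \<tau> = 0" for k by (auto simp: f_def indicator_def)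
        then show ?thesis by simp
      qed
    qed
    show "summable (\<lambda>k. LINT \<tau>|lborel. norm (f k \<tau>))" unfolding nb by (rule sq)
  qed
  also have "(\<lambda>\<tau>. \<Sum>k. f k \<tau>) = (\<lambda>\<tau>. indicator {0..t} \<tau> *\<^sub>R ((t - \<tau>) powr (- \<alpha>) * (?e \<tau> - 1)))"
    using ml by (simp add: sums_iff)
  also have "(\<Sum>k. LINT \<tau>|lborel. f k \<tau>) = (\<Sum>k. (- c) ^ Suc k * q k)"
    using hb by (simp add: has_bochner_integral_iff)
  also have "\<dots> = (\<Sum>k. - c * t * Gamma (1 - \<alpha>) * (rGamma (2 + \<alpha> * real k) * (- c * t powr \<alpha>) ^ k))"
    unfolding qe ..
  also have "\<dots> = - c * t * Gamma (1 - \<alpha>) * mittag_leffler2 \<alpha> (- c * t powr \<alpha>)"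
    unfolding mittag_leffler2_def
    by (rule suminf_mult) (rule summable_rabs_cancel[OF mittag_leffler2_summable_abs[OF \<alpha>(1)]])
  finally show ?thesis by (simp add: set_lebesgue_integral_def mult_ac)
qed

lemma mittag_leffler_continuous_time:
  assumes "0 < \<alpha>"
  shows "continuous_on {0..} (\<lambda>t. mittag_leffler \<alpha> (- (c * t powr \<alpha>)) :: real)"
  by (rule continuous_on_compose2[OF mittag_leffler_continuous[OF assms, of UNIV]])
    (use assms in \<open>auto intro!: continuous_intros continuous_on_powr'\<close>)

text \<open>Let \<open>w = 1 - e\<close> with \<open>e t = E\<^sub>\<alpha>(- t\<^sup>\<alpha>)\<close>, a nondecreasing function with \<open>w 0 = 0\<close>, and let
\<open>J t = \<integral>\<^sub>0\<^sup>t (t - \<tau>)\<^sup>-\<^sup>\<alpha> w \<tau> d\<tau>\<close>. By the relaxation equation the derivative of \<open>J\<close> is \<open>\<Gamma>(1 - \<alpha>) e\<close>.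
On the other hand the kernel is at least \<open>t\<^sup>-\<^sup>\<alpha>\<close>, so shifting by \<open>h\<close> raises \<open>J\<close> by at least
\<open>t\<^sup>-\<^sup>\<alpha> \<integral>\<^sub>0\<^sup>t (w (\<tau> + h) - w \<tau>) d\<tau> \<ge> t\<^sup>-\<^sup>\<alpha> h (w t - w h)\<close>. Dividing by \<open>h\<close> and letting \<open>h\<close> tend to \<open>0\<close>
compares \<open>e\<close> with \<open>t\<^sup>-\<^sup>\<alpha> w\<close>.\<close>

lemma mittag_leffler_lower_bound_time:
  assumes \<alpha>: "0 < \<alpha>" "\<alpha> < 1" and t: "0 < t"
  shows "t powr (- \<alpha>) * (1 - mittag_leffler \<alpha> (- (t powr \<alpha>))) \<le> Gamma (1 - \<alpha>) * mittag_leffler \<alpha> (- (t powr \<alpha>))"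
proof -
  define e where "e s = (if s < 0 then 1 else mittag_leffler \<alpha> (- (s powr \<alpha>)))" for s :: real
  define w where "w s = 1 - e s" for s :: real
  define F where "F s = s - s * mittag_leffler2 \<alpha> (- (s powr \<alpha>))" for s :: real
  define J where "J s = (LINT \<tau>:{0..s}|lborel. (s - \<tau>) powr (- \<alpha>) * w \<tau>)" for s
  have e: "0 \<le> e s" "e s \<le> 1" for s
    using mittag_leffler_neg[OF \<alpha>, of "s powr \<alpha>"] by (auto simp: e_def)
  have emono: "e s' \<le> e s" if "s \<le> s'" for s s'
    using that e[of s'] mittag_leffler_neg_antimono[OF \<alpha>, of "s powr \<alpha>" "s' powr \<alpha>"] \<alpha>
    by (auto simp: e_def powr_mono2)
  have w01: "\<bar>w s\<bar> \<le> 1" for s using e[of s] by (simp add: w_def abs_le_iff)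
  have [measurable]: "e \<in> borel_measurable borel"
  proof -
    have "mono (\<lambda>s. - e s)" using emono by (auto simp: mono_def)
    then have "(\<lambda>s. - (- e s)) \<in> borel_measurable borel" by (intro borel_measurable_uminus borel_measurable_mono)
    then show ?thesis by simp
  qed
  then have [measurable]: "w \<in> borel_measurable borel" by (simp add: w_def[abs_def])
  have dF: "(F has_real_derivative w s) (at s)" if "0 < s" for s
    using DERIV_diff[OF DERIV_ident mittag_leffler2_has_derivative[OF \<alpha>(1) that, of 1]] that
    by (simp add: F_def[abs_def] w_def e_def)
  have J: "J s = Gamma (1 - \<alpha>) * (s - F s)" if "0 < s" for s
  proof -
    have "J s = - (LINT \<tau>:{0..s}|lborel. (s - \<tau>) powr (- \<alpha>) * (mittag_leffler \<alpha> (- (1 * \<tau> powr \<alpha>)) - 1))"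
      unfolding J_def set_lebesgue_integral_def Bochner_Integration.integral_minus[symmetric]
      by (intro Bochner_Integration.integral_cong) (auto simp: indicator_def w_def e_def algebra_simps)
    also have "\<dots> = Gamma (1 - \<alpha>) * (s * mittag_leffler2 \<alpha> (- (s powr \<alpha>)))"
      unfolding mittag_leffler_fractional_integral[OF \<alpha> that] by simp
    finally show ?thesis by (simp add: F_def)
  qed
  have cF: "continuous_on {0..} F"
  proof -
    have "isCont (mittag_leffler2 \<alpha>) x" for x
    proof (rule DERIV_isCont)
      show "(mittag_leffler2 \<alpha> has_field_derivative (\<Sum>n. diffs (\<lambda>k. rGamma (2 + \<alpha> * real k)) n * x ^ n)) (at x)"
        unfolding mittag_leffler2_def[abs_def]
        by (rule termdiffs_strong_converges_everywhere)
          (rule summable_rabs_cancel[OF mittag_leffler2_summable_abs[OF \<alpha>(1)]])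
    qed
    then have c: "continuous_on UNIV (mittag_leffler2 \<alpha>)" by (simp add: continuous_at_imp_continuous_on)
    show ?thesis unfolding F_def[abs_def]
      by (intro continuous_intros continuous_on_compose2[OF c] continuous_on_powr') (use \<alpha> in auto)
  qed
  have F0: "F 0 = 0" by (simp add: F_def)
  have key: "h * (Gamma (1 - \<alpha>) * e t) \<ge> t powr (- \<alpha>) * (h * (w t - w h))" if h: "0 < h" for h
  proof -
    have int: "set_integrable lborel {0..s} (\<lambda>\<tau>. (s - \<tau>) powr (- \<alpha>) * g \<tau>)"
      if "0 < s" "g \<in> borel_measurable lborel" "\<And>\<tau>. \<bar>g \<tau>\<bar> \<le> C" for g C and s :: real
      by (rule frac_kernel_set_integrable[OF \<alpha>(2)]) (use that in auto)
    have iw: "set_integrable lborel {0..t} g"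
      if "g \<in> borel_measurable lborel" "\<And>\<tau>. \<bar>g \<tau>\<bar> \<le> C" for g :: "real \<Rightarrow> real" and C
      unfolding set_integrable_def
    proof (rule Bochner_Integration.integrable_bound)
      show "integrable lborel (\<lambda>x. C * indicat_real {0..t} x)" by (intro integrable_mult_right integrable_real_indicator) (use t in auto)
      show "AE x in lborel. norm (indicat_real {0..t} x *\<^sub>R g x) \<le> norm (C * indicat_real {0..t} x)"
        using order_trans[OF that(2) abs_ge_self[of C]] by (intro AE_I2) (auto simp: indicator_def)
    qed (use that in measurable)
    let ?I0 = "LINT r:{0..t}|lborel. (t - r) powr (- \<alpha>) * w r"
      and ?I1 = "LINT r:{0..t}|lborel. (t - r) powr (- \<alpha>) * w (r + h)"
      and ?d = "\<lambda>r. (t - r) powr (- \<alpha>) * w (r + h) - (t - r) powr (- \<alpha>) * w r"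
      and ?d' = "\<lambda>r. t powr (- \<alpha>) * (w (r + h) - w r)"
    have m: "(\<lambda>r. w (r + h)) \<in> borel_measurable lborel" "w \<in> borel_measurable lborel" by measurable
    \<comment> \<open>Since \<open>w \<ge> 0\<close>, the part of \<open>J (t + h)\<close> over \<open>{0..h}\<close> may be dropped; the rest is a translate of the
      integral for \<open>J t\<close>.\<close>
    have "?I1 \<le> J (t + h)"
    proof -
      have "?I1
         = (LINT r|lborel. indicator {0..t} (- h + 1 * r) *\<^sub>R ((t - (- h + 1 * r)) powr (- \<alpha>) * w ((- h + 1 * r) + h)))"
        unfolding set_lebesgue_integral_def by (subst lborel_integral_real_affine[of 1 _ "- h"]) simp_all
      also have "\<dots> = (LINT r:{h..t+h}|lborel. (t + h - r) powr (- \<alpha>) * w r)"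
        unfolding set_lebesgue_integral_def
        by (intro Bochner_Integration.integral_cong) (auto simp: indicator_def algebra_simps)
      also have "\<dots> \<le> J (t + h)" unfolding J_def set_lebesgue_integral_def
      proof (rule integral_mono)
        have I: "set_integrable lborel {0..t+h} (\<lambda>r. (t + h - r) powr (- \<alpha>) * w r)"
          by (rule int[OF _ m(2) w01]) (use t h in simp)
        then show "integrable lborel (\<lambda>r. indicat_real {0..t+h} r *\<^sub>R ((t + h - r) powr (- \<alpha>) * w r))"
          by (simp add: set_integrable_def)
        have "set_integrable lborel {h..t+h} (\<lambda>r. (t + h - r) powr (- \<alpha>) * w r)"
          by (rule set_integrable_subset[OF I]) (use h in auto)
        then show "integrable lborel (\<lambda>r. indicat_real {h..t+h} r *\<^sub>R ((t + h - r) powr (- \<alpha>) * w r))"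
          by (simp add: set_integrable_def)
      qed (use e h in \<open>auto simp: indicator_def w_def\<close>)
      finally show ?thesis .
    qed
    then have "J (t + h) - J t \<ge> ?I1 - ?I0"
      by (simp add: J_def)
    also have "?I1 - ?I0
       = (LINT r:{0..t}|lborel. ?d r)"
      by (rule set_integral_diff(2)[symmetric]) (use int[OF t m(1) w01] int[OF t m(2) w01] in auto)
    also have "\<dots> \<ge> (LINT r:{0..t}|lborel. ?d' r)"
    proof (rule set_integral_mono_AE)
      show "set_integrable lborel {0..t} (\<lambda>r. ?d' r)"
        by (intro set_integrable_mult_right set_integral_diff iw[OF m(1) w01] iw[OF m(2) w01])
      show "set_integrable lborel {0..t} (\<lambda>r. ?d r)"
        by (intro set_integral_diff int[OF t m(1) w01] int[OF t m(2) w01])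
      \<comment> \<open>At \<open>r = t\<close> the kernel takes the default value \<open>0 powr (- \<alpha>) = 0\<close>.\<close>
      have "AE r in lborel. r \<noteq> t" by (rule AE_lborel_singleton)
      then show "AE r\<in>{0..t} in lborel. ?d' r \<le> ?d r"
      proof eventually_elim
        case (elim r)
        have "?d' r \<le> (t - r) powr (- \<alpha>) * (w (r + h) - w r)" if "r \<in> {0..t}"
          using that elim \<alpha> emono[of r "r + h"] h by (intro mult_right_mono powr_mono2') (auto simp: w_def)
        then show ?case by (simp add: right_diff_distrib)
      qed
    qed
    also have "(LINT r:{0..t}|lborel. ?d' r) = t powr (- \<alpha>) * (LINT r:{0..t}|lborel. w (r + h) - w r)"
      by simp
    also have "(LINT r:{0..t}|lborel. w (r + h) - w r) = (F (t + h) - F t) - (F (0 + h) - F 0)"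
    proof -
      have "((\<lambda>r. w (r + h) - w r) has_integral (F (t + h) - F t) - (F (0 + h) - F 0)) {0..t}"
      proof (rule fundamental_theorem_of_calculus_interior)
        show "continuous_on {0..t} (\<lambda>r. F (r + h) - F r)"
          by (intro continuous_intros continuous_on_compose2[OF cF] continuous_on_subset[OF cF]) (use h in auto)
        show "((\<lambda>r. F (r + h) - F r) has_vector_derivative w (r + h) - w r) (at r)" if "r \<in> {0<..<t}" for r
          unfolding has_real_derivative_iff_has_vector_derivative[symmetric]
          using that h by (intro DERIV_diff dF DERIV_shift[THEN iffD1]) auto
      qed (use t in simp)
      then show ?thesis
        using set_borel_integral_eq_integral(2)[OF set_integral_diff(1)[OF iw[OF m(1) w01] iw[OF m(2) w01]]]
        by (simp add: integral_unique)
    qed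
    finally have 1: "J (t + h) - J t \<ge> t powr (- \<alpha>) * ((F (t + h) - F t) - (F (0 + h) - F 0))" by simp
    have MVT: "\<exists>z. a < z \<and> z < b \<and> F b - F a = (b - a) * w z" if "0 \<le> a" "a < b" for a b
    proof -
      note ab = that(2)
      have "continuous_on {a..b} F" by (rule continuous_on_subset[OF cF]) (use that in auto)
      then obtain z where "a < z" "z < b" "F b - F a = w z * (b - a)"
      proof (rule mvt[OF ab, of F "\<lambda>x. (*) (w x)"])
        show "(F has_derivative (*) (w x)) (at x)" if "a < x" for x
          using dF[of x] \<open>0 \<le> a\<close> that by (simp add: has_field_derivative_def)
      qed blast
      then show ?thesis by (auto simp: mult.commute)
    qed
    obtain z where z: "t < z" "F (t + h) - F t = h * w z" using MVT[of t "t + h"] t h by auto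
    obtain y where y: "y < h" "F (0 + h) - F 0 = h * w y" using MVT[of 0 "0 + h"] h by auto
    have wz: "w t \<le> w z" "w y \<le> w h" using emono z y by (auto simp: w_def)
    have "h * (w t - w h) \<le> (F (t + h) - F t) - (F (0 + h) - F 0)"
      unfolding z y using wz h by (simp add: right_diff_distrib[symmetric] mult_left_mono)
    then have "t powr (- \<alpha>) * (h * (w t - w h)) \<le> J (t + h) - J t"
      using 1 by (meson mult_left_mono powr_ge_zero order_trans)
    also have "\<dots> = Gamma (1 - \<alpha>) * (h - (F (t + h) - F t))"
      using J[of t] J[of "t + h"] t h by (simp add: algebra_simps)
    also have "\<dots> = Gamma (1 - \<alpha>) * (h * e z)"
      unfolding z by (simp add: w_def algebra_simps)
    also have "\<dots> \<le> Gamma (1 - \<alpha>) * (h * e t)"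
      using emono[of t z] z h \<alpha> by (intro mult_left_mono) (auto intro!: less_imp_le[OF Gamma_real_pos])
    finally show ?thesis by (simp add: mult_ac)
  qed
  have "(\<lambda>n. t powr (- \<alpha>) * (w t - w (inverse (real (Suc n))))) \<longlonglongrightarrow> t powr (- \<alpha>) * (w t - w 0)"
  proof (intro tendsto_intros)
    have "continuous_on {0..} w" unfolding w_def[abs_def]
    proof (intro continuous_intros)
      show "continuous_on {0..} e"
        by (rule continuous_on_eq[OF mittag_leffler_continuous_time[OF \<alpha>(1), of 1]]) (auto simp: e_def)
    qed
    then show "(\<lambda>n. w (inverse (real (Suc n)))) \<longlonglongrightarrow> w 0"
      unfolding continuous_on_sequentially using LIMSEQ_inverse_real_of_nat by (auto simp: comp_def)
  qed
  moreover have "t powr (- \<alpha>) * (w t - w (inverse (real (Suc n)))) \<le> Gamma (1 - \<alpha>) * e t" for n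
  proof -
    have "0 < inverse (real (Suc n))" by simp
    from key[OF this] this show ?thesis
      by (metis mult.left_commute mult_le_cancel_left_pos)
  qed
  ultimately have "t powr (- \<alpha>) * (w t - w 0) \<le> Gamma (1 - \<alpha>) * e t"
    by (blast intro: LIMSEQ_le_const2)
  then show ?thesis using t by (simp add: w_def e_def mittag_leffler_0)
qed

text \<open>So \<open>E\<^sub>\<alpha>(- x)\<close> decays no faster than \<open>1 / x\<close>. For \<open>d \<ge> \<beta>\<close> this slow decay makes the
fundamental solution singular at the origin.\<close>

lemma mittag_leffler_lower_bound:
  assumes \<alpha>: "0 < \<alpha>" "\<alpha> < 1" and x: "0 \<le> x"
  shows "1 / (1 + Gamma (1 - \<alpha>) * x) \<le> mittag_leffler \<alpha> (- x)"
proof (cases "x = 0")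
  case False
  define t where "t = x powr (1 / \<alpha>)"
  have t: "0 < t" "t powr \<alpha> = x" using False x \<alpha> by (auto simp: t_def powr_powr)
  have G: "Gamma (1 - \<alpha>) > 0" using \<alpha> by (simp add: Gamma_real_pos)
  have "(1 - mittag_leffler \<alpha> (- x)) / x \<le> Gamma (1 - \<alpha>) * mittag_leffler \<alpha> (- x)"
    using mittag_leffler_lower_bound_time[OF \<alpha> t(1)] t by (simp add: powr_minus field_simps)
  then have "1 \<le> mittag_leffler \<alpha> (- x) * (1 + Gamma (1 - \<alpha>) * x)"
    using False x by (simp add: field_simps)
  then show ?thesis using G x by (subst pos_divide_le_eq) (auto simp: add_pos_nonneg)
qed (simp add: mittag_leffler_0)

section \<open>Gaussian integrals and Fourier inversion\<close>

lemma lborel_integral_affine: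
  fixes f :: "'a::euclidean_space \<Rightarrow> 'b::{banach, second_countable_topology}"
  assumes c: "c \<noteq> 0" and [measurable]: "f \<in> borel_measurable borel"
  shows "(LINT x|lborel. f x) = \<bar>c\<bar> ^ DIM('a) *\<^sub>R (LINT x|lborel. f (t + c *\<^sub>R x))"
  by (subst lborel_affine[OF c, of t]) (simp add: integral_density integral_distr)

text \<open>The characteristic function of the standard normal law, rescaled.\<close>

lemma gaussian_fourier_real:
  fixes t \<delta> :: real
  assumes \<delta>: "0 < \<delta>"
  shows "has_bochner_integral lborel (\<lambda>x. exp (- (\<delta> * x\<^sup>2)) *\<^sub>R cis (x * t))
    (of_real ((pi / \<delta>) powr (1/2) * exp (- (t\<^sup>2 / (4 * \<delta>)))))"
proof -
  define c where "c = sqrt (2 * \<delta>)"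
  have c: "0 < c" "c\<^sup>2 = 2 * \<delta>" using \<delta> by (auto simp: c_def)
  define s where "s = t / c"
  define f where "f x = exp (- (x\<^sup>2 / 2)) *\<^sub>R cis (x * s)" for x
  have [measurable]: "f \<in> borel_measurable borel" unfolding f_def[abs_def] cis_conv_exp by measurable
  have "char std_normal_distribution s = (LINT x|lborel. std_normal_density x *\<^sub>R iexp (s * x))"
    unfolding char_def by (rule integral_density) auto
  also have "\<dots> = (LINT x|lborel. (1 / sqrt (2 * pi)) *\<^sub>R f x)"
    by (simp add: std_normal_density_def f_def cis_conv_exp mult_ac)
  also have "\<dots> = (1 / sqrt (2 * pi)) *\<^sub>R (LINT x|lborel. f x)" by (rule integral_scaleR_right)
  finally have "(1 / sqrt (2 * pi)) *\<^sub>R (LINT x|lborel. f x) = of_real (exp (- (s\<^sup>2) / 2))"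
    by (simp add: char_std_normal_distribution)
  then have "sqrt (2 * pi) *\<^sub>R ((1 / sqrt (2 * pi)) *\<^sub>R (LINT x|lborel. f x)) = sqrt (2 * pi) *\<^sub>R of_real (exp (- (s\<^sup>2) / 2))"
    by simp
  then have v: "(LINT x|lborel. f x) = of_real (sqrt (2 * pi) * exp (- (s\<^sup>2) / 2))"
    by (simp add: scaleR_conv_of_real)
  have "integrable lborel (\<lambda>x. sqrt (2 * pi) * std_normal_density x)"
    using integrable_std_normal_moment[of 0] by simp
  then have "integrable lborel f"
    by (rule Bochner_Integration.integrable_bound) (auto simp: f_def std_normal_density_def)
  with v have "has_bochner_integral lborel f (of_real (sqrt (2 * pi) * exp (- (s\<^sup>2) / 2)))"
    by (simp add: has_bochner_integral_iff)
  then have "has_bochner_integral lborel (\<lambda>x. f (0 + c * x)) (of_real (sqrt (2 * pi) * exp (- (s\<^sup>2) / 2)) /\<^sub>R \<bar>c\<bar>)"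
    using lborel_has_bochner_integral_real_affine_iff[of c f _ 0] c by simp
  moreover have "f (0 + c * x) = exp (- (\<delta> * x\<^sup>2)) *\<^sub>R cis (x * t)" for x
    using c by (simp add: f_def s_def power_mult_distrib mult_ac)
  moreover have "of_real (sqrt (2 * pi) * exp (- (s\<^sup>2) / 2)) /\<^sub>R \<bar>c\<bar> = complex_of_real ((pi / \<delta>) powr (1/2) * exp (- (t\<^sup>2 / (4 * \<delta>))))"
  proof -
    have "sqrt (2 * pi) / c = sqrt (pi / \<delta>)" by (simp add: c_def real_sqrt_divide[symmetric])
    moreover have "- (s\<^sup>2) / 2 = - (t\<^sup>2 / (4 * \<delta>))" by (simp add: s_def power_divide c)
    ultimately have "sqrt (2 * pi) * exp (- (s\<^sup>2) / 2) / c = (pi / \<delta>) powr (1/2) * exp (- (t\<^sup>2 / (4 * \<delta>)))"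
      using \<delta> by (simp add: powr_half_sqrt flip: times_divide_eq_left)
    moreover have "complex_of_real A /\<^sub>R \<bar>c\<bar> = of_real (A / c)" for A
      using c by (simp add: scaleR_conv_of_real field_simps)
    ultimately show ?thesis by (simp only:)
  qed
  ultimately show ?thesis by simp
qed

text \<open>Lebesgue measure on a Euclidean space is the image of a product measure under the coordinate map,
so integrals of products of functions of single coordinates factorise.\<close>

lemma lborel_product_integral:
  fixes f :: "'a::euclidean_space \<Rightarrow> real \<Rightarrow> complex"
  assumes f: "\<And>b. b \<in> Basis \<Longrightarrow> has_bochner_integral lborel (f b) (I b)"
  shows "has_bochner_integral lborel (\<lambda>x::'a. \<Prod>b\<in>Basis. f b (x \<bullet> b)) (\<Prod>b\<in>Basis. I b)"
proof -
  interpret product_sigma_finite "\<lambda>_::'a. lborel :: real measure" ..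
  define T where "T = (\<lambda>h::'a \<Rightarrow> real. \<Sum>b\<in>Basis. h b *\<^sub>R b)"
  have eq: "(lborel :: 'a measure) = distr (\<Pi>\<^sub>M b\<in>Basis. lborel) borel T"
    unfolding lborel_def[where 'a='a] lborel_eq_real T_def ..
  have [measurable]: "T \<in> measurable (\<Pi>\<^sub>M b\<in>Basis. lborel) borel"
    unfolding T_def by measurable
  have m: "(\<lambda>x::'a. \<Prod>b\<in>Basis. f b (x \<bullet> b)) \<in> borel_measurable borel"
  proof (rule borel_measurable_prod)
    fix b :: 'a assume "b \<in> Basis"
    then have [measurable]: "f b \<in> borel_measurable borel" using f[of b] by (auto simp: has_bochner_integral_iff dest: borel_measurable_integrable)
    show "(\<lambda>x. f b (x \<bullet> b)) \<in> borel_measurable borel" by measurable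
  qed
  have T: "(\<Prod>b\<in>Basis. f b (T h \<bullet> b)) = (\<Prod>b\<in>Basis. f b (h b))" for h
    by (intro prod.cong) (auto simp: T_def inner_sum_left_Basis)
  have i: "integrable lborel (f b)" if "b \<in> Basis" for b using f[OF that] by (simp add: has_bochner_integral_iff)
  have "integrable lborel (\<lambda>x::'a. \<Prod>b\<in>Basis. f b (x \<bullet> b))"
    unfolding eq using product_integrable_prod[of Basis f] i m
    by (subst integrable_distr_eq) (auto simp: T)
  moreover have "(LINT x|lborel. (\<Prod>b\<in>Basis. f b (x \<bullet> b))) = (\<Prod>b\<in>Basis. I b)"
    unfolding eq using product_integral_prod[of Basis f] i m f
    by (subst integral_distr) (auto simp: T has_bochner_integral_iff)
  ultimately show ?thesis by (simp add: has_bochner_integral_iff)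
qed

lemma norm_sq_sum_Basis: "(norm (x::'a::euclidean_space))\<^sup>2 = (\<Sum>b\<in>Basis. (x \<bullet> b)\<^sup>2)"
  unfolding power2_norm_eq_inner by (subst euclidean_inner) (simp add: power2_eq_square)

lemma power2_powr_half: "0 < y \<Longrightarrow> (y\<^sup>2) powr (real n / 2) = y ^ n" for y :: real
proof -
  assume y: "0 < y"
  have "(y\<^sup>2) powr (real n / 2) = (y powr 2) powr (real n / 2)" using y by simp
  also have "\<dots> = y powr real n" by (simp only: powr_powr) simp
  also have "\<dots> = y ^ n" by (rule powr_realpow[OF y])
  finally show ?thesis .
qed

abbreviation gauss :: "real \<Rightarrow> 'a::euclidean_space \<Rightarrow> real" where
  "gauss c x \<equiv> exp (- (c * (norm x)\<^sup>2))"

lemma gaussian_fourier: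
  fixes \<xi> :: "'a::euclidean_space"
  assumes \<delta>: "0 < \<delta>"
  shows "has_bochner_integral lborel (\<lambda>x::'a. gauss \<delta> x *\<^sub>R cis (x \<bullet> \<xi>))
    (of_real ((pi / \<delta>) powr (DIM('a)/2) * exp (- ((norm \<xi>)\<^sup>2 / (4 * \<delta>)))))"
proof -
  have "has_bochner_integral lborel (\<lambda>x::'a. \<Prod>b\<in>Basis. exp (- (\<delta> * (x \<bullet> b)\<^sup>2)) *\<^sub>R cis ((x \<bullet> b) * (\<xi> \<bullet> b)))
     (\<Prod>b\<in>(Basis::'a set). of_real ((pi / \<delta>) powr (1/2) * exp (- ((\<xi> \<bullet> b)\<^sup>2 / (4 * \<delta>)))))"
    using lborel_product_integral[where f = "\<lambda>b y. exp (- (\<delta> * y\<^sup>2)) *\<^sub>R cis (y * (\<xi> \<bullet> b))",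
        OF gaussian_fourier_real[OF \<delta>]] .
  moreover have "(\<Prod>b\<in>Basis. exp (- (\<delta> * (x \<bullet> b)\<^sup>2)) *\<^sub>R cis ((x \<bullet> b) * (\<xi> \<bullet> b))) = gauss \<delta> x *\<^sub>R cis (x \<bullet> \<xi>)" for x
  proof -
    have "(\<Prod>b\<in>Basis. exp (- (\<delta> * (x \<bullet> b)\<^sup>2))) = gauss \<delta> x"
      unfolding norm_sq_sum_Basis by (subst exp_sum[symmetric]) (simp_all only: finite_Basis sum_distrib_left sum_negf)
    moreover have "(\<Prod>b\<in>Basis. cis ((x \<bullet> b) * (\<xi> \<bullet> b))) = cis (x \<bullet> \<xi>)"
      unfolding cis_conv_exp euclidean_inner[of x \<xi>]
      by (subst exp_sum[symmetric]) (simp_all only: finite_Basis of_real_sum sum_distrib_left)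
    ultimately show ?thesis by (simp only: scaleR_conv_of_real prod.distrib of_real_prod[symmetric])
  qed
  moreover have "(\<Prod>b\<in>(Basis::'a set). complex_of_real ((pi / \<delta>) powr (1/2) * exp (- ((\<xi> \<bullet> b)\<^sup>2 / (4 * \<delta>)))))
     = of_real ((pi / \<delta>) powr (DIM('a)/2) * exp (- ((norm \<xi>)\<^sup>2 / (4 * \<delta>))))"
  proof -
    have "(\<Prod>b\<in>(Basis::'a set). exp (- ((\<xi> \<bullet> b)\<^sup>2 / (4 * \<delta>)))) = exp (- ((norm \<xi>)\<^sup>2 / (4 * \<delta>)))"
      unfolding norm_sq_sum_Basis by (subst exp_sum[symmetric]) (simp_all only: finite_Basis sum_divide_distrib sum_negf)
    moreover have "(\<Prod>b\<in>(Basis::'a set). (pi / \<delta>) powr (1/2)) = (pi / \<delta>) powr (DIM('a)/2)"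
      using \<delta> unfolding prod_constant by (subst powr_power) auto
    ultimately show ?thesis by (simp only: of_real_prod[symmetric] prod.distrib)
  qed
  ultimately show ?thesis by (simp only:)
qed

lemma gaussian_integrable:
  assumes "0 < \<delta>"
  shows "integrable lborel (\<lambda>x::'a::euclidean_space. gauss \<delta> x)"
  using has_bochner_integral_Re[OF gaussian_fourier[OF assms, of "0::'a"]] by (simp add: has_bochner_integral_iff)

lemma gaussian_integral:
  assumes "0 < \<delta>"
  shows "(LINT x|lborel. gauss \<delta> (x::'a::euclidean_space)) = (pi / \<delta>) powr (DIM('a)/2)"
  using has_bochner_integral_Re[OF gaussian_fourier[OF assms, of "0::'a"]] by (simp add: has_bochner_integral_iff)

lemma gaussian_cos_integral:
  assumes "0 < \<delta>"
  shows "(LINT \<xi>|lborel. cos (x \<bullet> \<xi>) * gauss \<delta> (\<xi>::'a::euclidean_space))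
     = (pi / \<delta>) powr (DIM('a)/2) * exp (- ((norm x)\<^sup>2 / (4 * \<delta>)))"
  using has_bochner_integral_Re[OF gaussian_fourier[OF assms, of x]]
  by (simp add: has_bochner_integral_iff inner_commute mult.commute)

text \<open>Half of the Gaussian absorbs the polynomial: \<open>(1 + r) ^ N \<le> N! exp (1 + r)\<close>, and
\<open>r \<le> \<delta> r\<^sup>2 / 2 + 1 / (2 \<delta>)\<close>.\<close>

lemma polynomial_gaussian_integrable:
  assumes \<delta>: "0 < \<delta>"
  shows "integrable lborel (\<lambda>x::'a::euclidean_space. (1 + norm x) ^ N * gauss \<delta> x)"
proof (rule Bochner_Integration.integrable_bound)
  show "integrable lborel (\<lambda>x::'a. (fact N * exp (1 + 1 / (2 * \<delta>))) * gauss (\<delta> / 2) x)"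
    by (intro integrable_mult_right gaussian_integrable) (use \<delta> in simp)
  show "AE x in lborel. norm ((1 + norm (x::'a)) ^ N * gauss \<delta> x)
     \<le> norm ((fact N * exp (1 + 1 / (2 * \<delta>))) * gauss (\<delta> / 2) x)"
  proof (rule AE_I2)
    fix x :: 'a
    define r where "r = norm x"
    have "(1 + r) ^ N / fact N \<le> exp (1 + r)"
    proof -
      have "(\<Sum>n\<in>{N}. (1 + r) ^ n /\<^sub>R fact n) \<le> (\<Sum>n. (1 + r) ^ n /\<^sub>R fact n)"
        by (rule sum_le_suminf, rule summable_exp_generic) (auto simp: r_def)
      then show ?thesis by (simp add: exp_def divide_inverse mult.commute)
    qed
    then have 1: "(1 + r) ^ N \<le> fact N * exp (1 + r)" by (simp add: field_simps)
    have "0 \<le> (\<delta> * r - 1)\<^sup>2 / (2 * \<delta>)" using \<delta> by simp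
    also have "(\<delta> * r - 1)\<^sup>2 / (2 * \<delta>) = \<delta> / 2 * r\<^sup>2 - r + 1 / (2 * \<delta>)"
      using \<delta> by (simp add: power2_eq_square field_simps)
    finally have 2: "exp (1 + r) \<le> exp (1 + 1 / (2 * \<delta>) + \<delta> / 2 * r\<^sup>2)" by simp
    have "(1 + r) ^ N * exp (- (\<delta> * r\<^sup>2)) \<le> (fact N * exp (1 + 1 / (2 * \<delta>) + \<delta> / 2 * r\<^sup>2)) * exp (- (\<delta> * r\<^sup>2))"
      using 1 2 by (intro mult_right_mono) (auto intro: order_trans mult_left_mono)
    also have "\<dots> = (fact N * exp (1 + 1 / (2 * \<delta>))) * exp (- (\<delta> / 2 * r\<^sup>2))"
      by (simp add: exp_add[symmetric] mult.assoc)
    finally show "norm ((1 + norm x) ^ N * gauss \<delta> x)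
     \<le> norm ((fact N * exp (1 + 1 / (2 * \<delta>))) * gauss (\<delta> / 2) x)"
      by (simp add: r_def)
  qed
qed measurable

lemma even_fourier_real:
  fixes g :: "'a::euclidean_space \<Rightarrow> real"
  assumes g: "integrable lborel g" and even: "\<And>\<xi>. g (- \<xi>) = g \<xi>"
  shows "(LINT \<xi>|lborel. g \<xi> *\<^sub>R cis (x \<bullet> \<xi>)) = of_real (LINT \<xi>|lborel. cos (x \<bullet> \<xi>) * g \<xi>)"
proof -
  have [measurable]: "g \<in> borel_measurable borel" using g by (auto dest: borel_measurable_integrable)
  have i: "integrable lborel (\<lambda>\<xi>. g \<xi> *\<^sub>R cis (x \<bullet> \<xi>))"
    using g by (rule Bochner_Integration.integrable_bound) (auto simp: cis_conv_exp)
  have "(LINT \<xi>|lborel. sin (x \<bullet> \<xi>) * g \<xi>) = (LINT \<xi>|lborel. - (sin (x \<bullet> \<xi>) * g \<xi>))"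
    using lborel_integral_affine[of "-1" "\<lambda>\<xi>. sin (x \<bullet> \<xi>) * g \<xi>" 0] by (simp add: even)
  then have "(LINT \<xi>|lborel. sin (x \<bullet> \<xi>) * g \<xi>) = 0" by simp
  then show ?thesis
    using integral_Re[OF i] integral_Im[OF i] by (simp add: complex_eq_iff mult.commute)
qed

text \<open>Fourier inversion for a continuous bounded integrable \<open>g\<close> whose transform \<open>u\<close> is nonnegative; the
integrability of \<open>u\<close> is part of the conclusion. By Fubini, integrating \<open>u x cis (- x \<bullet> \<eta>)\<close> against
\<open>exp (- \<delta> |x|\<^sup>2)\<close> gives a Gaussian average of \<open>g\<close> around \<open>\<eta>\<close>, which tends to \<open>(2 \<pi>) ^ d * g \<eta>\<close> as \<open>\<delta>\<close>
tends to \<open>0\<close>. At \<open>\<eta> = 0\<close> the left-hand side increases to the integral of \<open>u \<ge> 0\<close>, so \<open>u\<close> is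
integrable by monotone convergence; then dominated convergence handles every \<open>\<eta>\<close>.\<close>

lemma fourier_inversion_nonneg:
  fixes g :: "'a::euclidean_space \<Rightarrow> real" and u :: "'a \<Rightarrow> real"
  assumes cont: "continuous_on UNIV g" and bnd: "\<And>\<xi>. \<bar>g \<xi>\<bar> \<le> B" and int: "integrable lborel g"
    and u: "\<And>x. (LINT \<xi>|lborel. g \<xi> *\<^sub>R cis (x \<bullet> \<xi>)) = of_real (u x)"
    and nonneg: "\<And>x. 0 \<le> u x"
  shows "integrable lborel u"
    and "(LINT x|lborel. u x *\<^sub>R cis (- (x \<bullet> \<eta>))) = of_real ((2 * pi) ^ DIM('a) * g \<eta>)"
proof -
  let ?c = "\<lambda>\<delta>. (pi / \<delta>) powr (DIM('a)/2)"
  let ?K = "\<lambda>\<delta> \<eta>. (4 * pi) powr (DIM('a)/2) * (LINT z|lborel. g (\<eta> + (2 * sqrt \<delta>) *\<^sub>R z) * exp (- (norm z)\<^sup>2))"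
  have [measurable]: "g \<in> borel_measurable borel" using cont by (rule borel_measurable_continuous_onI)
  have cis_m [measurable]: "cis \<in> borel_measurable borel" unfolding cis_conv_exp[abs_def] by measurable
  have um [measurable]: "u \<in> borel_measurable borel"
  proof -
    have "u = (\<lambda>x. Re (LINT \<xi>|lborel. g \<xi> *\<^sub>R cis (x \<bullet> \<xi>)))" by (simp add: u)
    also have "\<dots> \<in> borel_measurable borel" by measurable
    finally show ?thesis .
  qed
  have A: "has_bochner_integral lborel (\<lambda>x. (u x * gauss \<delta> x) *\<^sub>R cis (- (x \<bullet> \<eta>)))
      (of_real (?K \<delta> \<eta>))"
    if \<delta>: "0 < \<delta>" for \<delta> \<eta>
  proof -
    define f where "f = (\<lambda>(x::'a, \<xi>). (g \<xi> * gauss \<delta> x) *\<^sub>R cis (x \<bullet> (\<xi> - \<eta>)))"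
    have fm [measurable]: "f \<in> borel_measurable (lborel \<Otimes>\<^sub>M lborel)" unfolding f_def by measurable
    have fint: "integrable (lborel \<Otimes>\<^sub>M lborel) f"
    proof (rule lborel_pair.Fubini_integrable[OF fm])
      have "(LINT y|lborel. norm (f (x, y))) = gauss \<delta> x * (LINT y|lborel. \<bar>g y\<bar>)" for x
        by (simp add: f_def abs_mult mult.commute)
      then show "integrable lborel (\<lambda>x. LINT y|lborel. norm (f (x, y)))"
        using gaussian_integrable[OF \<delta>, where 'a='a] by simp
      show "AE x in lborel. integrable lborel (\<lambda>y. f (x, y))"
      proof (rule AE_I2)
        fix x :: 'a
        have "integrable lborel (\<lambda>y. gauss \<delta> x * g y)" using int by simp
        then show "integrable lborel (\<lambda>y. f (x, y))"
          by (rule Bochner_Integration.integrable_bound) (auto simp: f_def abs_mult mult.commute)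
      qed
    qed
    have fx: "(LINT \<xi>|lborel. f (x, \<xi>)) = (u x * gauss \<delta> x) *\<^sub>R cis (- (x \<bullet> \<eta>))" for x
    proof -
      have eq: "f (x, \<xi>) = (g \<xi> *\<^sub>R cis (x \<bullet> \<xi>)) * (gauss \<delta> x *\<^sub>R cis (- (x \<bullet> \<eta>)))" for \<xi>
        by (simp add: f_def inner_diff_right cis_mult[symmetric] cis_divide[symmetric] scaleR_conv_of_real cis_inverse[symmetric] divide_inverse del: cis_inverse cis_mult cis_divide)
      have "(LINT \<xi>|lborel. f (x, \<xi>)) = (LINT \<xi>|lborel. g \<xi> *\<^sub>R cis (x \<bullet> \<xi>)) * (gauss \<delta> x *\<^sub>R cis (- (x \<bullet> \<eta>)))"
        unfolding eq by (rule integral_mult_left_zero)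
      then show ?thesis unfolding u by (simp add: scaleR_conv_of_real)
    qed
    have fy: "(LINT x|lborel. f (x, \<xi>)) = of_real (g \<xi> * (?c \<delta> * exp (- ((norm (\<xi> - \<eta>))\<^sup>2 / (4 * \<delta>)))))" for \<xi>
    proof -
      have eq: "f (x, \<xi>) = of_real (g \<xi>) * (gauss \<delta> x *\<^sub>R cis (x \<bullet> (\<xi> - \<eta>)))" for x
        by (simp add: f_def scaleR_conv_of_real)
      show ?thesis unfolding eq integral_mult_right_zero
        has_bochner_integral_integral_eq[OF gaussian_fourier[OF \<delta>, of "\<xi> - \<eta>"]] of_real_mult ..
    qed
    have "integrable lborel (\<lambda>x. (u x * gauss \<delta> x) *\<^sub>R cis (- (x \<bullet> \<eta>)))"
      using lborel_pair.integrable_fst'[OF fint] by (simp add: fx)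
    moreover have "(LINT x|lborel. (u x * gauss \<delta> x) *\<^sub>R cis (- (x \<bullet> \<eta>))) =
        (LINT \<xi>|lborel. of_real (g \<xi> * (?c \<delta> * exp (- ((norm (\<xi> - \<eta>))\<^sup>2 / (4 * \<delta>))))))"
      using lborel_pair.Fubini_integral[of "\<lambda>x \<xi>. f (x, \<xi>)"] fint by (simp add: fx fy)
    moreover have "(LINT \<xi>|lborel. complex_of_real (g \<xi> * (?c \<delta> * exp (- ((norm (\<xi> - \<eta>))\<^sup>2 / (4 * \<delta>))))))
       = of_real (?K \<delta> \<eta>)"
    proof -
      have "(LINT \<xi>|lborel. g \<xi> * (?c \<delta> * exp (- ((norm (\<xi> - \<eta>))\<^sup>2 / (4 * \<delta>)))))
        = (2 * sqrt \<delta>) ^ DIM('a) * (LINT z|lborel. g (\<eta> + (2 * sqrt \<delta>) *\<^sub>R z) * (?c \<delta> * exp (- ((norm ((2 * sqrt \<delta>) *\<^sub>R z))\<^sup>2 / (4 * \<delta>)))))"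
        using lborel_integral_affine[of "2 * sqrt \<delta>" "\<lambda>\<xi>. g \<xi> * (?c \<delta> * exp (- ((norm (\<xi> - \<eta>))\<^sup>2 / (4 * \<delta>))))" \<eta>] \<delta>
        by simp
      also have "\<dots> = (2 * sqrt \<delta>) ^ DIM('a) * (LINT z|lborel. ?c \<delta> * (g (\<eta> + (2 * sqrt \<delta>) *\<^sub>R z) * exp (- (norm z)\<^sup>2)))"
        using \<delta> by (simp add: power_mult_distrib mult_ac)
      also have "\<dots> = ((2 * sqrt \<delta>) ^ DIM('a) * ?c \<delta>) * (LINT z|lborel. g (\<eta> + (2 * sqrt \<delta>) *\<^sub>R z) * exp (- (norm z)\<^sup>2))"
        by simp
      also have "(2 * sqrt \<delta>) ^ DIM('a) * ?c \<delta> = (4 * pi) powr (DIM('a)/2)"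
      proof -
        have "(2 * sqrt \<delta>) ^ DIM('a) = ((2 * sqrt \<delta>)\<^sup>2) powr (DIM('a)/2)"
          using \<delta> by (intro power2_powr_half[symmetric]) simp
        then show ?thesis using \<delta> by (simp add: powr_mult[symmetric] power_mult_distrib mult_ac)
      qed
      finally show ?thesis by (simp only: integral_complex_of_real)
    qed
    ultimately show ?thesis by (simp only: has_bochner_integral_iff)
  qed
  define \<delta> where "\<delta> k = inverse (real (Suc k))" for k
  have \<delta>: "0 < \<delta> k" for k by (simp add: \<delta>_def)
  have \<delta>0: "\<delta> \<longlonglongrightarrow> 0" unfolding \<delta>_def by (rule LIMSEQ_inverse_real_of_nat)
  have R: "(\<lambda>k. ?K (\<delta> k) \<eta>) \<longlonglongrightarrow> (2 * pi) ^ DIM('a) * g \<eta>" for \<eta>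
  proof -
    have "(\<lambda>k. LINT z|lborel. g (\<eta> + (2 * sqrt (\<delta> k)) *\<^sub>R z) * exp (- (norm (z::'a))\<^sup>2)) \<longlonglongrightarrow> (LINT z|lborel. g \<eta> * exp (- (norm (z::'a))\<^sup>2))"
    proof (rule integral_dominated_convergence)
      show "integrable lborel (\<lambda>z::'a. B * exp (- (norm z)\<^sup>2))"
        using gaussian_integrable[of 1, where 'a='a] by simp
      show "AE z in lborel. (\<lambda>k. g (\<eta> + (2 * sqrt (\<delta> k)) *\<^sub>R z) * exp (- (norm (z::'a))\<^sup>2)) \<longlonglongrightarrow> g \<eta> * exp (- (norm z)\<^sup>2)"
      proof (rule AE_I2)
        fix z :: 'a
        have "(\<lambda>k. \<eta> + (2 * sqrt (\<delta> k)) *\<^sub>R z) \<longlonglongrightarrow> \<eta> + (2 * sqrt 0) *\<^sub>R z"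
          by (intro tendsto_intros \<delta>0)
        then have "(\<lambda>k. g (\<eta> + (2 * sqrt (\<delta> k)) *\<^sub>R z)) \<longlonglongrightarrow> g \<eta>"
          using cont by (auto simp: continuous_on_sequentially comp_def)
        then show "(\<lambda>k. g (\<eta> + (2 * sqrt (\<delta> k)) *\<^sub>R z) * exp (- (norm (z::'a))\<^sup>2)) \<longlonglongrightarrow> g \<eta> * exp (- (norm z)\<^sup>2)"
          by (intro tendsto_intros)
      qed
      show "AE z in lborel. norm (g (\<eta> + (2 * sqrt (\<delta> k)) *\<^sub>R z) * exp (- (norm (z::'a))\<^sup>2)) \<le> B * exp (- (norm z)\<^sup>2)" for k
        using bnd by (intro AE_I2) (simp add: abs_mult mult_right_mono)
    qed measurable
    then have "(\<lambda>k. ?K (\<delta> k) \<eta>) \<longlonglongrightarrow> (4 * pi) powr (DIM('a)/2) * (LINT z|lborel. g \<eta> * exp (- (norm (z::'a))\<^sup>2))"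
      by (intro tendsto_intros)
    moreover have "(4 * pi) powr (DIM('a)/2) * (LINT z|lborel. g \<eta> * exp (- (norm (z::'a))\<^sup>2)) = (2 * pi) ^ DIM('a) * g \<eta>"
    proof -
      have "(4 * pi) powr (DIM('a)/2) * pi powr (DIM('a)/2) = ((2 * pi)\<^sup>2) powr (DIM('a)/2)"
        by (simp add: powr_mult[symmetric] power2_eq_square mult.assoc)
      also have "\<dots> = (2 * pi) ^ DIM('a)"
        by (rule power2_powr_half) simp
      finally show ?thesis using gaussian_integral[of 1, where 'a='a] by (simp add: mult_ac)
    qed
    ultimately show ?thesis by (simp only:)
  qed
  have lim: "(\<lambda>k. u x * gauss (\<delta> k) x) \<longlonglongrightarrow> u x" for x
  proof -
    have "(\<lambda>k. u x * gauss (\<delta> k) x) \<longlonglongrightarrow> u x * exp (- (0 * (norm x)\<^sup>2))"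
      by (intro tendsto_intros \<delta>0)
    then show ?thesis by simp
  qed
  show uint: "integrable lborel u"
  proof (rule integrable_monotone_convergence)
    have A0: "has_bochner_integral lborel (\<lambda>x. u x * gauss (\<delta> k) x)
        (?K (\<delta> k) 0)" for k
      using has_bochner_integral_Re[OF A[OF \<delta>[of k], of 0]] by simp
    show "integrable lborel (\<lambda>x. u x * gauss (\<delta> k) x)" for k
      using A0 by (simp add: has_bochner_integral_iff)
    show "AE x in lborel. mono (\<lambda>k. u x * gauss (\<delta> k) x)"
    proof (rule AE_I2, rule monoI)
      fix x :: 'a and m n :: nat assume "m \<le> n"
      then have "\<delta> n \<le> \<delta> m" by (simp add: \<delta>_def field_simps)
      then show "u x * gauss (\<delta> m) x \<le> u x * gauss (\<delta> n) x"
        using nonneg by (intro mult_left_mono) (auto simp: mult_right_mono)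
    qed
    show "AE x in lborel. (\<lambda>k. u x * gauss (\<delta> k) x) \<longlonglongrightarrow> u x" using lim by simp
    show "(\<lambda>k. LINT x|lborel. u x * gauss (\<delta> k) x) \<longlonglongrightarrow> (2 * pi) ^ DIM('a) * g 0"
      using R[of 0] A0 by (simp add: has_bochner_integral_iff)
  qed measurable
  have "(\<lambda>k. LINT x|lborel. (u x * gauss (\<delta> k) x) *\<^sub>R cis (- (x \<bullet> \<eta>))) \<longlonglongrightarrow> (LINT x|lborel. u x *\<^sub>R cis (- (x \<bullet> \<eta>)))"
  proof (rule integral_dominated_convergence)
    show "AE x in lborel. (\<lambda>k. (u x * gauss (\<delta> k) x) *\<^sub>R cis (- (x \<bullet> \<eta>))) \<longlonglongrightarrow> u x *\<^sub>R cis (- (x \<bullet> \<eta>))"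
      by (intro AE_I2 tendsto_intros lim)
    show "AE x in lborel. norm ((u x * gauss (\<delta> k) x) *\<^sub>R cis (- (x \<bullet> \<eta>))) \<le> u x" for k
      using nonneg \<delta>[of k] by (intro AE_I2) (auto simp: abs_mult mult_left_le)
  qed (use uint in measurable)
  moreover have "(LINT x|lborel. (u x * gauss (\<delta> k) x) *\<^sub>R cis (- (x \<bullet> \<eta>)))
     = of_real (?K (\<delta> k) \<eta>)" for k
    using A[OF \<delta>[of k], of \<eta>] by (simp only: has_bochner_integral_iff)
  moreover have "(\<lambda>k. complex_of_real (?K (\<delta> k) \<eta>)) \<longlonglongrightarrow> of_real ((2 * pi) ^ DIM('a) * g \<eta>)"
    by (intro tendsto_of_real R)
  ultimately show "(LINT x|lborel. u x *\<^sub>R cis (- (x \<bullet> \<eta>))) = of_real ((2 * pi) ^ DIM('a) * g \<eta>)"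
    by (metis (no_types, lifting) LIMSEQ_unique ext)
qed

section \<open>Smoothness of superpositions of relaxing plane waves\<close>

text \<open>Differentiation under the integral from a pointwise derivative at \<open>p0\<close> and an integrable Lipschitz
constant: the difference quotients are dominated by \<open>2 B\<close>.\<close>

lemma has_derivative_integral:
  fixes h :: "'p::real_normed_vector \<Rightarrow> 'x \<Rightarrow> real" and D :: "'x \<Rightarrow> 'p \<Rightarrow> real"
  assumes r: "0 < r"
    and int: "\<And>p. p \<in> ball p0 r \<Longrightarrow> integrable M (h p)"
    and der: "\<And>x. ((\<lambda>p. h p x) has_derivative D x) (at p0)"
    and lip: "\<And>p x. p \<in> ball p0 r \<Longrightarrow> \<bar>h p x - h p0 x\<bar> \<le> B x * norm (p - p0)"
    and B: "integrable M B"
    and Dm: "\<And>v. (\<lambda>x. D x v) \<in> borel_measurable M"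
    and Db: "\<And>x v. \<bar>D x v\<bar> \<le> B x * norm v"
  shows "((\<lambda>p. LINT x|M. h p x) has_derivative (\<lambda>v. LINT x|M. D x v)) (at p0)"
  unfolding has_derivative_at
proof
  have Dint: "integrable M (\<lambda>x. D x v)" for v
  proof (rule Bochner_Integration.integrable_bound)
    show "integrable M (\<lambda>x. B x * norm v)" using B by simp
    show "AE x in M. norm (D x v) \<le> norm (B x * norm v)"
      using Db by (intro AE_I2) (metis abs_ge_self order_trans real_norm_def)
  qed (rule Dm)
  have lin: "linear (D x)" for x using der[of x] by (rule has_derivative_linear)
  show "bounded_linear (\<lambda>v. LINT x|M. D x v)"
  proof (rule bounded_linear_intro[where K = "LINT x|M. B x"])
    show "(LINT x|M. D x (u + v)) = (LINT x|M. D x u) + (LINT x|M. D x v)" for u v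
      by (simp add: linear_add[OF lin] Dint)
    show "(LINT x|M. D x (c *\<^sub>R v)) = c *\<^sub>R (LINT x|M. D x v)" for c v
      by (simp add: linear_scale[OF lin])
    show "norm (LINT x|M. D x v) \<le> norm v * (LINT x|M. B x)" for v
    proof -
      have "norm (LINT x|M. D x v) \<le> (LINT x|M. norm (D x v))" by (rule integral_norm_bound)
      also have "\<dots> \<le> (LINT x|M. B x * norm v)"
        using Db B Dint by (intro integral_mono) auto
      also have "\<dots> = norm v * (LINT x|M. B x)" by (simp add: mult.commute)
      finally show ?thesis .
    qed
  qed
  show "(\<lambda>k. norm ((LINT x|M. h (p0 + k) x) - (LINT x|M. h p0 x) - (LINT x|M. D x k)) / norm k) \<midarrow>0\<rightarrow> 0"
    unfolding tendsto_at_iff_sequentially comp_def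
  proof (intro allI impI)
    fix X :: "nat \<Rightarrow> 'p" assume X: "\<forall>i. X i \<in> UNIV - {0}" "X \<longlonglongrightarrow> 0"
    from X(2) r obtain N where N: "\<And>n. n \<ge> N \<Longrightarrow> norm (X n) < r"
      unfolding LIMSEQ_iff by (metis diff_zero)
    define Y where "Y n = X (n + N)" for n
    have Y0: "Y n \<noteq> 0" and Yr: "p0 + Y n \<in> ball p0 r" for n
      using X(1) N[of "n + N"] by (auto simp: Y_def dist_norm)
    have Y: "Y \<longlonglongrightarrow> 0" unfolding Y_def using X(2) by (rule LIMSEQ_ignore_initial_segment)
    define q where "q n x = (h (p0 + Y n) x - h p0 x - D x (Y n)) / norm (Y n)" for n x
    have p0: "p0 \<in> ball p0 r" using r by simp
    have qint: "integrable M (q n)" for n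
      unfolding q_def using int[OF Yr[of n]] int[OF p0] Dint by simp
    have "(\<lambda>n. LINT x|M. q n x) \<longlonglongrightarrow> (LINT x|M. 0)"
    proof (rule integral_dominated_convergence)
      show "integrable M (\<lambda>x. 2 * B x)" using B by simp
      show "AE x in M. (\<lambda>n. q n x) \<longlonglongrightarrow> 0"
      proof (rule AE_I2)
        fix x
        have "(\<lambda>k. norm (h (p0 + k) x - h p0 x - D x k) / norm k) \<midarrow>0\<rightarrow> 0"
          using der[of x] by (simp add: has_derivative_at)
        then have "(\<lambda>n. norm (h (p0 + Y n) x - h p0 x - D x (Y n)) / norm (Y n)) \<longlonglongrightarrow> 0"
          unfolding tendsto_at_iff_sequentially comp_def using Y Y0 by auto
        then have "(\<lambda>n. norm (q n x)) \<longlonglongrightarrow> 0" by (simp add: q_def)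
        then show "(\<lambda>n. q n x) \<longlonglongrightarrow> 0" by (rule tendsto_norm_zero_cancel)
      qed
      show "AE x in M. norm (q n x) \<le> 2 * B x" for n
      proof (rule AE_I2)
        fix x
        have "\<bar>h (p0 + Y n) x - h p0 x - D x (Y n)\<bar> \<le> 2 * B x * norm (Y n)"
          using lip[OF Yr[of n], of x] Db[of x "Y n"] by simp
        then show "norm (q n x) \<le> 2 * B x"
          using Y0[of n] by (simp add: q_def divide_le_eq)
      qed
    qed (use qint in \<open>auto dest: borel_measurable_integrable\<close>)
    then have "(\<lambda>n. norm (LINT x|M. q n x)) \<longlonglongrightarrow> 0" by (simp add: tendsto_rabs_zero)
    moreover have "(LINT x|M. q n x) = ((LINT x|M. h (p0 + Y n) x) - (LINT x|M. h p0 x) - (LINT x|M. D x (Y n))) / norm (Y n)" for n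
      unfolding q_def using int[OF Yr[of n]] int[OF p0] Dint by simp
    ultimately have "(\<lambda>n. norm ((LINT x|M. h (p0 + Y n) x) - (LINT x|M. h p0 x) - (LINT x|M. D x (Y n))) / norm (Y n)) \<longlonglongrightarrow> 0"
      by simp
    then show "(\<lambda>n. norm ((LINT x|M. h (p0 + X n) x) - (LINT x|M. h p0 x) - (LINT x|M. D x (X n))) / norm (X n)) \<longlonglongrightarrow> 0"
      unfolding Y_def by (rule LIMSEQ_offset)
  qed
qed

text \<open>The time profile of the frequency with symbol value \<open>\<kappa> = |\<xi>|\<^sup>\<beta>\<close>, extended to complex time so that its
derivatives can be estimated by Cauchy's inequality.\<close>

definition relaxation :: "real \<Rightarrow> real \<Rightarrow> complex \<Rightarrow> complex" where
  "relaxation \<alpha> \<kappa> z = mittag_leffler \<alpha> (- (of_real \<kappa> * z powr of_real \<alpha>))"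

definition relaxation_deriv :: "real \<Rightarrow> nat \<Rightarrow> real \<Rightarrow> real \<Rightarrow> real" where
  "relaxation_deriv \<alpha> j \<kappa> t = Re ((deriv ^^ j) (relaxation \<alpha> \<kappa>) (of_real t))"

lemma relaxation_holomorphic:
  assumes "0 < \<alpha>"
  shows "relaxation \<alpha> \<kappa> holomorphic_on {z. 0 < Re z}"
proof -
  have "(mittag_leffler \<alpha> \<circ> (\<lambda>z. - (of_real \<kappa> * z powr of_real \<alpha>))) holomorphic_on {z. 0 < Re z}"
    by (rule holomorphic_on_compose[OF _ mittag_leffler_holomorphic[OF assms]])
      (auto intro!: holomorphic_intros simp: complex_nonpos_Reals_iff)
  then show ?thesis by (simp add: comp_def relaxation_def[abs_def])
qed

lemma relaxation_deriv_0:
  assumes "0 < \<alpha>" "0 \<le> t"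
  shows "relaxation_deriv \<alpha> 0 \<kappa> t = mittag_leffler \<alpha> (- (\<kappa> * t powr \<alpha>))"
  using mittag_leffler_of_real[OF assms(1), of "- (\<kappa> * t powr \<alpha>)"] assms
  by (simp add: relaxation_deriv_def relaxation_def powr_of_real)

text \<open>The profile is bounded by one on the disc of radius \<open>t / 2\<close> around \<open>t\<close>, being a Laplace transform of a
measure of mass at most one. The bound does not depend on \<open>\<kappa>\<close>, so time derivatives cost no
decay in frequency.\<close>

lemma relaxation_deriv_bound:
  assumes \<alpha>: "0 < \<alpha>" "\<alpha> < 1" and \<kappa>: "0 \<le> \<kappa>" and t: "0 < s" "s \<le> t"
  shows "\<bar>relaxation_deriv \<alpha> j \<kappa> t\<bar> \<le> fact j / (s / 2) ^ j"
proof -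
  have sub: "cball (complex_of_real t) (t / 2) \<subseteq> {z. 0 < Re z}"
  proof
    fix z assume "z \<in> cball (complex_of_real t) (t / 2)"
    then have "norm (of_real t - z) \<le> t / 2" by (simp add: dist_norm)
    then have "\<bar>t - Re z\<bar> \<le> t / 2" using abs_Re_le_cmod[of "of_real t - z"] by simp
    then have "t / 2 \<le> Re z" by linarith
    then show "z \<in> {z. 0 < Re z}" using t by simp
  qed
  have hol: "relaxation \<alpha> \<kappa> holomorphic_on cball (of_real t) (t / 2)"
    by (rule holomorphic_on_subset[OF relaxation_holomorphic[OF \<alpha>(1)] sub])
  have cone: "relaxation \<alpha> \<kappa> \<in> laplace_cone"
    unfolding relaxation_def[abs_def] by (rule laplace_cone_mittag_leffler) (use \<alpha> \<kappa> in auto)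
  have "norm ((deriv ^^ j) (relaxation \<alpha> \<kappa>) (of_real t)) \<le> fact j * 1 / (t / 2) ^ j"
  proof (rule Cauchy_inequality)
    show "relaxation \<alpha> \<kappa> holomorphic_on ball (of_real t) (t / 2)"
      by (rule holomorphic_on_subset[OF hol ball_subset_cball])
    show "continuous_on (cball (of_real t) (t / 2)) (relaxation \<alpha> \<kappa>)"
      by (rule holomorphic_on_imp_continuous_on[OF hol])
    show "norm (relaxation \<alpha> \<kappa> x) \<le> 1" if "norm (of_real t - x) = t / 2" for x
      using subsetD[OF sub, of x] that by (intro laplace_cone_norm_le[OF cone]) (simp add: dist_norm)
  qed (use t in simp)
  also have "\<dots> \<le> fact j / (s / 2) ^ j"
    using t by (auto intro!: divide_left_mono power_mono mult_pos_pos)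
  finally show ?thesis
    unfolding relaxation_deriv_def using abs_Re_le_cmod order_trans by blast
qed

lemma relaxation_deriv_has_derivative:
  assumes \<alpha>: "0 < \<alpha>" and t: "0 < t"
  shows "(relaxation_deriv \<alpha> j \<kappa> has_real_derivative relaxation_deriv \<alpha> (Suc j) \<kappa> t) (at t)"
proof -
  have op: "open {z. 0 < Re z}" by (rule open_halfspace_Re_gt)
  have "(deriv ^^ j) (relaxation \<alpha> \<kappa>) holomorphic_on {z. 0 < Re z}"
    by (rule holomorphic_higher_deriv[OF relaxation_holomorphic[OF \<alpha>] op])
  then have "((deriv ^^ j) (relaxation \<alpha> \<kappa>) has_field_derivative deriv ((deriv ^^ j) (relaxation \<alpha> \<kappa>)) (of_real t)) (at (of_real t))"
    using op t by (intro holomorphic_derivI) auto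
  from has_vector_derivative_real_field[OF this]
  have "((\<lambda>x. (deriv ^^ j) (relaxation \<alpha> \<kappa>) (of_real x)) has_vector_derivative (deriv ^^ Suc j) (relaxation \<alpha> \<kappa>) (of_real t)) (at t)"
    by simp
  from bounded_linear.has_vector_derivative[OF bounded_linear_Re this]
  show ?thesis
    by (simp add: has_real_derivative_iff_has_vector_derivative relaxation_deriv_def[abs_def])
qed

text \<open>The \<open>j\<close>-th derivative is measurable in the parameter as a limit of difference quotients of the
preceding one.\<close>

lemma relaxation_deriv_measurable:
  assumes \<alpha>: "0 < \<alpha>" and [measurable]: "\<kappa> \<in> borel_measurable M" and t: "0 < t"
  shows "(\<lambda>x. relaxation_deriv \<alpha> j (\<kappa> x) t) \<in> borel_measurable M"
  using t
proof (induction j arbitrary: t)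
  case 0
  have [measurable]: "(mittag_leffler \<alpha> :: real \<Rightarrow> real) \<in> borel_measurable borel"
    by (rule borel_measurable_continuous_onI[OF mittag_leffler_continuous[OF \<alpha>]])
  show ?case using 0 \<alpha> by (simp add: relaxation_deriv_0)
next
  case (Suc j)
  define s where "s n = inverse (real (Suc n))" for n
  have s: "s n > 0" for n by (simp add: s_def)
  show ?case
  proof (rule borel_measurable_LIMSEQ_real)
    show "(\<lambda>x. (relaxation_deriv \<alpha> j (\<kappa> x) (t + s n) - relaxation_deriv \<alpha> j (\<kappa> x) t) / s n) \<in> borel_measurable M" for n
      using Suc.prems s[of n] by (intro borel_measurable_divide borel_measurable_diff Suc.IH) auto
    fix x
    have "((\<lambda>h. (relaxation_deriv \<alpha> j (\<kappa> x) (t + h) - relaxation_deriv \<alpha> j (\<kappa> x) t) / h) \<longlongrightarrow> relaxation_deriv \<alpha> (Suc j) (\<kappa> x) t) (at 0)"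
      using relaxation_deriv_has_derivative[OF \<alpha> Suc.prems, of j "\<kappa> x"] by (simp add: DERIV_def)
    moreover have "s \<longlonglongrightarrow> 0" unfolding s_def by (rule LIMSEQ_inverse_real_of_nat)
    ultimately show "(\<lambda>n. (relaxation_deriv \<alpha> j (\<kappa> x) (t + s n) - relaxation_deriv \<alpha> j (\<kappa> x) t) / s n) \<longlonglongrightarrow> relaxation_deriv \<alpha> (Suc j) (\<kappa> x) t"
      unfolding tendsto_at_iff_sequentially comp_def using s by (auto simp: less_imp_neq[symmetric])
  qed
qed

lemma C_k_cong:
  fixes f g :: "'a::euclidean_space \<Rightarrow> real"
  assumes "open S" "\<And>x. x \<in> S \<Longrightarrow> f x = g x" "C_k k S f"
  shows "C_k k S g"
  using assms(2,3)
proof (induction k arbitrary: f g)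
  case 0
  then show ?case by (auto cong: continuous_on_cong)
next
  case (Suc k)
  have d: "(g has_derivative frechet_derivative f (at x)) (at x)" if "x \<in> S" for x
  proof (rule has_derivative_transform_within_open)
    show "(f has_derivative frechet_derivative f (at x)) (at x)"
      using Suc.prems that by (simp add: frechet_derivative_works)
  qed (use assms(1) that Suc.prems in auto)
  have fd: "frechet_derivative f (at x) = frechet_derivative g (at x)" if "x \<in> S" for x
    by (rule frechet_derivative_at[OF d[OF that]])
  have "C_k k S (\<lambda>x. frechet_derivative g (at x) b)" if "b \<in> Basis" for b
  proof (rule Suc.IH)
    show "C_k k S (\<lambda>x. frechet_derivative f (at x) b)" using Suc.prems(2) that by simp
  qed (simp add: fd)
  moreover have "g differentiable (at x)" if "x \<in> S" for x
    using d[OF that] differentiable_def by blast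
  ultimately show ?case by simp
qed

text \<open>The integrands that arise from differentiating the solution repeatedly: a time derivative raises
\<open>j\<close>, a derivative in direction \<open>b\<close> adds the factor \<open>\<xi> \<bullet> b\<close> and shifts the phase by \<open>\<pi> / 2\<close>. The family is
closed under differentiation, so smoothness follows by induction on the order.\<close>

definition relaxation_wave ::
    "real \<Rightarrow> real \<Rightarrow> real \<Rightarrow> 'a list \<Rightarrow> nat \<Rightarrow> real \<Rightarrow> real \<times> 'a::euclidean_space \<Rightarrow> 'a \<Rightarrow> real" where
  "relaxation_wave \<alpha> \<beta> \<epsilon> bs j \<phi> p \<xi> =
     prod_list (map (\<lambda>b. \<xi> \<bullet> b) bs) * gauss \<epsilon> \<xi> *
     (cos (snd p \<bullet> \<xi> + \<phi>) * relaxation_deriv \<alpha> j (norm \<xi> powr \<beta>) (fst p))"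

lemma prod_list_inner_le:
  fixes \<xi> :: "'a::euclidean_space"
  assumes "set bs \<subseteq> Basis"
  shows "\<bar>prod_list (map (\<lambda>b. \<xi> \<bullet> b) bs)\<bar> \<le> (1 + norm \<xi>) ^ length bs"
  using assms
proof (induction bs)
  case (Cons b bs)
  have "\<bar>\<xi> \<bullet> b\<bar> \<le> 1 + norm \<xi>" using Basis_le_norm[of b \<xi>] Cons.prems by simp
  then show ?case using Cons by (auto simp: abs_mult intro!: mult_mono)
qed simp

lemma relaxation_wave_has_derivative:
  fixes bs :: "'a::euclidean_space list"
  assumes \<alpha>: "0 < \<alpha>" "\<alpha> < 1" and \<epsilon>: "0 < \<epsilon>" and bs: "set bs \<subseteq> Basis" and t: "0 < t"
  shows "((\<lambda>p. LINT \<xi>|lborel. relaxation_wave \<alpha> \<beta> \<epsilon> bs j \<phi> p \<xi>) has_derivative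
     (\<lambda>v. LINT \<xi>|lborel. fst v * relaxation_wave \<alpha> \<beta> \<epsilon> bs (Suc j) \<phi> (t, x) \<xi>
                    + (snd v \<bullet> \<xi>) * relaxation_wave \<alpha> \<beta> \<epsilon> bs j (\<phi> + pi/2) (t, x) \<xi>)) (at (t, x))"
proof -
  let ?W = "relaxation_wave \<alpha> \<beta> \<epsilon> bs"
  define m where "m \<xi> = prod_list (map (\<lambda>b. \<xi> \<bullet> b) bs) * gauss \<epsilon> \<xi>" for \<xi> :: 'a
  define \<kappa> where "\<kappa> \<xi> = norm \<xi> powr \<beta>" for \<xi> :: 'a
  define Q where "Q i = fact i / (t / 2 / 2) ^ i" for i
  have Q0: "0 \<le> Q i" for i using t by (simp add: Q_def)
  define B where "B \<xi> = (Q j + Q (Suc j)) * ((1 + norm \<xi>) ^ Suc (length bs) * gauss \<epsilon> \<xi>)" for \<xi> :: 'a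
  define D where "D p \<xi> v = fst v * ?W (Suc j) \<phi> p \<xi>
                    + (snd v \<bullet> \<xi>) * ?W j (\<phi> + pi/2) p \<xi>" for p :: "real \<times> 'a" and \<xi> and v :: "real \<times> 'a"
  have pm [measurable]: "(\<lambda>\<xi>::'a. prod_list (map (\<lambda>b. \<xi> \<bullet> b) bs)) \<in> borel_measurable borel"
    by (induction bs) (auto intro!: borel_measurable_times)
  have [measurable]: "(\<lambda>\<xi>. relaxation_deriv \<alpha> i (norm (\<xi>::'a) powr \<beta>) s) \<in> borel_measurable borel" if "0 < s" for i s
    by (rule relaxation_deriv_measurable[OF \<alpha>(1) _ that]) measurable
  have wm [measurable]: "?W i \<psi> p \<in> borel_measurable borel" if "0 < fst p" for i \<psi> and p :: "real \<times> 'a"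
    unfolding relaxation_wave_def[abs_def] using that by measurable
  have wb: "\<bar>?W i \<psi> p \<xi>\<bar> \<le> Q i * ((1 + norm \<xi>) ^ length bs * gauss \<epsilon> \<xi>)"
    if "t / 2 \<le> fst p" for i \<psi> p \<xi>
  proof -
    have "\<bar>?W i \<psi> p \<xi>\<bar> \<le> ((1 + norm \<xi>) ^ length bs * gauss \<epsilon> \<xi>) * (1 * Q i)"
      unfolding relaxation_wave_def abs_mult Q_def using prod_list_inner_le[OF bs, of \<xi>] that t \<alpha>
      by (intro mult_mono relaxation_deriv_bound) auto
    then show ?thesis by (simp add: mult_ac)
  qed
  have Db: "\<bar>D p \<xi> v\<bar> \<le> B \<xi> * norm v" if p: "t / 2 \<le> fst p" for p \<xi> v
  proof -
    define G where "G = (1 + norm \<xi>) ^ length bs * gauss \<epsilon> \<xi>"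
    have G0: "0 \<le> G" by (simp add: G_def)
    have "\<bar>D p \<xi> v\<bar> \<le> \<bar>fst v\<bar> * \<bar>?W (Suc j) \<phi> p \<xi>\<bar> + \<bar>snd v \<bullet> \<xi>\<bar> * \<bar>?W j (\<phi> + pi/2) p \<xi>\<bar>"
      unfolding D_def abs_mult[symmetric] by (rule abs_triangle_ineq)
    also have "\<dots> \<le> (norm v * (1 + norm \<xi>)) * (Q (Suc j) * G) + (norm v * (1 + norm \<xi>)) * (Q j * G)"
    proof (intro add_mono mult_mono)
      have "\<bar>fst v\<bar> \<le> norm v" using norm_fst_le[of "fst v" "snd v"] by simp
      also have "\<dots> \<le> norm v * (1 + norm \<xi>)" by (simp add: mult_le_cancel_left1)
      finally show "\<bar>fst v\<bar> \<le> norm v * (1 + norm \<xi>)" .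
      have "\<bar>snd v \<bullet> \<xi>\<bar> \<le> norm (snd v) * norm \<xi>" by (rule Cauchy_Schwarz_ineq2)
      also have "\<dots> \<le> norm v * (1 + norm \<xi>)" using norm_snd_le[of "snd v" "fst v"] by (intro mult_mono) auto
      finally show "\<bar>snd v \<bullet> \<xi>\<bar> \<le> norm v * (1 + norm \<xi>)" .
    qed (use wb[OF p] Q0 G0 in \<open>auto simp: G_def\<close>)
    also have "\<dots> = B \<xi> * norm v" by (simp add: B_def G_def algebra_simps)
    finally show ?thesis .
  qed
  have der: "((\<lambda>p. ?W j \<phi> p \<xi>) has_derivative D p \<xi>) (at p)" if p: "0 < fst p" for p \<xi>
  proof -
    have 1: "((\<lambda>p. relaxation_deriv \<alpha> j (\<kappa> \<xi>) (fst p)) has_derivative (\<lambda>v. relaxation_deriv \<alpha> (Suc j) (\<kappa> \<xi>) (fst p) * fst v)) (at p)"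
      using has_derivative_compose[OF has_derivative_fst[OF has_derivative_ident] relaxation_deriv_has_derivative[OF \<alpha>(1) p, unfolded has_field_derivative_def]]
      by simp
    have 2: "((\<lambda>p. cos (snd p \<bullet> \<xi> + \<phi>)) has_derivative (\<lambda>v. - sin (snd p \<bullet> \<xi> + \<phi>) * (snd v \<bullet> \<xi>))) (at p)"
      by (auto intro!: derivative_eq_intros)
    have "((\<lambda>p. m \<xi> * (cos (snd p \<bullet> \<xi> + \<phi>) * relaxation_deriv \<alpha> j (\<kappa> \<xi>) (fst p))) has_derivative
       (\<lambda>v. m \<xi> * (cos (snd p \<bullet> \<xi> + \<phi>) * (relaxation_deriv \<alpha> (Suc j) (\<kappa> \<xi>) (fst p) * fst v)
           + (- sin (snd p \<bullet> \<xi> + \<phi>) * (snd v \<bullet> \<xi>)) * relaxation_deriv \<alpha> j (\<kappa> \<xi>) (fst p)))) (at p)"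
      by (intro has_derivative_mult_right has_derivative_mult 1 2)
    moreover have "cos (snd p \<bullet> \<xi> + (\<phi> + pi/2)) = - sin (snd p \<bullet> \<xi> + \<phi>)"
      by (simp add: add.assoc[symmetric] cos_add)
    then have "(\<lambda>v. m \<xi> * (cos (snd p \<bullet> \<xi> + \<phi>) * (relaxation_deriv \<alpha> (Suc j) (\<kappa> \<xi>) (fst p) * fst v)
           + (- sin (snd p \<bullet> \<xi> + \<phi>) * (snd v \<bullet> \<xi>)) * relaxation_deriv \<alpha> j (\<kappa> \<xi>) (fst p))) = D p \<xi>"
      unfolding D_def relaxation_wave_def m_def \<kappa>_def by (simp only: fun_eq_iff) (simp add: algebra_simps)
    ultimately show ?thesis by (simp add: relaxation_wave_def[abs_def] m_def \<kappa>_def)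
  qed
  have tp: "t / 2 < fst p" if "p \<in> ball (t, x) (t / 2)" for p
  proof -
    have "\<bar>t - fst p\<bar> \<le> norm ((t, x) - p)" using norm_fst_le[of "t - fst p" "x - snd p"] by (simp add: minus_prod_def)
    then show ?thesis using that by (auto simp: dist_norm abs_le_iff)
  qed
  have "((\<lambda>p. LINT \<xi>|lborel. ?W j \<phi> p \<xi>) has_derivative (\<lambda>v. LINT \<xi>|lborel. D (t, x) \<xi> v)) (at (t, x))"
  proof (rule has_derivative_integral[where r = "t / 2" and B = B])
    show "integrable lborel B"
      unfolding B_def by (intro integrable_mult_right polynomial_gaussian_integrable \<epsilon>)
    show "integrable lborel (?W j \<phi> p)" if "p \<in> ball (t, x) (t / 2)" for p
    proof (rule Bochner_Integration.integrable_bound)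
      show "integrable lborel (\<lambda>\<xi>::'a. Q j * ((1 + norm \<xi>) ^ length bs * gauss \<epsilon> \<xi>))"
        by (intro integrable_mult_right polynomial_gaussian_integrable \<epsilon>)
      show "AE \<xi> in lborel. norm (?W j \<phi> p \<xi>) \<le> norm (Q j * ((1 + norm \<xi>) ^ length bs * gauss \<epsilon> \<xi>))"
        using order_trans[OF wb abs_ge_self] tp[OF that] by (intro AE_I2) auto
    qed (use wm tp[OF that] t in auto)
    show "\<bar>?W j \<phi> p \<xi> - ?W j \<phi> (t, x) \<xi>\<bar> \<le> B \<xi> * norm (p - (t, x))"
      if p: "p \<in> ball (t, x) (t / 2)" for p \<xi>
    proof -
      have "norm (?W j \<phi> p \<xi> - ?W j \<phi> (t, x) \<xi>) \<le> B \<xi> * norm (p - (t, x))"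
      proof (rule differentiable_bound[where f' = "\<lambda>p. D p \<xi>"])
        show "convex (ball (t, x) (t / 2))" by (rule convex_ball)
        show "((\<lambda>p. ?W j \<phi> p \<xi>) has_derivative D q \<xi>) (at q within ball (t, x) (t / 2))"
          if "q \<in> ball (t, x) (t / 2)" for q
          by (rule has_derivative_at_withinI[OF der]) (use tp[OF that] t in linarith)
        show "onorm (D q \<xi>) \<le> B \<xi>" if "q \<in> ball (t, x) (t / 2)" for q
        proof (rule onorm_le)
          fix v show "norm (D q \<xi> v) \<le> B \<xi> * norm v" using Db[of q \<xi> v] tp[OF that] by simp
        qed
        show "(t, x) \<in> ball (t, x) (t / 2)" using t by simp
      qed (rule p)
      then show ?thesis by simp
    qed
    show "(\<lambda>\<xi>. D (t, x) \<xi> v) \<in> borel_measurable lborel" for v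
    proof -
      have [measurable]: "?W i \<psi> (t, x) \<in> borel_measurable borel" for i \<psi>
        by (rule wm) (use t in simp)
      show ?thesis unfolding D_def by measurable
    qed
    show "((\<lambda>p. ?W j \<phi> p \<xi>) has_derivative D (t, x) \<xi>) (at (t, x))" for \<xi>
      using der[of "(t, x)" \<xi>] t by simp
    show "\<bar>D (t, x) \<xi> v\<bar> \<le> B \<xi> * norm v" for \<xi> v using Db[of "(t, x)"] t by simp
  qed (use t in simp)
  then show ?thesis unfolding D_def .
qed

lemma relaxation_wave_smooth:
  fixes bs :: "'a::euclidean_space list"
  assumes \<alpha>: "0 < \<alpha>" "\<alpha> < 1" and \<epsilon>: "0 < \<epsilon>" and bs: "set bs \<subseteq> Basis"
  shows "C_k k ({0<..} \<times> UNIV) (\<lambda>p. LINT \<xi>|lborel. relaxation_wave \<alpha> \<beta> \<epsilon> bs j \<phi> p \<xi>)"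
  using bs
proof (induction k arbitrary: bs j \<phi>)
  case 0
  show ?case unfolding C_k.simps
  proof (rule continuous_at_imp_continuous_on, rule ballI)
    fix p :: "real \<times> 'a" assume "p \<in> {0<..} \<times> UNIV"
    then show "isCont (\<lambda>p. LINT \<xi>|lborel. relaxation_wave \<alpha> \<beta> \<epsilon> bs j \<phi> p \<xi>) p"
      using has_derivative_continuous[OF relaxation_wave_has_derivative[OF \<alpha> \<epsilon> 0, of "fst p" \<beta> j \<phi> "snd p"]] by auto
  qed
next
  case (Suc k)
  let ?F = "\<lambda>bs j \<phi> p. LINT \<xi>|lborel. relaxation_wave \<alpha> \<beta> \<epsilon> bs j \<phi> p \<xi>"
  have op: "open ({0::real<..} \<times> (UNIV :: 'a set))" by (intro open_Times open_UNIV open_greaterThan)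
  have der: "(?F bs j \<phi> has_derivative
     (\<lambda>v. LINT \<xi>|lborel. fst v * relaxation_wave \<alpha> \<beta> \<epsilon> bs (Suc j) \<phi> p \<xi>
                    + (snd v \<bullet> \<xi>) * relaxation_wave \<alpha> \<beta> \<epsilon> bs j (\<phi> + pi/2) p \<xi>)) (at p)"
    if "p \<in> {0<..} \<times> UNIV" for p
    using relaxation_wave_has_derivative[OF \<alpha> \<epsilon> Suc.prems, of "fst p" \<beta> j \<phi> "snd p"] that by auto
  show ?case unfolding C_k.simps
  proof (intro conjI ballI)
    fix p :: "real \<times> 'a" assume "p \<in> {0<..} \<times> UNIV"
    then show "?F bs j \<phi> differentiable at p" by (rule differentiableI[OF der])
  next
    fix b :: "real \<times> 'a" assume b: "b \<in> Basis"
    have fd: "frechet_derivative (?F bs j \<phi>) (at p) b = (LINT \<xi>|lborel. fst b * relaxation_wave \<alpha> \<beta> \<epsilon> bs (Suc j) \<phi> p \<xi>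
                    + (snd b \<bullet> \<xi>) * relaxation_wave \<alpha> \<beta> \<epsilon> bs j (\<phi> + pi/2) p \<xi>)"
      if "p \<in> {0<..} \<times> UNIV" for p
      by (subst frechet_derivative_at[OF der[OF that], symmetric]) (rule refl)
    from b consider "b = (1, 0)" | c where "b = (0, c)" "c \<in> Basis"
      by (auto simp: Basis_prod_def)
    then show "C_k k ({0<..} \<times> UNIV) (\<lambda>p. frechet_derivative (?F bs j \<phi>) (at p) b)"
    proof cases
      case 1
      show ?thesis
        by (rule C_k_cong[OF op _ Suc.IH[OF Suc.prems, of "Suc j" \<phi>]]) (subst fd, assumption, simp add: 1)
    next
      case 2
      have w: "(c \<bullet> \<xi>) * relaxation_wave \<alpha> \<beta> \<epsilon> bs j \<psi> p \<xi> = relaxation_wave \<alpha> \<beta> \<epsilon> (c # bs) j \<psi> p \<xi>" for \<psi> p \<xi>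
        by (simp add: relaxation_wave_def inner_commute)
      show ?thesis
      proof (rule C_k_cong[OF op])
        show "C_k k ({0<..} \<times> UNIV) (?F (c # bs) j (\<phi> + pi/2))"
          by (rule Suc.IH) (use Suc.prems 2 in simp)
      qed (subst fd, assumption, simp add: 2 w)
    qed
  qed
qed

section \<open>Solutions with Gaussian initial data\<close>

text \<open>If \<open>f z = exp (- r z)\<close>, then \<open>f(|\<xi>|\<^sup>2) exp (- \<epsilon> |\<xi>|\<^sup>2)\<close> is a Gaussian, and its transform at \<open>x\<close> exceeds
that of \<open>exp (- \<epsilon> |\<xi>|\<^sup>2)\<close> up to the factor
\<open>(1 + r / \<epsilon>)\<^sup>-\<^sup>d\<^sup>/\<^sup>2 \<ge> exp (- r d / (2 \<epsilon>))\<close>. The last expression is the value of \<open>f\<close> at \<open>d / (2 \<epsilon>)\<close>, so both sides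
are linear in \<open>f\<close> and the inequality passes to mixtures and limits. It shows that the transform is
strictly positive whenever \<open>f\<close> does not vanish at \<open>d / (2 \<epsilon>)\<close>. The frequency \<open>\<xi> = 0\<close> is excluded
since \<open>f\<close> is only controlled on the open half-plane.\<close>

lemma laplace_cone_gaussian_lower_bound:
  fixes x :: "'a::euclidean_space"
  assumes "f \<in> laplace_cone" and \<epsilon>: "0 < \<epsilon>"
  shows "(\<lambda>\<xi>::'a. if \<xi> = 0 then 0 else Re (f (of_real ((norm \<xi>)\<^sup>2)))) \<in> borel_measurable borel" (is "?M f \<in> _")
    and "(pi / \<epsilon>) powr (DIM('a)/2) * exp (- ((norm x)\<^sup>2 / (4 * \<epsilon>))) * Re (f (of_real (DIM('a) / (2 * \<epsilon>))))
       \<le> (LINT \<xi>|lborel. cos (x \<bullet> \<xi>) * ((if \<xi> = 0 then 0 else Re (f (of_real ((norm \<xi>)\<^sup>2)))) * gauss \<epsilon> \<xi>))"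
      (is "?C * Re (f ?d) \<le> ?I f")
proof -
  have d: "0 < DIM('a) / (2 * \<epsilon>)" using \<epsilon> by simp
  have mb: "\<bar>?M f \<xi>\<bar> \<le> 1" if "f \<in> laplace_cone" for f and \<xi> :: 'a
    using order_trans[OF abs_Re_le_cmod laplace_cone_norm_le[OF that, of "of_real ((norm \<xi>)\<^sup>2)"]] by auto
  have wb: "norm (cos (x \<bullet> \<xi>) * (?M f \<xi> * gauss \<epsilon> \<xi>)) \<le> gauss \<epsilon> \<xi>" if "f \<in> laplace_cone" for f and \<xi> :: 'a
  proof -
    have "\<bar>cos (x \<bullet> \<xi>)\<bar> * (\<bar>?M f \<xi>\<bar> * gauss \<epsilon> \<xi>) \<le> 1 * (1 * gauss \<epsilon> \<xi>)"
      by (intro mult_mono mb that) auto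
    then show ?thesis unfolding real_norm_def abs_mult by simp
  qed
  have wint: "integrable lborel (\<lambda>\<xi>::'a. cos (x \<bullet> \<xi>) * (?M f \<xi> * gauss \<epsilon> \<xi>))"
    if f: "f \<in> laplace_cone" and [measurable]: "?M f \<in> borel_measurable borel" for f
  proof (rule Bochner_Integration.integrable_bound[OF gaussian_integrable[OF \<epsilon>]])
    show "AE \<xi> in lborel. norm (cos (x \<bullet> \<xi>) * (?M f \<xi> * gauss \<epsilon> \<xi>)) \<le> norm (gauss \<epsilon> \<xi>)"
      using order_trans[OF wb[OF f] abs_ge_self] by (intro AE_I2) simp
  qed measurable
  have "?M f \<in> borel_measurable borel \<and> ?C * Re (f ?d) \<le> ?I f"
    using assms(1)
  proof induction
    case (exp r)
    have "?I (\<lambda>z. exp (- (of_real r * z))) = (LINT \<xi>|lborel. cos (x \<bullet> \<xi>) * gauss (r + \<epsilon>) \<xi>)"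
    proof (rule integral_cong_AE)
      have "AE \<xi> in lborel. \<xi> \<noteq> (0::'a)" by (rule AE_lborel_singleton)
      then show "AE \<xi> in lborel. cos (x \<bullet> \<xi>) * ((if \<xi> = 0 then 0 else Re (exp (- (of_real r * of_real ((norm \<xi>)\<^sup>2))))) * gauss \<epsilon> \<xi>)
           = cos (x \<bullet> \<xi>) * gauss (r + \<epsilon>) \<xi>"
        by eventually_elim (simp add: Re_exp exp_add[symmetric] algebra_simps)
    qed measurable
    also have "\<dots> = (pi / (r + \<epsilon>)) powr (DIM('a)/2) * exp (- ((norm x)\<^sup>2 / (4 * (r + \<epsilon>))))"
      by (rule gaussian_cos_integral) (use exp \<epsilon> in simp)
    also have "\<dots> \<ge> ((pi / \<epsilon>) powr (DIM('a)/2) * exp (- (r * (DIM('a) / (2 * \<epsilon>))))) * exp (- ((norm x)\<^sup>2 / (4 * \<epsilon>)))"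
    proof (rule mult_mono)
      have "ln ((r + \<epsilon>) / \<epsilon>) \<le> r / \<epsilon>"
        using ln_le_minus_one[of "(r + \<epsilon>) / \<epsilon>"] exp \<epsilon> by (simp add: field_simps)
      then have "(DIM('a)/2) * ln ((r + \<epsilon>) / \<epsilon>) \<le> (DIM('a)/2) * (r / \<epsilon>)"
        by (rule mult_left_mono) simp
      moreover have "ln (\<epsilon> / (r + \<epsilon>)) = - ln ((r + \<epsilon>) / \<epsilon>)" using exp \<epsilon> by (simp add: ln_div)
      moreover have "r * (DIM('a) / (2 * \<epsilon>)) = (DIM('a)/2) * (r / \<epsilon>)" by simp
      ultimately have "exp (- (r * (DIM('a) / (2 * \<epsilon>)))) \<le> exp ((DIM('a)/2) * ln (\<epsilon> / (r + \<epsilon>)))"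
        by (simp only: exp_le_cancel_iff mult_minus_right neg_le_iff_le)
      also have "\<dots> = (\<epsilon> / (r + \<epsilon>)) powr (DIM('a)/2)" using exp \<epsilon> by (simp add: powr_def)
      finally have "(pi / \<epsilon>) powr (DIM('a)/2) * exp (- (r * (DIM('a) / (2 * \<epsilon>)))) \<le> (pi / \<epsilon>) powr (DIM('a)/2) * (\<epsilon> / (r + \<epsilon>)) powr (DIM('a)/2)"
        by (rule mult_left_mono) simp
      also have "\<dots> = (pi / (r + \<epsilon>)) powr (DIM('a)/2)"
        using exp \<epsilon> by (simp add: powr_mult[symmetric])
      finally show "(pi / \<epsilon>) powr (DIM('a)/2) * exp (- (r * (DIM('a) / (2 * \<epsilon>)))) \<le> (pi / (r + \<epsilon>)) powr (DIM('a)/2)" .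
      show "exp (- ((norm x)\<^sup>2 / (4 * \<epsilon>))) \<le> exp (- ((norm x)\<^sup>2 / (4 * (r + \<epsilon>))))"
        using exp \<epsilon> by (auto intro!: divide_left_mono)
    qed auto
    finally have "((pi / \<epsilon>) powr (DIM('a)/2) * exp (- (r * (DIM('a) / (2 * \<epsilon>))))) * exp (- ((norm x)\<^sup>2 / (4 * \<epsilon>))) \<le> ?I (\<lambda>z. exp (- (of_real r * z)))" .
    moreover have "?M (\<lambda>z. exp (- (of_real r * z))) \<in> borel_measurable borel" by measurable
    moreover have "Re (exp (- (of_real r * of_real (DIM('a) / (2 * \<epsilon>))))) = exp (- (r * (DIM('a) / (2 * \<epsilon>))))"
      by (simp only: of_real_mult[symmetric] of_real_minus[symmetric] exp_of_real Re_complex_of_real)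
    ultimately show ?case by (simp only: mult_ac simp_thms)
  next
    case (mix N f w)
    have eq: "?M (\<lambda>z. \<Sum>i<N. of_real (w i) * f i z) = (\<lambda>\<xi>. \<Sum>i<N. w i * ?M (f i) \<xi>)"
      by (auto simp: fun_eq_iff)
    have m: "?M (f i) \<in> borel_measurable borel" if "i < N" for i using mix.IH[OF that] by blast
    have "?M (\<lambda>z. \<Sum>i<N. of_real (w i) * f i z) \<in> borel_measurable borel"
      unfolding eq by (intro borel_measurable_sum borel_measurable_times measurable_const m) auto
    moreover have "?I (\<lambda>z. \<Sum>i<N. of_real (w i) * f i z) = (\<Sum>i<N. w i * ?I (f i))"
    proof -
      have "cos (x \<bullet> \<xi>) * (?M (\<lambda>z. \<Sum>i<N. of_real (w i) * f i z) \<xi> * gauss \<epsilon> \<xi>)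
         = (\<Sum>i<N. w i * (cos (x \<bullet> \<xi>) * (?M (f i) \<xi> * gauss \<epsilon> \<xi>)))" for \<xi>
        by (simp add: eq sum_distrib_left sum_distrib_right mult_ac)
      then have "?I (\<lambda>z. \<Sum>i<N. of_real (w i) * f i z) = (LINT \<xi>|lborel. (\<Sum>i<N. w i * (cos (x \<bullet> \<xi>) * (?M (f i) \<xi> * gauss \<epsilon> \<xi>))))"
        by simp
      also have "\<dots> = (\<Sum>i<N. LINT \<xi>|lborel. w i * (cos (x \<bullet> \<xi>) * (?M (f i) \<xi> * gauss \<epsilon> \<xi>)))"
        by (rule Bochner_Integration.integral_sum) (use wint m mix.hyps in auto)
      finally show ?thesis by (simp only: integral_mult_right_zero)
    qed
    moreover have "?C * Re (\<Sum>i<N. of_real (w i) * f i ?d) = (\<Sum>i<N. w i * (?C * Re (f i ?d)))"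
      by (simp add: sum_distrib_left mult_ac)
    moreover have "(\<Sum>i<N. w i * (?C * Re (f i ?d))) \<le> (\<Sum>i<N. w i * ?I (f i))"
      using mix by (intro sum_mono mult_left_mono) auto
    ultimately show ?case by (simp only: simp_thms)
  next
    case (lim f g)
    have l: "(\<lambda>n. ?M (f n) \<xi>) \<longlonglongrightarrow> ?M g \<xi>" for \<xi> :: 'a
      using tendsto_Re[OF lim.hyps(2)[of "of_real ((norm \<xi>)\<^sup>2)"]] by auto
    have m [measurable]: "?M (f n) \<in> borel_measurable borel" for n using lim.IH by blast
    have mg [measurable]: "?M g \<in> borel_measurable borel"
      by (rule borel_measurable_LIMSEQ_real[OF l m])
    have Ilim: "(\<lambda>n. ?I (f n)) \<longlonglongrightarrow> ?I g"
    proof (rule integral_dominated_convergence)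
      show "integrable lborel (\<lambda>\<xi>::'a. gauss \<epsilon> \<xi>)" by (rule gaussian_integrable[OF \<epsilon>])
      show "AE \<xi> in lborel. (\<lambda>n. cos (x \<bullet> \<xi>) * (?M (f n) \<xi> * gauss \<epsilon> \<xi>)) \<longlonglongrightarrow> cos (x \<bullet> \<xi>) * (?M g \<xi> * gauss \<epsilon> \<xi>)"
        by (intro AE_I2 tendsto_intros l)
      show "AE \<xi> in lborel. norm (cos (x \<bullet> \<xi>) * (?M (f n) \<xi> * gauss \<epsilon> \<xi>)) \<le> gauss \<epsilon> \<xi>" for n
        by (intro AE_I2 wb lim.hyps)
    qed measurable
    have Clim: "(\<lambda>n. ?C * Re (f n ?d)) \<longlonglongrightarrow> ?C * Re (g ?d)"
      by (intro tendsto_intros lim.hyps(2)) (use d in simp)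
    have "?C * Re (g ?d) \<le> ?I g"
      by (rule LIMSEQ_le[OF Clim Ilim]) (use lim.IH in blast)
    then show ?case using mg by blast
  qed
  then show "?M f \<in> borel_measurable borel" "?C * Re (f ?d) \<le> ?I f" by blast+
qed

text \<open>The Fourier multiplier of the evolution times the transform of the initial datum, up to constants.\<close>

definition wave_symbol :: "real \<Rightarrow> real \<Rightarrow> real \<Rightarrow> real \<Rightarrow> 'a::euclidean_space \<Rightarrow> real" where
  "wave_symbol \<alpha> \<beta> \<epsilon> t \<xi> = mittag_leffler \<alpha> (- (norm \<xi> powr \<beta> * t powr \<alpha>)) * gauss \<epsilon> \<xi>"

text \<open>The solution with initial datum \<open>(\<pi> / \<epsilon>)\<^sup>d\<^sup>/\<^sup>2 exp (- |x|\<^sup>2 / (4 \<epsilon>))\<close>: its mass \<open>(2 \<pi>)\<^sup>d\<close> does not depend on \<open>\<epsilon>\<close>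
and it concentrates at the origin as \<open>\<epsilon>\<close> tends to \<open>0\<close>.\<close>

definition gaussian_wave :: "real \<Rightarrow> real \<Rightarrow> real \<Rightarrow> real \<Rightarrow> 'a::euclidean_space \<Rightarrow> real" where
  "gaussian_wave \<alpha> \<beta> \<epsilon> t x = (LINT \<xi>|lborel. cos (x \<bullet> \<xi>) * wave_symbol \<alpha> \<beta> \<epsilon> t \<xi>)"

context
  fixes \<alpha> \<beta> \<epsilon> :: real
  assumes \<alpha>: "0 < \<alpha>" "\<alpha> < 1" and \<beta>: "0 < \<beta>" "\<beta> \<le> 2" and \<epsilon>: "0 < \<epsilon>"
begin

abbreviation symb :: "real \<Rightarrow> 'a::euclidean_space \<Rightarrow> real" where
  "symb \<equiv> wave_symbol \<alpha> \<beta> \<epsilon>"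

abbreviation wave :: "real \<Rightarrow> 'a::euclidean_space \<Rightarrow> real" where
  "wave \<equiv> gaussian_wave \<alpha> \<beta> \<epsilon>"

lemma relaxation_factor_bounds:
  "0 \<le> mittag_leffler \<alpha> (- (norm \<xi> powr \<beta> * t powr \<alpha>))" "mittag_leffler \<alpha> (- (norm \<xi> powr \<beta> * t powr \<alpha>)) \<le> (1::real)"
  using mittag_leffler_neg[OF \<alpha>, of "norm \<xi> powr \<beta> * t powr \<alpha>"] by auto

lemma wave_symbol_bounds: "0 \<le> symb t \<xi>" "symb t \<xi> \<le> gauss \<epsilon> \<xi>"
  using relaxation_factor_bounds[of \<xi> t] by (auto simp: wave_symbol_def mult_left_le_one_le)

lemma mittag_leffler_measurable [measurable]: "(mittag_leffler \<alpha> :: real \<Rightarrow> real) \<in> borel_measurable borel"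
  by (rule borel_measurable_continuous_onI[OF mittag_leffler_continuous[OF \<alpha>(1)]])

lemma wave_symbol_measurable:
  assumes [measurable]: "f \<in> borel_measurable M" "g \<in> borel_measurable M"
  shows "(\<lambda>y. symb (f y) (g y :: 'a::euclidean_space)) \<in> borel_measurable M"
  unfolding wave_symbol_def by measurable

lemma wave_symbol_continuous:
  "continuous_on ({0..} \<times> UNIV) (\<lambda>(t, \<xi>::'a::euclidean_space). symb t \<xi>)"
  unfolding wave_symbol_def case_prod_beta
  by (intro continuous_intros continuous_on_compose2[OF mittag_leffler_continuous[OF \<alpha>(1), of UNIV]] continuous_on_powr')
    (use \<alpha> \<beta> in auto)

lemma wave_symbol_integrable: "integrable lborel (symb t :: 'a::euclidean_space \<Rightarrow> real)"
proof (rule Bochner_Integration.integrable_bound[OF gaussian_integrable[OF \<epsilon>]])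
  show "AE \<xi> in lborel. norm (symb t (\<xi>::'a)) \<le> norm (gauss \<epsilon> \<xi>)"
    by (intro AE_I2) (simp add: abs_of_nonneg[OF wave_symbol_bounds(1)] wave_symbol_bounds(2))
qed (rule wave_symbol_measurable; measurable)

lemma wave_integrand_bound: "\<bar>cos (x \<bullet> \<xi>) * symb t \<xi>\<bar> \<le> gauss \<epsilon> \<xi>"
proof -
  have "\<bar>cos (x \<bullet> \<xi>)\<bar> * \<bar>symb t \<xi>\<bar> \<le> 1 * gauss \<epsilon> \<xi>"
    using wave_symbol_bounds[of t \<xi>] by (intro mult_mono) auto
  then show ?thesis by (simp add: abs_mult)
qed

lemma gaussian_wave_bound: "\<bar>wave t (x::'a::euclidean_space)\<bar> \<le> (pi / \<epsilon>) powr (DIM('a)/2)"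
proof -
  have "\<bar>wave t x\<bar> \<le> (LINT \<xi>|lborel. \<bar>cos (x \<bullet> \<xi>) * symb t \<xi>\<bar>)"
    unfolding gaussian_wave_def by (rule integral_abs_bound)
  also have "\<dots> \<le> (LINT \<xi>::'a|lborel. gauss \<epsilon> \<xi>)"
    by (rule integral_mono') (auto intro: gaussian_integrable \<epsilon> wave_integrand_bound)
  finally show ?thesis by (simp add: gaussian_integral[OF \<epsilon>])
qed

lemma gaussian_wave_measurable:
  "(\<lambda>t. wave t (x::'a::euclidean_space)) \<in> borel_measurable borel"
proof -
  have [measurable]: "(\<lambda>p. symb (fst p) (snd p :: 'a)) \<in> borel_measurable (borel \<Otimes>\<^sub>M borel)"
    by (rule wave_symbol_measurable) measurable
  have "(\<lambda>t. LINT \<xi>|lborel. cos (x \<bullet> \<xi>) * symb (fst (t, \<xi>)) (snd (t, \<xi>))) \<in> borel_measurable borel"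
    by measurable
  then show ?thesis by (simp add: gaussian_wave_def[abs_def])
qed

lemma gaussian_wave_continuous:
  "continuous_on ({0..} \<times> UNIV) (\<lambda>(t, x::'a::euclidean_space). wave t x)"
  unfolding continuous_on_sequentially
proof (intro allI ballI impI, elim conjE)
  fix X :: "nat \<Rightarrow> real \<times> 'a" and p
  assume p: "p \<in> {0..} \<times> UNIV" and X: "\<forall>n. X n \<in> {0..} \<times> UNIV" and lim: "X \<longlonglongrightarrow> p"
  have "(\<lambda>n. LINT \<xi>|lborel. cos (snd (X n) \<bullet> \<xi>) * symb (fst (X n)) \<xi>)
     \<longlonglongrightarrow> (LINT \<xi>|lborel. cos (snd p \<bullet> \<xi>) * symb (fst p) \<xi>)"
  proof (rule integral_dominated_convergence)
    show "integrable lborel (\<lambda>\<xi>::'a. gauss \<epsilon> \<xi>)" by (rule gaussian_integrable[OF \<epsilon>])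
    show "AE \<xi> in lborel. (\<lambda>n. cos (snd (X n) \<bullet> \<xi>) * symb (fst (X n)) \<xi>)
       \<longlonglongrightarrow> cos (snd p \<bullet> \<xi>) * symb (fst p) \<xi>"
    proof (intro AE_I2 tendsto_mult)
      fix \<xi> :: 'a
      show "(\<lambda>n. cos (snd (X n) \<bullet> \<xi>)) \<longlonglongrightarrow> cos (snd p \<bullet> \<xi>)" by (intro tendsto_intros lim)
      have "(\<lambda>n. (fst (X n), \<xi>)) \<longlonglongrightarrow> (fst p, \<xi>)" by (intro tendsto_intros lim)
      moreover have "(fst p, \<xi>) \<in> {0..} \<times> UNIV" "\<forall>n. (fst (X n), \<xi>) \<in> {0..} \<times> UNIV"
        using p X by (auto simp: mem_Times_iff)
      ultimately show "(\<lambda>n. symb (fst (X n)) \<xi>) \<longlonglongrightarrow> symb (fst p) \<xi>"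
        using wave_symbol_continuous[where 'a='a, unfolded continuous_on_sequentially, rule_format, of "(fst p, \<xi>)" "\<lambda>n. (fst (X n), \<xi>)"]
        by (simp add: comp_def)
    qed
    show "AE \<xi> in lborel. norm (cos (snd (X n) \<bullet> \<xi>) * symb (fst (X n)) \<xi>) \<le> gauss \<epsilon> \<xi>" for n
      using wave_integrand_bound by (intro AE_I2) auto
  qed (use borel_measurable_integrable[OF wave_symbol_integrable] in measurable)
  then show "((\<lambda>(t, x). wave t x) \<circ> X) \<longlonglongrightarrow> (case p of (t, x) \<Rightarrow> wave t x)"
    by (simp add: comp_def case_prod_beta gaussian_wave_def)
qed

text \<open>As a function of \<open>z = |\<xi>|\<^sup>2\<close> the multiplier is \<open>E\<^sub>\<alpha>(- t\<^sup>\<alpha> z powr (\<beta> / 2))\<close>, which is in \<open>laplace_cone\<close>; it is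
positive at real arguments by the lower bound for \<open>E\<^sub>\<alpha>\<close>.\<close>

lemma gaussian_wave_pos:
  assumes t: "0 < t"
  shows "0 < wave t (x::'a::euclidean_space)"
proof -
  define f where "f z = mittag_leffler \<alpha> (- (of_real (t powr \<alpha>) * z powr of_real (\<beta> / 2)))" for z :: complex
  have f: "f \<in> laplace_cone"
    unfolding f_def[abs_def] by (rule laplace_cone_mittag_leffler) (use \<alpha> \<beta> in auto)
  have fr: "Re (f (of_real s)) = mittag_leffler \<alpha> (- (t powr \<alpha> * s powr (\<beta> / 2)))" if "0 \<le> s" for s
    unfolding f_def powr_of_real[OF that] of_real_mult[symmetric] of_real_minus[symmetric] mittag_leffler_of_real[OF \<alpha>(1)]
    by simp
  have "(LINT \<xi>|lborel. cos (x \<bullet> \<xi>) * ((if \<xi> = 0 then 0 else Re (f (of_real ((norm \<xi>)\<^sup>2)))) * gauss \<epsilon> \<xi>)) = wave t x"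
    unfolding gaussian_wave_def
  proof (rule integral_cong_AE)
    have "AE \<xi> in lborel. \<xi> \<noteq> (0::'a)" by (rule AE_lborel_singleton)
    then show "AE \<xi> in lborel. cos (x \<bullet> \<xi>) * ((if \<xi> = 0 then 0 else Re (f (of_real ((norm \<xi>)\<^sup>2)))) * gauss \<epsilon> \<xi>) = cos (x \<bullet> \<xi>) * symb t \<xi>"
    proof eventually_elim
      case (elim \<xi>)
      have "((norm \<xi>)\<^sup>2) powr (\<beta> / 2) = norm \<xi> powr \<beta>"
      proof -
        have "((norm \<xi>)\<^sup>2) powr (\<beta> / 2) = (norm \<xi> powr 2) powr (\<beta> / 2)" using elim by simp
        then show ?thesis by (simp only: powr_powr) simp
      qed
      then show ?case using elim fr[of "(norm \<xi>)\<^sup>2"] by (simp add: wave_symbol_def mult.commute)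
    qed
    have [measurable]: "(\<lambda>\<xi>::'a. if \<xi> = 0 then 0 else Re (f (of_real ((norm \<xi>)\<^sup>2)))) \<in> borel_measurable borel"
      by (rule laplace_cone_gaussian_lower_bound(1)[OF f \<epsilon>])
    show "(\<lambda>\<xi>. cos (x \<bullet> \<xi>) * ((if \<xi> = 0 then 0 else Re (f (of_real ((norm \<xi>)\<^sup>2)))) * gauss \<epsilon> \<xi>)) \<in> borel_measurable lborel"
      by measurable
  qed (use borel_measurable_integrable[OF wave_symbol_integrable] in measurable)
  moreover have "0 < (pi / \<epsilon>) powr (DIM('a)/2) * exp (- ((norm x)\<^sup>2 / (4 * \<epsilon>))) * Re (f (of_real (DIM('a) / (2 * \<epsilon>))))"
  proof -
    have G: "0 < Gamma (1 - \<alpha>)" using \<alpha> by (simp add: Gamma_real_pos)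
    have "0 < 1 / (1 + Gamma (1 - \<alpha>) * y)" if "0 \<le> y" for y :: real
      using G that by (intro divide_pos_pos add_pos_nonneg) auto
    then have "0 < mittag_leffler \<alpha> (- y)" if "0 \<le> y" for y :: real
      using mittag_leffler_lower_bound[OF \<alpha> that] that less_le_trans by blast
    then have "0 < Re (f (of_real (DIM('a) / (2 * \<epsilon>))))"
      by (subst fr) (use \<epsilon> in auto)
    then show ?thesis using \<epsilon> by simp
  qed
  ultimately show ?thesis
    using laplace_cone_gaussian_lower_bound(2)[OF f \<epsilon>, of x] by linarith
qed

lemma wave_symbol_even: "symb t (- \<xi>) = symb t \<xi>"
  by (simp add: wave_symbol_def)

lemma wave_symbol_continuous_space:
  assumes "0 \<le> t"
  shows "continuous_on UNIV (symb t :: 'a::euclidean_space \<Rightarrow> real)"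
proof -
  have "continuous_on UNIV (\<lambda>\<xi>::'a. case (t, \<xi>) of (t, \<xi>) \<Rightarrow> symb t \<xi>)"
    by (rule continuous_on_compose2[OF wave_symbol_continuous]) (use assms in \<open>auto intro!: continuous_intros\<close>)
  then show ?thesis by simp
qed

lemma gaussian_wave_fourier:
  fixes \<eta> :: "'a::euclidean_space"
  assumes t: "0 < t"
  shows "integrable lborel (wave t :: 'a \<Rightarrow> real)"
    and "(LINT x|lborel. wave t x *\<^sub>R cis (- (x \<bullet> \<eta>))) = of_real ((2 * pi) ^ DIM('a) * symb t \<eta>)"
proof -
  note inv = fourier_inversion_nonneg[where g = "symb t :: 'a \<Rightarrow> real" and u = "wave t :: 'a \<Rightarrow> real" and B = 1]
  have b: "\<bar>symb t (\<xi>::'a)\<bar> \<le> 1" for \<xi>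
  proof -
    have "gauss \<epsilon> \<xi> \<le> 1" using \<epsilon> by simp
    then show ?thesis using wave_symbol_bounds[of t \<xi>] by linarith
  qed
  have u: "(LINT \<xi>|lborel. symb t \<xi> *\<^sub>R cis (x \<bullet> \<xi>)) = of_real (wave t x)" for x :: 'a
    unfolding gaussian_wave_def by (rule even_fourier_real[OF wave_symbol_integrable wave_symbol_even])
  show "integrable lborel (wave t :: 'a \<Rightarrow> real)"
    by (rule inv(1)[OF _ b wave_symbol_integrable u])
      (use t gaussian_wave_pos[OF t] wave_symbol_continuous_space less_imp_le in auto)
  show "(LINT x|lborel. wave t x *\<^sub>R cis (- (x \<bullet> \<eta>))) = of_real ((2 * pi) ^ DIM('a) * symb t \<eta>)"
    by (rule inv(2)[OF _ b wave_symbol_integrable u])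
      (use t gaussian_wave_pos[OF t] wave_symbol_continuous_space less_imp_le in auto)
qed

lemma gaussian_wave_smooth: "smooth_on ({0<..} \<times> UNIV) (\<lambda>(t, x::'a::euclidean_space). wave t x)"
  unfolding smooth_on_def
proof
  fix k
  have op: "open ({0::real<..} \<times> (UNIV :: 'a set))" by (intro open_Times open_UNIV open_greaterThan)
  show "C_k k ({0<..} \<times> UNIV) (\<lambda>(t, x::'a). wave t x)"
  proof (rule C_k_cong[OF op _ relaxation_wave_smooth[OF \<alpha> \<epsilon>, of "[]" k \<beta> 0 0]])
    fix p :: "real \<times> 'a" assume "p \<in> {0<..} \<times> UNIV"
    then have "0 < fst p" by auto
    then have "relaxation_wave \<alpha> \<beta> \<epsilon> [] 0 0 p \<xi> = cos (snd p \<bullet> \<xi>) * symb (fst p) \<xi>" for \<xi>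
      using \<alpha> by (simp add: relaxation_wave_def wave_symbol_def relaxation_deriv_0)
    then show "(LINT \<xi>|lborel. relaxation_wave \<alpha> \<beta> \<epsilon> [] 0 0 p \<xi>) = (case p of (t, x) \<Rightarrow> wave t x)"
      by (simp add: case_prod_beta gaussian_wave_def)
  qed simp
qed

lemma weighted_symbol_bound: "norm \<xi> powr \<beta> \<le> (1 + norm \<xi>) ^ 2"
proof -
  have "norm \<xi> powr \<beta> \<le> (1 + norm \<xi>) powr \<beta>" using \<beta> by (intro powr_mono2) auto
  also have "\<dots> \<le> (1 + norm \<xi>) powr 2" using \<beta> by (intro powr_mono) auto
  also have "\<dots> = (1 + norm \<xi>) ^ 2" by (subst powr_numeral) (auto simp: add_nonneg_eq_0_iff add_pos_nonneg)
  finally show ?thesis .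
qed

lemma weighted_symbol_integrable:
  "integrable lborel (\<lambda>\<xi>::'a::euclidean_space. norm \<xi> powr \<beta> * symb t \<xi>)"
proof (rule Bochner_Integration.integrable_bound[OF polynomial_gaussian_integrable[OF \<epsilon>, of 2]])
  show "AE \<xi> in lborel. norm (norm (\<xi>::'a) powr \<beta> * symb t \<xi>) \<le> norm ((1 + norm \<xi>)\<^sup>2 * gauss \<epsilon> \<xi>)"
    by (intro AE_I2) (auto simp: abs_mult abs_of_nonneg[OF wave_symbol_bounds(1)] intro!: mult_mono wave_symbol_bounds weighted_symbol_bound)
qed (use borel_measurable_integrable[OF wave_symbol_integrable] in measurable)

section \<open>The equation\<close>

text \<open>Fubini's theorem exchanges the fractional integral in time with the integral over frequencies, where
the relaxation equation applies to each frequency separately.\<close>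

lemma gaussian_wave_frac_integral:
  fixes x :: "'a::euclidean_space"
  assumes T: "0 < T"
  defines "H \<equiv> \<lambda>\<xi>. - (cos (x \<bullet> \<xi>) * gauss \<epsilon> \<xi> * (norm \<xi> powr \<beta> * (T * mittag_leffler2 \<alpha> (- (norm \<xi> powr \<beta> * T powr \<alpha>)))))"
  shows "integrable lborel H"
    and "frac_integral \<alpha> (\<lambda>s. wave s x - wave 0 x) T = (LINT \<xi>|lborel. H \<xi>)"
proof -
  define k where "k \<tau> = indicat_real {0..T} \<tau> * (T - \<tau>) powr (- \<alpha>)" for \<tau>
  define G where "G \<xi> = gauss \<epsilon> \<xi>" for \<xi> :: 'a
  define e where "e \<tau> \<xi> = mittag_leffler \<alpha> (- (norm \<xi> powr \<beta> * \<tau> powr \<alpha>))" for \<tau> :: real and \<xi> :: 'a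
  define F where "F \<tau> \<xi> = k \<tau> * (cos (x \<bullet> \<xi>) * ((e \<tau> \<xi> - 1) * G \<xi>))" for \<tau> \<xi>
  have e: "0 \<le> e \<tau> \<xi>" "e \<tau> \<xi> \<le> 1" for \<tau> \<xi>
    using relaxation_factor_bounds[of \<xi> \<tau>] by (auto simp: e_def)
  have ws: "symb \<tau> \<xi> = e \<tau> \<xi> * G \<xi>" for \<tau> \<xi> by (simp add: wave_symbol_def e_def G_def)
  have ws0: "symb 0 \<xi> = G \<xi>" for \<xi> :: 'a by (simp add: wave_symbol_def G_def mittag_leffler_0)
  have kint: "integrable lborel k" unfolding k_def by (rule frac_kernel_integrable[OF \<alpha>(2) T])
  have [measurable]: "k \<in> borel_measurable borel" unfolding k_def by measurable
  have [measurable]: "G \<in> borel_measurable borel" unfolding G_def by measurable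
  have Gint: "integrable lborel G" unfolding G_def by (rule gaussian_integrable[OF \<epsilon>])
  have [measurable]: "(\<lambda>p. e (fst p) (snd p)) \<in> borel_measurable (borel \<Otimes>\<^sub>M borel)" unfolding e_def by measurable
  have Fm: "case_prod F \<in> borel_measurable (lborel \<Otimes>\<^sub>M lborel)"
  proof -
    have "(\<lambda>p. k (fst p) * (cos (x \<bullet> snd p) * ((e (fst p) (snd p) - 1) * G (snd p)))) \<in> borel_measurable (lborel \<Otimes>\<^sub>M lborel)"
      by measurable
    then show ?thesis by (simp add: F_def case_prod_beta')
  qed
  have Fb: "\<bar>F \<tau> \<xi>\<bar> \<le> \<bar>k \<tau>\<bar> * G \<xi>" for \<tau> \<xi>
  proof -
    have "\<bar>F \<tau> \<xi>\<bar> = \<bar>k \<tau>\<bar> * (\<bar>cos (x \<bullet> \<xi>)\<bar> * (\<bar>e \<tau> \<xi> - 1\<bar> * G \<xi>))" by (simp add: F_def abs_mult G_def)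
    also have "\<dots> \<le> \<bar>k \<tau>\<bar> * (1 * (1 * G \<xi>))"
      using e[of \<tau> \<xi>] by (intro mult_mono mult_left_mono) (auto simp: G_def)
    finally show ?thesis by simp
  qed
  have prod: "integrable (lborel \<Otimes>\<^sub>M lborel) (\<lambda>(\<tau>, \<xi>). \<bar>k \<tau>\<bar> * G \<xi>)"
  proof (rule lborel_pair.Fubini_integrable)
    have "(\<lambda>p. \<bar>k (fst p)\<bar> * G (snd p)) \<in> borel_measurable (lborel \<Otimes>\<^sub>M lborel)" by measurable
    then show "(\<lambda>(\<tau>, \<xi>). \<bar>k \<tau>\<bar> * G \<xi>) \<in> borel_measurable (lborel \<Otimes>\<^sub>M lborel)" by (simp add: case_prod_beta')
    have "integrable lborel (\<lambda>\<tau>. \<bar>k \<tau>\<bar> * (LINT \<xi>|lborel. \<bar>G \<xi>\<bar>))" using kint by simp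
    then show "integrable lborel (\<lambda>\<tau>. LINT \<xi>|lborel. norm (case (\<tau>, \<xi>) of (\<tau>, \<xi>) \<Rightarrow> \<bar>k \<tau>\<bar> * G \<xi>))"
      by (simp add: abs_mult)
    show "AE \<tau> in lborel. integrable lborel (\<lambda>\<xi>. case (\<tau>, \<xi>) of (\<tau>, \<xi>) \<Rightarrow> \<bar>k \<tau>\<bar> * G \<xi>)"
      using Gint by (intro AE_I2) simp
  qed
  have Fint: "integrable (lborel \<Otimes>\<^sub>M lborel) (case_prod F)"
  proof (rule Bochner_Integration.integrable_bound[OF prod Fm], rule AE_I2)
    fix p :: "real \<times> 'a"
    have "0 \<le> \<bar>k (fst p)\<bar> * G (snd p)" by (simp add: G_def)
    then show "norm (case_prod F p) \<le> norm (case p of (\<tau>, \<xi>) \<Rightarrow> \<bar>k \<tau>\<bar> * G \<xi>)"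
      using Fb[of "fst p" "snd p"] by (simp add: case_prod_beta)
  qed
  have inner1: "(LINT \<xi>|lborel. F \<tau> \<xi>) = k \<tau> * (wave \<tau> x - wave 0 x)" for \<tau>
  proof -
    have i: "integrable lborel (\<lambda>\<xi>. cos (x \<bullet> \<xi>) * symb s \<xi>)" for s
    proof (rule Bochner_Integration.integrable_bound[OF gaussian_integrable[OF \<epsilon>]])
      show "AE \<xi> in lborel. norm (cos (x \<bullet> \<xi>) * symb s \<xi>) \<le> norm (gauss \<epsilon> \<xi>)"
        using wave_integrand_bound by (intro AE_I2) auto
    qed (use borel_measurable_integrable[OF wave_symbol_integrable] in measurable)
    have "F \<tau> \<xi> = k \<tau> * (cos (x \<bullet> \<xi>) * symb \<tau> \<xi> - cos (x \<bullet> \<xi>) * symb 0 \<xi>)" for \<xi>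
      unfolding F_def ws0 unfolding ws by (simp add: algebra_simps)
    then show ?thesis using i by (simp add: gaussian_wave_def)
  qed
  have inner2: "(LINT \<tau>|lborel. F \<tau> \<xi>) = Gamma (1 - \<alpha>) * H \<xi>" for \<xi>
  proof -
    have "(LINT \<tau>|lborel. F \<tau> \<xi>) = (LINT \<tau>|lborel. (cos (x \<bullet> \<xi>) * G \<xi>) * (indicator {0..T} \<tau> *\<^sub>R ((T - \<tau>) powr (- \<alpha>) * (mittag_leffler \<alpha> (- (norm \<xi> powr \<beta> * \<tau> powr \<alpha>)) - 1))))"
      by (simp add: F_def k_def e_def mult_ac)
    also have "\<dots> = (cos (x \<bullet> \<xi>) * G \<xi>) * (LINT \<tau>:{0..T}|lborel. (T - \<tau>) powr (- \<alpha>) * (mittag_leffler \<alpha> (- (norm \<xi> powr \<beta> * \<tau> powr \<alpha>)) - 1))"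
      unfolding set_lebesgue_integral_def by (rule integral_mult_right_zero)
    also have "\<dots> = Gamma (1 - \<alpha>) * H \<xi>"
      unfolding mittag_leffler_fractional_integral[OF \<alpha> T] by (simp add: H_def G_def mult_ac)
    finally show ?thesis .
  qed
  have "0 < Gamma (1 - \<alpha>)" using \<alpha> by (intro Gamma_real_pos) simp
  then have G0: "Gamma (1 - \<alpha>) \<noteq> 0" by (rule less_imp_neq[symmetric])
  have "integrable lborel (\<lambda>\<xi>. Gamma (1 - \<alpha>) * H \<xi>)"
    using lborel_pair.integrable_snd[OF Fint] by (simp add: inner2)
  then show "integrable lborel H" using G0 by simp
  have "frac_integral \<alpha> (\<lambda>s. wave s x - wave 0 x) T = 1 / Gamma (1 - \<alpha>) * (LINT \<tau>|lborel. (LINT \<xi>|lborel. F \<tau> \<xi>))"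
    by (simp add: frac_integral_def set_lebesgue_integral_def inner1 k_def mult.assoc)
  also have "(LINT \<tau>|lborel. (LINT \<xi>|lborel. F \<tau> \<xi>)) = (LINT \<xi>|lborel. (LINT \<tau>|lborel. F \<tau> \<xi>))"
    by (rule lborel_pair.Fubini_integral[OF Fint, symmetric])
  also have "\<dots> = Gamma (1 - \<alpha>) * (LINT \<xi>|lborel. H \<xi>)" by (simp add: inner2)
  finally show "frac_integral \<alpha> (\<lambda>s. wave s x - wave 0 x) T = (LINT \<xi>|lborel. H \<xi>)"
    using G0 by simp
qed

text \<open>Each frequency of the fractional integral has time derivative at most \<open>|\<xi>|\<^sup>\<beta> exp (- \<epsilon> |\<xi>|\<^sup>2)\<close> in absolute
value, uniformly in time, which allows differentiation under the integral.\<close>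

lemma gaussian_wave_RL_derivative:
  fixes x :: "'a::euclidean_space"
  assumes t: "0 < t"
  shows "has_RL_derivative \<alpha> (\<lambda>s. wave s x - wave 0 x)
     (- (LINT \<xi>|lborel. cos (x \<bullet> \<xi>) * (norm \<xi> powr \<beta> * symb t \<xi>))) t"
proof -
  define f where "f s = wave s x - wave 0 x" for s
  define a where "a \<xi> = cos (x \<bullet> \<xi>) * gauss \<epsilon> \<xi> * norm \<xi> powr \<beta>" for \<xi> :: 'a
  define h where "h T \<xi> = - (a \<xi> * (T * mittag_leffler2 \<alpha> (- (norm \<xi> powr \<beta> * T powr \<alpha>))))" for T \<xi>
  define D where "D T \<xi> = - (cos (x \<bullet> \<xi>) * (norm \<xi> powr \<beta> * symb T \<xi>))" for T \<xi>
  define B where "B \<xi> = (1 + norm \<xi>)\<^sup>2 * gauss \<epsilon> \<xi>" for \<xi> :: 'a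
  have "(\<lambda>T. h T \<xi>) = (\<lambda>T. (- a \<xi>) * (T * mittag_leffler2 \<alpha> (- (norm \<xi> powr \<beta> * T powr \<alpha>))))" for \<xi>
    by (simp add: h_def fun_eq_iff)
  then have der: "((\<lambda>T. h T \<xi>) has_real_derivative D T \<xi>) (at T)" if "0 < T" for T \<xi>
    using DERIV_cmult[OF mittag_leffler2_has_derivative[OF \<alpha>(1) that, of "norm \<xi> powr \<beta>"], of "- a \<xi>"]
    by (simp add: D_def a_def wave_symbol_def mult_ac)
  have Db: "\<bar>D T \<xi>\<bar> \<le> B \<xi>" for T \<xi>
  proof -
    have "\<bar>D T \<xi>\<bar> = norm \<xi> powr \<beta> * \<bar>cos (x \<bullet> \<xi>) * symb T \<xi>\<bar>" by (simp add: D_def abs_mult)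
    also have "\<dots> \<le> B \<xi>" unfolding B_def
      by (intro mult_mono weighted_symbol_bound wave_integrand_bound) auto
    finally show ?thesis .
  qed
  have fr: "integrable lborel (h T)" "frac_integral \<alpha> f T = (LINT \<xi>|lborel. h T \<xi>)" if "0 < T" for T
    using gaussian_wave_frac_integral[OF that, of x] by (simp_all add: h_def[abs_def] a_def f_def[abs_def] mult_ac)
  have "((\<lambda>T. LINT \<xi>|lborel. h T \<xi>) has_derivative (\<lambda>v. LINT \<xi>|lborel. D t \<xi> * v)) (at t)"
  proof (rule has_derivative_integral[where r = t and B = B])
    show "integrable lborel B" unfolding B_def by (rule polynomial_gaussian_integrable[OF \<epsilon>])
    show "integrable lborel (h T)" if "T \<in> ball t t" for T using that by (intro fr) (auto simp: dist_real_def)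
    show "((\<lambda>T. h T \<xi>) has_derivative (*) (D t \<xi>)) (at t)" for \<xi>
      using der[OF t, of \<xi>] by (simp add: has_field_derivative_def)
    show "\<bar>h T \<xi> - h t \<xi>\<bar> \<le> B \<xi> * norm (T - t)" if T: "T \<in> ball t t" for T \<xi>
    proof -
      have "norm (h T \<xi> - h t \<xi>) \<le> B \<xi> * norm (T - t)"
      proof (rule field_differentiable_bound[where S = "ball t t" and f' = "\<lambda>T. D T \<xi>"])
        show "convex (ball t t)" by (rule convex_ball)
        show "((\<lambda>T. h T \<xi>) has_field_derivative D z \<xi>) (at z within ball t t)" if "z \<in> ball t t" for z
          by (rule has_field_derivative_at_within[OF der]) (use that in \<open>auto simp: dist_real_def\<close>)
        show "norm (D z \<xi>) \<le> B \<xi>" for z using Db by simp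
      qed (use T t in auto)
      then show ?thesis by simp
    qed
    have [measurable]: "symb t \<in> borel_measurable (borel :: 'a measure)"
      using borel_measurable_integrable[OF wave_symbol_integrable] by simp
    show "(\<lambda>\<xi>. D t \<xi> * v) \<in> borel_measurable lborel" for v unfolding D_def by measurable
    show "\<bar>D t \<xi> * v\<bar> \<le> B \<xi> * norm v" for \<xi> v using Db[of t \<xi>] by (simp add: abs_mult mult_right_mono)
  qed (rule t)
  then have "((\<lambda>T. LINT \<xi>|lborel. h T \<xi>) has_real_derivative (LINT \<xi>|lborel. D t \<xi>)) (at t)"
    by (simp add: has_field_derivative_def)
  then have "(frac_integral \<alpha> f has_real_derivative (LINT \<xi>|lborel. D t \<xi>)) (at t)"
  proof (rule has_field_derivative_transform_within_open)
    show "open {0::real<..}" by simp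
  qed (use t fr in auto)
  moreover have "set_integrable lborel {0..s} (\<lambda>\<tau>. (s - \<tau>) powr (- \<alpha>) * f \<tau>)" if "0 < s" for s
  proof (rule frac_kernel_set_integrable[OF \<alpha>(2) that])
    show "f \<in> borel_measurable lborel"
      unfolding f_def using gaussian_wave_measurable[of x] by measurable
    show "\<bar>f \<tau>\<bar> \<le> 2 * (pi / \<epsilon>) powr (DIM('a)/2)" for \<tau>
      using gaussian_wave_bound[of \<tau> x] gaussian_wave_bound[of 0 x]
      by (simp add: f_def abs_le_iff)
  qed
  ultimately show ?thesis
    unfolding has_RL_derivative_def f_def[abs_def] D_def by simp
qed

lemma gaussian_wave_fourier_transform:
  fixes \<xi> :: "real ^ 'd"
  assumes t: "0 < t"
  shows "fourier (\<lambda>x. of_real (wave t x)) \<xi> = of_real ((2 * pi) powr (real CARD('d) / 2) * symb t \<xi>)"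
proof -
  have "(LINT x|lborel. exp (- (\<i> * of_real (x \<bullet> \<xi>))) * complex_of_real (wave t x))
     = of_real ((2 * pi) ^ CARD('d) * symb t \<xi>)"
    using gaussian_wave_fourier(2)[OF t, of \<xi>] by (simp add: cis_conv_exp scaleR_conv_of_real mult.commute)
  moreover have "(2 * pi) powr (- real CARD('d) / 2) * (2 * pi) ^ CARD('d) = (2 * pi) powr (real CARD('d) / 2)"
  proof -
    have "(2 * pi) ^ CARD('d) = (2 * pi) powr real CARD('d)" by (rule powr_realpow[symmetric]) simp
    then show ?thesis by (simp add: powr_add[symmetric])
  qed
  ultimately show ?thesis unfolding fourier_def by (simp only: of_real_mult[symmetric] mult.assoc[symmetric])
qed

lemma gaussian_wave_frac_laplacian:
  assumes t: "0 < t"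
  shows "has_frac_laplacian \<beta> (wave t :: real ^ 'd \<Rightarrow> real)
     (\<lambda>x. LINT \<xi>|lborel. cos (x \<bullet> \<xi>) * (norm \<xi> powr \<beta> * symb t \<xi>))"
proof -
  define c where "c = (2 * pi) powr (real CARD('d) / 2)"
  define w where "w \<xi> = norm \<xi> powr \<beta> * symb t \<xi>" for \<xi> :: "real ^ 'd"
  have wint: "integrable lborel w"
    unfolding w_def by (rule weighted_symbol_integrable)
  have sym: "frac_laplacian_symbol \<beta> (wave t) = (\<lambda>\<xi>. of_real (c * w \<xi>))"
    unfolding frac_laplacian_symbol_def gaussian_wave_fourier_transform[OF t] c_def w_def
    by (simp add: fun_eq_iff)
  have "inv_fourier (\<lambda>\<xi>. of_real (c * w \<xi>)) x = of_real (LINT \<xi>|lborel. cos (x \<bullet> \<xi>) * w \<xi>)" for x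
  proof -
    have "exp (\<i> * of_real (x \<bullet> \<xi>)) * of_real (c * w \<xi>) = of_real c * (w \<xi> *\<^sub>R cis (x \<bullet> \<xi>))" for \<xi>
      by (simp add: cis_conv_exp scaleR_conv_of_real)
    then have "inv_fourier (\<lambda>\<xi>. of_real (c * w \<xi>)) x = of_real ((2 * pi) powr (- real CARD('d) / 2)) * (of_real c * (LINT \<xi>|lborel. w \<xi> *\<^sub>R cis (x \<bullet> \<xi>)))"
      by (simp only: inv_fourier_def integral_mult_right_zero)
    also have "\<dots> = of_real ((2 * pi) powr (- real CARD('d) / 2) * c) * (LINT \<xi>|lborel. w \<xi> *\<^sub>R cis (x \<bullet> \<xi>))"
      by (simp only: of_real_mult mult.assoc)
    also have "(2 * pi) powr (- real CARD('d) / 2) * c = 1" by (simp add: c_def powr_add[symmetric])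
    also have "(LINT \<xi>|lborel. w \<xi> *\<^sub>R cis (x \<bullet> \<xi>)) = of_real (LINT \<xi>|lborel. cos (x \<bullet> \<xi>) * w \<xi>)"
      by (rule even_fourier_real[OF wint]) (simp add: w_def wave_symbol_even)
    finally show ?thesis by simp
  qed
  moreover have "integrable lborel (\<lambda>\<xi>. complex_of_real (c * w \<xi>))" using wint by (intro integrable_of_real) simp
  ultimately show ?thesis
    unfolding has_frac_laplacian_def sym using gaussian_wave_fourier(1)[OF t] by (simp add: w_def)
qed

lemma gaussian_wave_solution:
  "time_frac_solution \<alpha> \<beta> (wave :: real \<Rightarrow> real ^ 'd \<Rightarrow> real)"
  unfolding time_frac_solution_def
proof (intro conjI allI impI)
  show "continuous_on ({0..} \<times> UNIV) (\<lambda>(t, x::real ^ 'd). wave t x)"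
    by (rule gaussian_wave_continuous)
  fix t :: real assume t: "0 < t"
  show "\<exists>D L. (\<forall>x::real ^ 'd. has_RL_derivative \<alpha> (\<lambda>s. wave s x - wave 0 x) (D x) t) \<and>
       has_frac_laplacian \<beta> (wave t) L \<and> (\<forall>x. D x + L x = 0)"
    using gaussian_wave_RL_derivative[OF t, where 'a = "real ^ 'd"] gaussian_wave_frac_laplacian[OF t, where 'd = 'd]
    by (intro exI[of _ "\<lambda>x. - (LINT \<xi>|lborel. cos (x \<bullet> \<xi>) * (norm \<xi> powr \<beta> * symb t \<xi>))"]
        exI[of _ "\<lambda>x. LINT \<xi>|lborel. cos (x \<bullet> \<xi>) * (norm \<xi> powr \<beta> * symb t \<xi>)"]) simp
qed

end

section \<open>Values at the origin against norms\<close>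

lemma resolvent_set_integrable:
  assumes "0 \<le> C"
  shows "set_integrable lborel (ball (0::'a::euclidean_space) R) (\<lambda>\<xi>. 1 / (1 + C * norm \<xi> powr \<beta>))"
  unfolding set_integrable_def
proof (rule Bochner_Integration.integrable_bound)
  show "integrable lborel (indicat_real (ball (0::'a) R))"
    using emeasure_bounded_finite[OF bounded_ball[of "0::'a" R]] by (intro integrable_real_indicator) auto
  show "AE \<xi> in lborel. norm (indicat_real (ball 0 R) \<xi> *\<^sub>R (1 / (1 + C * norm (\<xi>::'a) powr \<beta>))) \<le> norm (indicat_real (ball 0 R) \<xi>)"
    using assms by (intro AE_I2) (auto simp: indicator_def divide_le_eq add_nonneg_nonneg)
  have [measurable]: "ball (0::'a) R \<in> sets borel" by simp
  have [measurable]: "(\<lambda>\<xi>::'a. 1 / (1 + C * norm \<xi> powr \<beta>)) \<in> borel_measurable borel" by measurable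
  show "(\<lambda>\<xi>. indicat_real (ball (0::'a) R) \<xi> *\<^sub>R (1 / (1 + C * norm \<xi> powr \<beta>))) \<in> borel_measurable lborel"
    by measurable
qed

text \<open>All frequencies contribute positively at the origin; up to \<open>|\<xi>| \<le> R\<close> the Gaussian factor is at least
\<open>exp (- 1)\<close>, and the multiplier is bounded below by its \<open>1 / x\<close> decay.\<close>

lemma gaussian_wave_origin_lower_bound:
  assumes \<alpha>: "0 < \<alpha>" "\<alpha> < 1" and \<beta>: "0 < \<beta>" "\<beta> \<le> 2" and \<epsilon>: "0 < \<epsilon>"
    and t: "0 < t" and R: "0 \<le> R" "\<epsilon> * R\<^sup>2 \<le> 1"
  shows "exp (- 1) * (LINT \<xi>:ball (0::'a::euclidean_space) R|lborel. 1 / (1 + Gamma (1 - \<alpha>) * t powr \<alpha> * norm \<xi> powr \<beta>))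
     \<le> gaussian_wave \<alpha> \<beta> \<epsilon> t (0::'a)"
proof -
  define C where "C = Gamma (1 - \<alpha>) * t powr \<alpha>"
  have G: "0 \<le> Gamma (1 - \<alpha>)" using \<alpha> Gamma_real_pos[of "1 - \<alpha>"] by simp
  then have C: "0 \<le> C" by (simp add: C_def)
  have "exp (- 1) * (LINT \<xi>:ball (0::'a) R|lborel. 1 / (1 + C * norm \<xi> powr \<beta>))
    = (LINT \<xi>|lborel. exp (- 1) * (indicator (ball (0::'a) R) \<xi> *\<^sub>R (1 / (1 + C * norm \<xi> powr \<beta>))))"
    unfolding set_lebesgue_integral_def by (rule integral_mult_right_zero[symmetric])
  also have "\<dots> \<le> (LINT \<xi>|lborel. wave_symbol \<alpha> \<beta> \<epsilon> t (\<xi>::'a))"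
  proof (rule integral_mono)
    show "integrable lborel (\<lambda>\<xi>::'a. exp (- 1) * (indicator (ball (0::'a) R) \<xi> *\<^sub>R (1 / (1 + C * norm \<xi> powr \<beta>))))"
      using resolvent_set_integrable[OF C, of R \<beta>, where 'a='a] unfolding set_integrable_def by (rule integrable_mult_right)
    show "integrable lborel (wave_symbol \<alpha> \<beta> \<epsilon> t :: 'a \<Rightarrow> real)" by (rule wave_symbol_integrable[OF \<alpha> \<beta> \<epsilon>])
    fix \<xi> :: 'a
    show "exp (- 1) * (indicator (ball (0::'a) R) \<xi> *\<^sub>R (1 / (1 + C * norm \<xi> powr \<beta>))) \<le> wave_symbol \<alpha> \<beta> \<epsilon> t \<xi>"
    proof (cases "\<xi> \<in> ball 0 R")
      case True
      then have "(norm \<xi>)\<^sup>2 \<le> R\<^sup>2" by (intro power_mono) auto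
      then have "\<epsilon> * (norm \<xi>)\<^sup>2 \<le> 1" using R(2) \<epsilon> by (meson mult_left_mono less_imp_le order_trans)
      then have "exp (- 1) * (1 / (1 + C * norm \<xi> powr \<beta>)) \<le> gauss \<epsilon> \<xi> * mittag_leffler \<alpha> (- (norm \<xi> powr \<beta> * t powr \<alpha>))"
        using mittag_leffler_lower_bound[OF \<alpha>, of "norm \<xi> powr \<beta> * t powr \<alpha>"] G
        by (intro mult_mono) (auto simp: C_def mult_ac intro!: add_nonneg_nonneg)
      then show ?thesis using True by (simp add: wave_symbol_def mult.commute)
    qed (use wave_symbol_bounds(1)[OF \<alpha> \<beta> \<epsilon>] in simp)
  qed
  also have "\<dots> = gaussian_wave \<alpha> \<beta> \<epsilon> t (0::'a)" by (simp add: gaussian_wave_def)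
  finally show ?thesis by (simp add: C_def)
qed

text \<open>\<open>f\<^sup>p \<le> A\<^sup>p\<^sup>-\<^sup>1 f\<close> interpolates between the supremum and the integral. The norm is positive because \<open>f\<close>
is, and because \<open>f\<^sup>p\<close> is integrable.\<close>

lemma Lp_norm_interpolation:
  fixes f :: "real ^ 'd \<Rightarrow> real"
  assumes f: "integrable lborel f" "\<And>x. 0 < f x" "\<And>x. f x \<le> A" and p: "1 \<le> p"
  shows "0 < Lp_norm p f" "Lp_norm p f \<le> (A powr (p - 1) * (LINT x|lborel. f x)) powr (1 / p)"
proof -
  have b: "\<bar>f x\<bar> powr p \<le> A powr (p - 1) * f x" for x
  proof -
    have "\<bar>f x\<bar> powr p = f x powr (p - 1) * f x" using f(2)[of x] by (simp add: powr_diff)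
    also have "\<dots> \<le> A powr (p - 1) * f x" using f(2,3)[of x] p by (intro mult_right_mono powr_mono2) auto
    finally show ?thesis .
  qed
  have [measurable]: "f \<in> borel_measurable borel" using borel_measurable_integrable[OF f(1)] by simp
  have i: "integrable lborel (\<lambda>x. \<bar>f x\<bar> powr p)"
  proof (rule Bochner_Integration.integrable_bound)
    show "integrable lborel (\<lambda>x. A powr (p - 1) * f x)" using f(1) by simp
    show "AE x in lborel. norm (\<bar>f x\<bar> powr p) \<le> norm (A powr (p - 1) * f x)"
      using order_trans[OF b abs_ge_self] by (intro AE_I2) simp
  qed measurable
  have "(LINT x|lborel. \<bar>f x\<bar> powr p) \<noteq> 0"
  proof
    assume "(LINT x|lborel. \<bar>f x\<bar> powr p) = 0"
    then have "AE x in lborel. \<bar>f x\<bar> powr p = 0"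
      using integral_nonneg_eq_0_iff_AE[OF i] by simp
    then have "AE x in (lborel :: (real ^ 'd) measure). False"
      by eventually_elim (metis abs_eq_0 f(2) less_irrefl powr_eq_0_iff)
    then have "ae_filter (lborel :: (real ^ 'd) measure) = bot" by (simp only: eventually_False)
    then show False by (simp add: ae_filter_eq_bot_iff)
  qed
  moreover have "0 \<le> (LINT x|lborel. \<bar>f x\<bar> powr p)" by simp
  ultimately show "0 < Lp_norm p f" unfolding Lp_norm_def by simp
  have "(LINT x|lborel. \<bar>f x\<bar> powr p) \<le> (LINT x|lborel. A powr (p - 1) * f x)"
    using i f(1) b by (intro integral_mono) auto
  then show "Lp_norm p f \<le> (A powr (p - 1) * (LINT x|lborel. f x)) powr (1 / p)"
    unfolding Lp_norm_def using p by (intro powr_mono2) auto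
qed

lemma gaussian_wave_Lp_norm:
  assumes \<alpha>: "0 < \<alpha>" "\<alpha> < 1" and \<beta>: "0 < \<beta>" "\<beta> \<le> 2" and \<epsilon>: "0 < \<epsilon>" and t: "0 < t" and p: "1 \<le> p"
  shows "0 < Lp_norm p (gaussian_wave \<alpha> \<beta> \<epsilon> t :: real ^ 'd \<Rightarrow> real)"
    and "Lp_norm p (gaussian_wave \<alpha> \<beta> \<epsilon> t :: real ^ 'd \<Rightarrow> real)
      \<le> (((pi / \<epsilon>) powr (CARD('d)/2)) powr (p - 1) * (2 * pi) ^ CARD('d)) powr (1 / p)"
proof -
  have "complex_of_real (LINT x|lborel. gaussian_wave \<alpha> \<beta> \<epsilon> t (x :: real ^ 'd)) = of_real ((2 * pi) ^ CARD('d))"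
    using gaussian_wave_fourier(2)[OF \<alpha> \<beta> \<epsilon> t, of "0 :: real ^ 'd"] \<beta>
    by (simp add: wave_symbol_def mittag_leffler_0 scaleR_conv_of_real)
  then have I: "(LINT x|lborel. gaussian_wave \<alpha> \<beta> \<epsilon> t (x :: real ^ 'd)) = (2 * pi) ^ CARD('d)"
    by (simp only: of_real_eq_iff)
  have A: "gaussian_wave \<alpha> \<beta> \<epsilon> t x \<le> (pi / \<epsilon>) powr (CARD('d)/2)" for x :: "real ^ 'd"
    using gaussian_wave_bound[OF \<alpha> \<beta> \<epsilon>, of t x] by simp
  note L = Lp_norm_interpolation[OF gaussian_wave_fourier(1)[OF \<alpha> \<beta> \<epsilon> t] gaussian_wave_pos[OF \<alpha> \<beta> \<epsilon> t] A p]
  show "0 < Lp_norm p (gaussian_wave \<alpha> \<beta> \<epsilon> t :: real ^ 'd \<Rightarrow> real)" by (rule L(1))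
  show "Lp_norm p (gaussian_wave \<alpha> \<beta> \<epsilon> t :: real ^ 'd \<Rightarrow> real)
      \<le> (((pi / \<epsilon>) powr (CARD('d)/2)) powr (p - 1) * (2 * pi) ^ CARD('d)) powr (1 / p)"
    using L(2) unfolding I .
qed

text \<open>With \<open>\<epsilon> = 1 / n\<close> the ball of radius \<open>sqrt n\<close> contributes \<open>n\<^sup>d\<^sup>/\<^sup>2 / n\<^sup>\<beta>\<^sup>/\<^sup>2\<close> to the value at the origin, while
the norm is at most of order \<open>n\<close> to the power \<open>(d / 2) (1 - 1 / p)\<close>. The exponent of the quotient is
\<open>d / (2 p) - \<beta> / 2\<close>, positive exactly for \<open>p < d / \<beta>\<close>.\<close>

lemma ratio_blowup_subcritical:
  assumes \<alpha>: "0 < \<alpha>" "\<alpha> < 1" and \<beta>: "0 < \<beta>" "\<beta> \<le> 2" and t: "0 < t1" "0 < t2"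
    and p: "1 \<le> p" "p < real CARD('d) / \<beta>"
  shows "filterlim (\<lambda>n. gaussian_wave \<alpha> \<beta> (1 / real n) t1 (0 :: real ^ 'd) / Lp_norm p (gaussian_wave \<alpha> \<beta> (1 / real n) t2 :: real ^ 'd \<Rightarrow> real)) at_top sequentially"
proof -
  define d where "d = real CARD('d)"
  define C where "C = Gamma (1 - \<alpha>) * t1 powr \<alpha>"
  define V where "V = unit_ball_vol d"
  define K where "K = (pi powr (d/2 * (p - 1)) * (2 * pi) ^ CARD('d)) powr (1 / p)"
  define \<delta> where "\<delta> = d / (2 * p) - \<beta> / 2"
  have d0: "0 < d" by (simp add: d_def)
  have C: "0 \<le> C" using \<alpha> Gamma_real_pos[of "1 - \<alpha>"] by (simp add: C_def)
  have V: "0 < V" unfolding V_def using d0 by simp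
  have K: "0 < K" by (simp add: K_def)
  have \<delta>: "0 < \<delta>" using p \<beta> by (simp add: \<delta>_def d_def field_simps)
  have "filterlim (\<lambda>n. (exp (- 1) * V / ((1 + C) * K)) * real n powr \<delta>) at_top sequentially"
  proof (rule filterlim_tendsto_pos_mult_at_top[OF tendsto_const])
    show "0 < exp (- 1) * V / ((1 + C) * K)" using V C K by (simp add: add_pos_nonneg)
    show "filterlim (\<lambda>n. real n powr \<delta>) at_top sequentially" using \<delta> by real_asymp
  qed
  then show ?thesis
  proof (rule filterlim_at_top_mono)
    show "eventually (\<lambda>n. exp (- 1) * V / ((1 + C) * K) * real n powr \<delta>
       \<le> gaussian_wave \<alpha> \<beta> (1 / real n) t1 (0 :: real ^ 'd) / Lp_norm p (gaussian_wave \<alpha> \<beta> (1 / real n) t2 :: real ^ 'd \<Rightarrow> real)) sequentially"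
      using eventually_ge_at_top[of 1]
    proof eventually_elim
      case (elim n)
      define N where "N = real n"
      let ?u = "gaussian_wave \<alpha> \<beta> (1 / N) :: real \<Rightarrow> real ^ 'd \<Rightarrow> real"
      let ?f = "\<lambda>\<xi>::real ^ 'd. 1 / (1 + C * norm \<xi> powr \<beta>)"
      have N: "1 \<le> N" using elim by (simp add: N_def)
      have \<epsilon>: "0 < 1 / N" using N by simp
      define R where "R = sqrt N"
      have R: "0 \<le> R" "1 \<le> R" "1 / N * R\<^sup>2 \<le> 1" using N by (auto simp: R_def)
      have RN: "R ^ CARD('d) = N powr (d/2)" "R powr \<beta> = N powr (\<beta>/2)"
      proof -
        have "R = N powr (1/2)" using N by (simp add: R_def powr_half_sqrt)
        then show "R powr \<beta> = N powr (\<beta>/2)" by (simp add: powr_powr)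
        have "R ^ CARD('d) = R powr d" unfolding d_def by (rule powr_realpow[symmetric]) (use R in simp)
        then show "R ^ CARD('d) = N powr (d/2)" using \<open>R = N powr (1/2)\<close> by (simp add: powr_powr)
      qed
      have "V * R ^ CARD('d) * (1 / ((1 + C) * R powr \<beta>)) = (LINT \<xi>:ball (0 :: real ^ 'd) R|lborel. 1 / ((1 + C) * R powr \<beta>))"
        using R by (subst set_integral_const) (auto simp: content_ball V_def d_def emeasure_ball)
      also have "\<dots> \<le> (LINT \<xi>:ball (0 :: real ^ 'd) R|lborel. ?f \<xi>)"
      proof (rule set_integral_mono)
        show "set_integrable lborel (ball (0 :: real ^ 'd) R) (\<lambda>\<xi>. 1 / ((1 + C) * R powr \<beta>))"
          unfolding set_integrable_def using R by (intro integrable_scaleR_left integrable_real_indicator) (auto simp: emeasure_ball)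
        show "set_integrable lborel (ball (0 :: real ^ 'd) R) (\<lambda>\<xi>. ?f \<xi>)"
          by (rule resolvent_set_integrable[OF C])
        fix \<xi> :: "real ^ 'd" assume "\<xi> \<in> ball 0 R"
        then have "norm \<xi> powr \<beta> \<le> R powr \<beta>" using \<beta> by (intro powr_mono2) auto
        moreover have "1 \<le> R powr \<beta>" using R \<beta> by (simp add: ge_one_powr_ge_zero)
        ultimately have "1 + C * norm \<xi> powr \<beta> \<le> (1 + C) * R powr \<beta>"
          using C by (simp add: distrib_right add_mono mult_left_mono)
        then show "1 / ((1 + C) * R powr \<beta>) \<le> ?f \<xi>"
          using C by (intro frac_le) (auto intro!: add_pos_nonneg)
      qed
      finally have "exp (- 1) * (V * R ^ CARD('d) * (1 / ((1 + C) * R powr \<beta>))) \<le> ?u t1 0"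
        using gaussian_wave_origin_lower_bound[OF \<alpha> \<beta> \<epsilon> t(1) R(1,3), where 'a = "real ^ 'd"]
        unfolding C_def by (meson exp_ge_zero mult_left_mono order_trans)
      then have lower: "exp (- 1) * V / (1 + C) * N powr (d/2 - \<beta>/2) \<le> ?u t1 0"
        unfolding RN by (simp add: powr_diff)
      have upper: "Lp_norm p (?u t2) \<le> K * N powr (d/2 * (p - 1) / p)"
      proof -
        have "((pi / (1 / N)) powr (CARD('d)/2)) powr (p - 1) = pi powr (d/2 * (p - 1)) * N powr (d/2 * (p - 1))"
          using N by (simp add: powr_powr powr_mult d_def)
        then have "(((pi / (1 / N)) powr (CARD('d)/2)) powr (p - 1) * (2 * pi) ^ CARD('d)) powr (1 / p) = (pi powr (d/2 * (p - 1)) * (2 * pi) ^ CARD('d) * N powr (d/2 * (p - 1))) powr (1 / p)"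
          by (simp only: mult_ac)
        also have "\<dots> = K * N powr (d/2 * (p - 1) / p)"
          by (simp add: K_def powr_mult powr_powr)
        finally show ?thesis using gaussian_wave_Lp_norm(2)[OF \<alpha> \<beta> \<epsilon> t(2) p(1), where 'd = 'd] by simp
      qed
      have "exp (- 1) * V / ((1 + C) * K) * N powr \<delta> = (exp (- 1) * V / (1 + C) * N powr (d/2 - \<beta>/2)) / (K * N powr (d/2 * (p - 1) / p))"
      proof -
        have "\<delta> = (d/2 - \<beta>/2) - d/2 * (p - 1) / p" using p by (simp add: \<delta>_def field_simps)
        then have "N powr \<delta> = N powr (d/2 - \<beta>/2) / N powr (d/2 * (p - 1) / p)" by (simp only: powr_diff)
        then show ?thesis by simp
      qed
      also have "\<dots> \<le> ?u t1 0 / Lp_norm p (?u t2)"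
        using lower upper gaussian_wave_Lp_norm(1)[OF \<alpha> \<beta> \<epsilon> t(2) p(1), where 'd = 'd] gaussian_wave_pos[OF \<alpha> \<beta> \<epsilon> t(1), of "0 :: real ^ 'd"]
        by (intro frac_le) auto
      finally show ?case by (simp add: N_def)
    qed
  qed
qed

text \<open>For \<open>\<beta> = d\<close> each dyadic shell \<open>2\<^sup>N \<le> |\<xi>| < 2\<^sup>N\<^sup>+\<^sup>1\<close> contributes at least the same positive amount: its
volume grows like \<open>2\<^sup>N\<^sup>d\<close>, just as the denominator does.\<close>

lemma critical_shell_integral:
  assumes C: "0 \<le> C" and \<beta>: "real DIM('a) = \<beta>"
  shows "real N * (unit_ball_vol (real DIM('a)) / ((1 + C) * 2 ^ Suc DIM('a))) \<le> (LINT \<xi>:ball (0::'a::euclidean_space) (2 ^ N)|lborel. 1 / (1 + C * norm \<xi> powr \<beta>))"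
proof (induction N)
  case 0
  show ?case using C by (auto simp: set_lebesgue_integral_def intro!: integral_nonneg_AE AE_I2)
next
  case (Suc N)
  let ?f = "\<lambda>\<xi>::'a. 1 / (1 + C * norm \<xi> powr \<beta>)"
  define d where "d = DIM('a)"
  have d: "0 < d" by (simp add: d_def)
  define V where "V = unit_ball_vol (real d)"
  define A where "A = ball (0::'a) (2 ^ Suc N) - ball 0 (2 ^ N)"
  have sub: "ball (0::'a) (2 ^ N) \<subseteq> ball 0 (2 ^ Suc N)" by (rule subset_ball) simp
  have V: "0 \<le> V" by (simp add: V_def)
  have I: "set_integrable lborel (ball (0::'a) R) (?f)" for R
    by (rule resolvent_set_integrable[OF C])
  have IA: "set_integrable lborel A (?f)"
    by (rule set_integrable_subset[OF I[of "2 ^ Suc N"]]) (auto simp: A_def)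
  have fin: "emeasure lborel A \<noteq> \<infinity>"
    using emeasure_bounded_finite[of A] bounded_subset[OF bounded_ball[of "0::'a" "2 ^ Suc N"], of A] by (auto simp: A_def)
  have "measure lborel A = measure lborel (ball (0::'a) (2 ^ Suc N)) - measure lborel (ball (0::'a) (2 ^ N))"
    unfolding A_def using sub by (intro measure_Diff) (auto simp: emeasure_ball)
  also have "\<dots> = V * ((2 ^ Suc N) ^ d - (2 ^ N) ^ d)"
    by (simp add: content_ball V_def d_def right_diff_distrib)
  finally have mA: "measure lborel A = V * ((2 ^ Suc N) ^ d - (2 ^ N) ^ d)" .
  have "V / ((1 + C) * 2 ^ Suc d) \<le> measure lborel A * (1 / ((1 + C) * (2 ^ Suc N) ^ d))"
  proof -
    define M :: real where "M = (2 ^ N) ^ d"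
    have M: "1 \<le> M" by (simp add: M_def)
    have M2: "(2 ^ Suc N) ^ d = 2 ^ d * M" by (simp add: M_def power_mult_distrib)
    have "(2::real) \<le> 2 ^ d" using d power_increasing[of 1 d "2::real"] by simp
    then have "2 ^ d * M \<le> 2 * (2 ^ d * M - M)" using M by (simp add: algebra_simps mult_right_mono)
    then have "1 / 2 \<le> (2 ^ d * M - M) / (2 ^ d * M)" using M by (simp add: field_simps)
    also have "\<dots> \<le> 2 ^ d * ((2 ^ d * M - M) / (2 ^ d * M))"
    proof -
      have "0 \<le> (2 ^ d * M - M) / (2 ^ d * M)" using \<open>2 \<le> 2 ^ d\<close> M by (intro divide_nonneg_pos) (auto simp: mult_le_cancel_right1)
      moreover have "y \<le> 2 ^ d * y" if "0 \<le> y" for y :: real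
        using mult_right_mono[of 1 "2 ^ d" y] \<open>2 \<le> 2 ^ d\<close> that by simp
      ultimately show ?thesis by blast
    qed
    finally have "1 / (2 * 2 ^ d) \<le> (2 ^ d * M - M) / (2 ^ d * M)" by (simp add: field_simps)
    then have "V / (1 + C) * (1 / (2 * 2 ^ d)) \<le> V / (1 + C) * ((2 ^ d * M - M) / (2 ^ d * M))"
      using V C by (intro mult_left_mono) auto
    then show ?thesis unfolding mA M2 M_def[symmetric] by (simp add: mult_ac)
  qed
  also have "\<dots> = (LINT \<xi>:A|lborel. 1 / ((1 + C) * (2 ^ Suc N) ^ d))"
    using fin by (subst set_integral_const) (auto simp: A_def)
  also have "\<dots> \<le> (LINT \<xi>:A|lborel. ?f \<xi>)"
  proof (rule set_integral_mono)
    show "set_integrable lborel A (\<lambda>\<xi>. 1 / ((1 + C) * (2 ^ Suc N) ^ d))"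
      unfolding set_integrable_def using fin by (intro integrable_scaleR_left integrable_real_indicator) (auto simp: A_def less_top)
    fix \<xi> assume "\<xi> \<in> A"
    then have "norm \<xi> powr \<beta> \<le> (2 ^ Suc N) powr \<beta>" using \<beta> by (intro powr_mono2) (auto simp: A_def)
    also have "\<dots> = (2 ^ Suc N) ^ d" unfolding \<beta>[symmetric] d_def by (rule powr_realpow) simp
    finally have "1 + C * norm \<xi> powr \<beta> \<le> (1 + C) * (2 ^ Suc N) ^ d"
      using C by (simp add: distrib_right add_mono mult_left_mono del: power_Suc)
    then show "1 / ((1 + C) * (2 ^ Suc N) ^ d) \<le> ?f \<xi>"
      using C by (intro divide_left_mono) (auto intro!: mult_pos_pos add_pos_nonneg)
  qed (rule IA)
  finally have A: "V / ((1 + C) * 2 ^ Suc d) \<le> (LINT \<xi>:A|lborel. ?f \<xi>)" .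
  have "ball (0::'a) (2 ^ Suc N) = ball 0 (2 ^ N) \<union> A" using sub by (auto simp: A_def)
  then have "(LINT \<xi>:ball (0::'a) (2 ^ Suc N)|lborel. ?f \<xi>)
     = (LINT \<xi>:ball (0::'a) (2 ^ N)|lborel. ?f \<xi>) + (LINT \<xi>:A|lborel. ?f \<xi>)"
    using set_integral_Un[of "ball (0::'a) (2 ^ N)" A, OF _ I IA] by (auto simp: A_def)
  then show ?case
    using add_mono[OF Suc.IH A[unfolded V_def d_def]]
    by (simp only: of_nat_Suc distrib_right mult_1_left add.commute)
qed

text \<open>The \<open>L\<^sup>1\<close> norm is the conserved mass \<open>(2 \<pi>)\<^sup>d\<close>, and for \<open>n \<ge> 4\<^sup>N\<close> the value at the origin
collects \<open>N\<close> dyadic shells.\<close>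

lemma ratio_blowup_critical:
  assumes \<alpha>: "0 < \<alpha>" "\<alpha> < 1" and \<beta>: "0 < \<beta>" "\<beta> \<le> 2" and t: "0 < t1" "0 < t2"
    and d: "real CARD('d) = \<beta>"
  shows "filterlim (\<lambda>n. gaussian_wave \<alpha> \<beta> (1 / real n) t1 (0 :: real ^ 'd) / Lp_norm 1 (gaussian_wave \<alpha> \<beta> (1 / real n) t2 :: real ^ 'd \<Rightarrow> real)) at_top sequentially"
  unfolding filterlim_at_top
proof
  fix Z :: real
  define C where "C = Gamma (1 - \<alpha>) * t1 powr \<alpha>"
  have C: "0 \<le> C" using \<alpha> Gamma_real_pos[of "1 - \<alpha>"] by (simp add: C_def)
  define c where "c = unit_ball_vol (real CARD('d)) / ((1 + C) * 2 ^ Suc CARD('d))"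
  have c: "0 < c" using C by (simp add: c_def add_pos_nonneg)
  define L where "L = (2 * pi) ^ CARD('d)"
  have L: "0 < L" by (simp add: L_def)
  obtain N :: nat where N: "Z * L / (exp (- 1) * c) \<le> real N" using real_arch_simple by blast
  then have N: "Z * L \<le> exp (- 1) * (real N * c)" using c by (simp add: field_simps)
  show "eventually (\<lambda>n. Z \<le> gaussian_wave \<alpha> \<beta> (1 / real n) t1 (0 :: real ^ 'd) / Lp_norm 1 (gaussian_wave \<alpha> \<beta> (1 / real n) t2 :: real ^ 'd \<Rightarrow> real)) sequentially"
    using eventually_ge_at_top[of "4 ^ N"]
  proof eventually_elim
    case (elim n)
    let ?u = "gaussian_wave \<alpha> \<beta> (1 / real n) :: real \<Rightarrow> real ^ 'd \<Rightarrow> real"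
    have n: "4 ^ N \<le> real n" using elim by (metis of_nat_le_iff of_nat_numeral of_nat_power)
    have n0: "0 < real n" using n by (rule less_le_trans[rotated]) simp
    have \<epsilon>: "0 < 1 / real n" using n0 by simp
    have "((2 ^ N)\<^sup>2 :: real) = 4 ^ N" by (simp add: power2_eq_square power_mult_distrib[symmetric])
    then have R: "1 / real n * (2 ^ N)\<^sup>2 \<le> 1" using n n0 by (simp add: divide_le_eq)
    have "Z * L \<le> exp (- 1) * (real N * c)" by (rule N)
    also have "\<dots> \<le> exp (- 1) * (LINT \<xi>:ball (0 :: real ^ 'd) (2 ^ N)|lborel. 1 / (1 + C * norm \<xi> powr \<beta>))"
      using critical_shell_integral[OF C, of \<beta> N, where 'a = "real ^ 'd"] d by (intro mult_left_mono) (auto simp: c_def)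
    also have "\<dots> \<le> ?u t1 0"
      using gaussian_wave_origin_lower_bound[OF \<alpha> \<beta> \<epsilon> t(1) _ R, where 'a = "real ^ 'd"] by (simp add: C_def)
    finally have lower: "Z * L \<le> ?u t1 0" .
    define P where "P = Lp_norm 1 (?u t2)"
    have P: "0 < P" "P \<le> L"
      using gaussian_wave_Lp_norm[OF \<alpha> \<beta> \<epsilon> t(2), of 1, where 'd = 'd] n0 by (auto simp: P_def L_def)
    have u: "0 < ?u t1 0" by (rule gaussian_wave_pos[OF \<alpha> \<beta> \<epsilon> t(1)])
    have "Z * P \<le> ?u t1 0"
    proof (cases "0 \<le> Z")
      case True
      then show ?thesis using lower P by (meson mult_left_mono order_trans)
    next
      case False
      then show ?thesis using mult_neg_pos[of Z P] u P by linarith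
    qed
    then show ?case using P by (simp add: P_def le_divide_eq)
  qed
qed

theorem theorem2p3:
  fixes \<alpha> \<beta> :: real
  assumes "0 < \<alpha>" and "\<alpha> < 1" and "0 < \<beta>" and "\<beta> \<le> 2"
  shows "\<exists>u :: nat \<Rightarrow> real \<Rightarrow> real ^ 'd \<Rightarrow> real.
    (\<forall>n\<ge>1. smooth_on ({0<..} \<times> UNIV) (\<lambda>(t, x). u n t x) \<and>
           (\<forall>t>0. \<forall>x. u n t x > 0) \<and>
           time_frac_solution \<alpha> \<beta> (u n)) \<and>
    (\<forall>p t1 t2. t1 > 0 \<longrightarrow> t2 > 0 \<longrightarrow>
       (real CARD('d) > \<beta> \<and> 1 \<le> p \<and> p < real CARD('d) / \<beta>) \<or>
       (real CARD('d) = \<beta> \<and> p = 1) \<longrightarrow>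
       filterlim (\<lambda>n. u n t1 0 / Lp_norm p (u n t2)) at_top sequentially)"
proof (intro exI[of _ "\<lambda>n. gaussian_wave \<alpha> \<beta> (1 / real n)"] conjI allI impI)
  fix n :: nat assume "1 \<le> n"
  then have \<epsilon>: "0 < 1 / real n" by simp
  show "smooth_on ({0<..} \<times> UNIV) (\<lambda>(t, x :: real ^ 'd). gaussian_wave \<alpha> \<beta> (1 / real n) t x)"
    by (rule gaussian_wave_smooth[OF assms \<epsilon>])
  show "0 < gaussian_wave \<alpha> \<beta> (1 / real n) t x" if "0 < t" for t and x :: "real ^ 'd"
    by (rule gaussian_wave_pos[OF assms \<epsilon> that])
  show "time_frac_solution \<alpha> \<beta> (gaussian_wave \<alpha> \<beta> (1 / real n) :: real \<Rightarrow> real ^ 'd \<Rightarrow> real)"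
    by (rule gaussian_wave_solution[OF assms \<epsilon>])
next
  fix p t1 t2 :: real
  assume t: "0 < t1" "0 < t2"
    and "(real CARD('d) > \<beta> \<and> 1 \<le> p \<and> p < real CARD('d) / \<beta>) \<or> (real CARD('d) = \<beta> \<and> p = 1)"
  then consider "1 \<le> p" "p < real CARD('d) / \<beta>" | "real CARD('d) = \<beta>" "p = 1" by blast
  then show "filterlim (\<lambda>n. gaussian_wave \<alpha> \<beta> (1 / real n) t1 (0 :: real ^ 'd)
      / Lp_norm p (gaussian_wave \<alpha> \<beta> (1 / real n) t2 :: real ^ 'd \<Rightarrow> real)) at_top sequentially"
  proof cases
    case 1
    then show ?thesis by (rule ratio_blowup_subcritical[OF assms t])
  next
    case 2
    then show ?thesis using ratio_blowup_critical[OF assms t] by simp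
  qed
qed

end
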